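(* Let $k\ge1$, let $(\Omega_j,\mathcal F_j,H_j,P_j)$, $j\in\{1,\dots,k+1\}$, be projection valued measure spaces, and $P=P_1\otimes\cdots\otimes P_{k+1}$. Let $\varphi\in L^\infty(\Omega_1,P_1)\hat\otimes_i\cdots\hat\otimes_iL^\infty(\Omega_{k+1},P_{k+1})$ and let $(\Sigma,\rho,\varphi_1,\dots,\varphi_{k+1})$ be an $L^\infty_P$-integral projective decomposition of $\varphi$. If $b=(b_1,\dots,b_k)\in B(H_2;H_1)\times\cdots\times B(H_{k+1};H_k)$, $b_{k+1}\in\mathcal S_1(H_1;H_{k+1})$, and $\gamma\in S_{k+1}$ is a cyclic permutation of $\{1,\dots,k+1\}$ (i.e. $\gamma(i)\equiv i+j\bmod (k+1)$ for some fixed integer $j$), then $$\operatorname{Tr}\big(I^{\boldsymbol P}(\Sigma,\rho,\varphi_1,\dots,\varphi_{k+1})[b]\,b_{k+1}\big)=\operatorname{Tr}\big(I^{\boldsymbol P_\gamma}(\Sigma,\rho,\varphi_{\gamma(1)},\dots,\varphi_{\gamma(k+1)})[b_\gamma]\,b_{\gamma(k+1)}\big),$$ where $\boldsymbol P=(P_1,\dots,P_{k+1})$, $\boldsymbol P_\gamma=(P_{\gamma(1)},\dots,P_{\gamma(k+1)})$ and $b_\gamma=(b_{\gamma(1)},\dots,b_{\gamma(k)})$. In particular, the map $$I^{\boldsymbol P}(\Sigma,\rho,\varphi_1,\dots,\varphi_{k+1}):B(H_2;H_1)\times\cdots\times B(H_{k+1};H_k)\to B(H_{k+1};H_1)$$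 is ($k$-linear and) ultraweakly continuous in each argument.
   Context: Hilbert spaces are complex (not assumed separable), inner products linear in the first argument. $\mathcal S_1(H;K)$ is the space of trace class operators $H\to K$. The ultraweak topology on $B(H;K)$ is the weak$^*$ topology from $B(H;K)\cong\mathcal S_1(K;H)^*$ via $A\mapsto(B\mapsto\operatorname{Tr}(AB))$. A projection valued measure space $(\Xi,\mathcal G,K,Q)$: $(\Xi,\mathcal G)$ measurable space, $K$ Hilbert space, $Q:\mathcal G\to B(K)$ with $Q(\Xi)=\mathrm{id}_K$, $Q(G)^2=Q(G)=Q(G)^*$, countably additive in the weak operator topology. $L^\infty(\Xi,Q)$: $Q$-a.e. classes of bounded measurable functions, $\|f\|_{L^\infty(Q)}=\inf\{c\ge0:Q(|f|>c)=0\}$. For $f\in L^\infty(\Xi,Q)$, $Q(f)\in B(K)$ is given by $\langle Q(f)h,k\rangle=\int f\,dQ_{h,k}$, $Q_{h,k}(G)=\langle Q(G)h,k\rangle$. $P=P_1\otimes\cdots\otimes P_{k+1}$ is the unique projection valued measure on $\Omega=\prod_j\Omega_j$ with the product $\sigma$-algebra, acting on the Hilbert space tensor product of the $H_j$, with $P(G_1\times\cdots\times G_{k+1})=P_1(G_1)\otimes\cdots\otimes P_{k+1}(G_{k+1})$. Upper integral of arbitrary $h:\Sigma\to[0,\infty]$: $\overline{\int_\Sigma}h\,d\rho=\inf\{\int\tilde h\,d\rho:h\le\tilde h\ \rho\text{-a.e.},\ \tilde h\text{ measurable}\}$. An $L^\infty_P$-integral projective decomposition of $\varphi:\Omega\to\mathbb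 C$: a tuple $(\Sigma,\rho,\varphi_1,\dots,\varphi_{k+1})$ with $(\Sigma,\mathcal H,\rho)$ $\sigma$-finite, $\varphi_j:\Omega_j\times\Sigma\to\mathbb C$ measurable, (i) $\varphi_j(\cdot,\sigma)\in L^\infty(\Omega_j,P_j)$ for all $j,\sigma$; (ii) $\overline{\int_\Sigma}\prod_{j}\|\varphi_j(\cdot,\sigma)\|_{L^\infty(P_j)}\,\rho(d\sigma)<\infty$; (iii) $\varphi(\omega_1,\dots,\omega_{k+1})=\int_\Sigma\prod_j\varphi_j(\omega_j,\sigma)\,\rho(d\sigma)$ for $P$-a.e. $(\omega_1,\dots,\omega_{k+1})$. $L^\infty(\Omega_1,P_1)\hat\otimes_i\cdots\hat\otimes_iL^\infty(\Omega_{k+1},P_{k+1})$ is the set of $P$-a.e. classes of functions admitting such a decomposition. $I^{\boldsymbol P}(\Sigma,\rho,\varphi_1,\dots,\varphi_{k+1})[b]:=\int_\Sigma P_1(\varphi_1(\cdot,\sigma))\,b_1\cdots P_k(\varphi_k(\cdot,\sigma))\,b_k\,P_{k+1}(\varphi_{k+1}(\cdot,\sigma))\,\rho(d\sigma)\in B(H_{k+1};H_1)$ is a pointwise Pettis integral, i.e. the unique bounded operator $T$ with $\langle Th,h'\rangle=\int_\Sigma\langle F(\sigma)h,h'\rangle\,\rho(d\sigma)$ for all $h\in H_{k+1},h'\in H_1$, $F$ being the integrand (whose matrix coefficients are measurable and integrable). $I^{\boldsymbol P_\gamma}(\Sigma,\rho,\varphi_{\gamma(1)},\dots,\varphi_{\gamma(k+1)})[b_\gamma]$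 is defined in the same way with indices permuted. *)

theory Defs
  imports
    "HOL-Analysis.Analysis"
    "HOL-Algebra.Module"
    "HOL-Number_Theory.Cong"
    "HOL-Combinatorics.Permutations"
begin

section \<open>Complex Hilbert spaces\<close>

text \<open>
  The Hilbert spaces \<open>H\<^sub>1, \<dots>, H\<^sub>k\<^sub>+\<^sub>1\<close> form a family of varying length whose members
  are unrelated to each other, so a Hilbert space is a record with an explicit carrier set.  It
  extends the records of HOL-Algebra; as for every module there, the ring fields
  \<open>mult\<close> and \<open>one\<close> of the record carry no meaning.
\<close>

definition complex_ring :: "complex ring" where
  "complex_ring = \<lparr>carrier = UNIV, monoid.mult = (*), one = 1, zero = 0, add = (+)\<rparr>"

record 'a hilb = "(complex, 'a) module" +
  hinner :: "'a \<Rightarrow> 'a \<Rightarrow> complex"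

definition hnorm :: "'a hilb \<Rightarrow> 'a \<Rightarrow> real" where
  "hnorm H x = sqrt (Re (hinner H x x))"

locale hilbert_space =
  fixes H :: "'a hilb" (structure)
  assumes complex_module: "Module.module complex_ring H"
    and hinner_add_left: "\<And>x y z. \<lbrakk>x \<in> carrier H; y \<in> carrier H; z \<in> carrier H\<rbrakk>
      \<Longrightarrow> hinner H (x \<oplus> y) z = hinner H x z + hinner H y z"
    and hinner_smult_left: "\<And>a x y. \<lbrakk>x \<in> carrier H; y \<in> carrier H\<rbrakk>
      \<Longrightarrow> hinner H (a \<odot> x) y = a * hinner H x y"
    and hinner_commute: "\<And>x y. \<lbrakk>x \<in> carrier H; y \<in> carrier H\<rbrakk>
      \<Longrightarrow> hinner H x y = cnj (hinner H y x)"
    and hinner_nonneg: "\<And>x. x \<in> carrier H \<Longrightarrow> 0 \<le> Re (hinner H x x)"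
    and hinner_eq_zero: "\<And>x. \<lbrakk>x \<in> carrier H; hinner H x x = 0\<rbrakk> \<Longrightarrow> x = \<zero>"
    and complete: "\<And>s :: nat \<Rightarrow> 'a. \<lbrakk>range s \<subseteq> carrier H;
        \<forall>e>0. \<exists>N. \<forall>m\<ge>N. \<forall>n\<ge>N. hnorm H (s m \<ominus> s n) < e\<rbrakk>
      \<Longrightarrow> \<exists>l\<in>carrier H. (\<lambda>n. hnorm H (s n \<ominus> l)) \<longlonglongrightarrow> 0"

text \<open>The linear span of \<open>S\<close> is norm dense.\<close>

definition total_in :: "'a hilb \<Rightarrow> 'a set \<Rightarrow> bool" where
  "total_in H S \<longleftrightarrow> S \<subseteq> carrier H \<and>
     (\<forall>x\<in>carrier H. \<forall>e>0. \<exists>F c. finite F \<and> F \<subseteq> S \<and>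
        hnorm H (x \<ominus>\<^bsub>H\<^esub> (\<Oplus>\<^bsub>H\<^esub>v\<in>F. c v \<odot>\<^bsub>H\<^esub> v)) < e)"

definition orthonormal_basis :: "'a hilb \<Rightarrow> 'a set \<Rightarrow> bool" where
  "orthonormal_basis H E \<longleftrightarrow> total_in H E \<and>
     (\<forall>e\<in>E. \<forall>f\<in>E. hinner H e f = (if e = f then 1 else 0))"


section \<open>Bounded and trace class operators\<close>

text \<open>
  Operators are extensional functions on the carrier of their domain, so that equality of
  operators is equality in HOL; composition is \<open>compose\<close> of \<open>HOL-Library.FuncSet\<close>.
\<close>

definition bounded_ops :: "'a hilb \<Rightarrow> 'b hilb \<Rightarrow> ('a \<Rightarrow> 'b) set" where
  "bounded_ops H K = {A \<in> carrier H \<rightarrow>\<^sub>E carrier K.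
     (\<forall>x\<in>carrier H. \<forall>y\<in>carrier H. A (x \<oplus>\<^bsub>H\<^esub> y) = A x \<oplus>\<^bsub>K\<^esub> A y) \<and>
     (\<forall>a. \<forall>x\<in>carrier H. A (a \<odot>\<^bsub>H\<^esub> x) = a \<odot>\<^bsub>K\<^esub> A x) \<and>
     (\<exists>C. \<forall>x\<in>carrier H. hnorm K (A x) \<le> C * hnorm H x)}"

definition op_id :: "'a hilb \<Rightarrow> 'a \<Rightarrow> 'a" where
  "op_id H = (\<lambda>x\<in>carrier H. x)"

definition op_zero :: "'a hilb \<Rightarrow> 'b hilb \<Rightarrow> 'a \<Rightarrow> 'b" where
  "op_zero H K = (\<lambda>x\<in>carrier H. \<zero>\<^bsub>K\<^esub>)"

definition op_add :: "'a hilb \<Rightarrow> 'b hilb \<Rightarrow> ('a \<Rightarrow> 'b) \<Rightarrow> ('a \<Rightarrow> 'b) \<Rightarrow> 'a \<Rightarrow> 'b" where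
  "op_add H K A B = (\<lambda>x\<in>carrier H. A x \<oplus>\<^bsub>K\<^esub> B x)"

definition op_scale :: "'a hilb \<Rightarrow> 'b hilb \<Rightarrow> complex \<Rightarrow> ('a \<Rightarrow> 'b) \<Rightarrow> 'a \<Rightarrow> 'b" where
  "op_scale H K a A = (\<lambda>x\<in>carrier H. a \<odot>\<^bsub>K\<^esub> A x)"

definition op_adjoint :: "'a hilb \<Rightarrow> 'b hilb \<Rightarrow> ('a \<Rightarrow> 'b) \<Rightarrow> 'b \<Rightarrow> 'a" where
  "op_adjoint H K A = (THE B. B \<in> bounded_ops K H \<and>
     (\<forall>x\<in>carrier H. \<forall>y\<in>carrier K. hinner K (A x) y = hinner H x (B y)))"

definition positive_op :: "'a hilb \<Rightarrow> ('a \<Rightarrow> 'a) \<Rightarrow> bool" where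
  "positive_op H A \<longleftrightarrow> A \<in> bounded_ops H H \<and>
     (\<forall>x\<in>carrier H. Im (hinner H (A x) x) = 0 \<and> 0 \<le> Re (hinner H (A x) x))"

text \<open>\<open>\<bar>A\<bar> = (A\<^sup>* A)\<^bsup>1/2\<^esup>\<close>, the unique positive square root.\<close>

definition op_abs :: "'a hilb \<Rightarrow> 'b hilb \<Rightarrow> ('a \<Rightarrow> 'b) \<Rightarrow> 'a \<Rightarrow> 'a" where
  "op_abs H K A = (THE R. positive_op H R \<and>
     compose (carrier H) R R = compose (carrier H) (op_adjoint H K A) A)"

text \<open>
  \<open>A\<close> is trace class if \<open>Tr \<bar>A\<bar> < \<infinity>\<close>.  The value of \<open>Tr \<bar>A\<bar>\<close> in \<open>[0, \<infinity>]\<close>, and that of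
  \<open>Tr A\<close> for trace class \<open>A\<close>, does not depend on the orthonormal basis.
\<close>

definition trace_class :: "'a hilb \<Rightarrow> 'b hilb \<Rightarrow> ('a \<Rightarrow> 'b) set" where
  "trace_class H K = {A \<in> bounded_ops H K.
     \<exists>E. orthonormal_basis H E \<and> (\<lambda>e. Re (hinner H (op_abs H K A e) e)) summable_on E}"

definition op_trace :: "'a hilb \<Rightarrow> ('a \<Rightarrow> 'a) \<Rightarrow> complex" where
  "op_trace H A = (\<Sum>\<^sub>\<infinity>e\<in>(SOME E. orthonormal_basis H E). hinner H (A e) e)"

text \<open>
  The weak* topology on \<open>B(H;K)\<close> as the dual of \<open>S\<^sub>1(K;H)\<close>: pointwise convergence of the
  functionals \<open>B \<mapsto> Tr(AB)\<close>.
\<close>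

definition ultraweak_topology :: "'a hilb \<Rightarrow> 'b hilb \<Rightarrow> ('a \<Rightarrow> 'b) topology" where
  "ultraweak_topology H K = pullback_topology (bounded_ops H K)
     (\<lambda>A. \<lambda>B\<in>trace_class K H. op_trace K (compose (carrier K) A B))
     (product_topology (\<lambda>B. euclidean) (trace_class K H))"


section \<open>Projection valued measures\<close>

text \<open>Of \<open>M :: 'w measure\<close> only the underlying measurable space \<open>(space M, sets M)\<close> matters.\<close>

definition pvm_space :: "'w measure \<Rightarrow> 'a hilb \<Rightarrow> ('w set \<Rightarrow> 'a \<Rightarrow> 'a) \<Rightarrow> bool" where
  "pvm_space M K Q \<longleftrightarrow> hilbert_space K \<and>
     (\<forall>G\<in>sets M. Q G \<in> bounded_ops K K \<and>
        compose (carrier K) (Q G) (Q G) = Q G \<and> op_adjoint K K (Q G) = Q G) \<and>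
     Q (space M) = op_id K \<and>
     (\<forall>G :: nat \<Rightarrow> 'w set. range G \<subseteq> sets M \<and> disjoint_family G \<longrightarrow>
        (\<forall>x\<in>carrier K. \<forall>y\<in>carrier K.
           (\<lambda>n. hinner K (Q (G n) x) y) sums hinner K (Q (\<Union>n. G n) x) y))"

text \<open>
  Integral against a complex measure \<open>\<nu>\<close>: write \<open>\<nu> = \<mu>\<^sub>0 + \<i> \<mu>\<^sub>1 - \<mu>\<^sub>2 - \<i> \<mu>\<^sub>3\<close> with finite positive
  measures and integrate termwise; the result does not depend on the decomposition.
\<close>

definition complex_measure_integral ::
    "'w measure \<Rightarrow> ('w set \<Rightarrow> complex) \<Rightarrow> ('w \<Rightarrow> complex) \<Rightarrow> complex" where
  "complex_measure_integral M \<nu> f = (THE I. \<exists>\<mu> :: nat \<Rightarrow> 'w measure.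
     (\<forall>n<4. finite_measure (\<mu> n) \<and> sets (\<mu> n) = sets M \<and> integrable (\<mu> n) f) \<and>
     (\<forall>G\<in>sets M. \<nu> G = (\<Sum>n<4. \<i> ^ n * complex_of_real (measure (\<mu> n) G))) \<and>
     I = (\<Sum>n<4. \<i> ^ n * (\<integral>w. f w \<partial>\<mu> n)))"

definition pvm_integral ::
    "'w measure \<Rightarrow> 'a hilb \<Rightarrow> ('w set \<Rightarrow> 'a \<Rightarrow> 'a) \<Rightarrow> ('w \<Rightarrow> complex) \<Rightarrow> 'a \<Rightarrow> 'a" where
  "pvm_integral M K Q f = (THE A. A \<in> bounded_ops K K \<and>
     (\<forall>x\<in>carrier K. \<forall>y\<in>carrier K.
        hinner K (A x) y = complex_measure_integral M (\<lambda>G. hinner K (Q G x) y) f))"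

text \<open>
  Representatives of the elements of \<open>L\<^sup>\<infinity>(Q)\<close>: measurable functions that agree
  \<open>Q\<close>-almost everywhere with a bounded measurable function.
\<close>

definition Linf :: "'w measure \<Rightarrow> 'a hilb \<Rightarrow> ('w set \<Rightarrow> 'a \<Rightarrow> 'a) \<Rightarrow> ('w \<Rightarrow> complex) set" where
  "Linf M K Q = {f \<in> borel_measurable M. \<exists>g \<in> borel_measurable M.
     bounded (g ` space M) \<and> Q {w \<in> space M. f w \<noteq> g w} = op_zero K K}"

definition Linf_norm ::
    "'w measure \<Rightarrow> 'a hilb \<Rightarrow> ('w set \<Rightarrow> 'a \<Rightarrow> 'a) \<Rightarrow> ('w \<Rightarrow> complex) \<Rightarrow> real" where
  "Linf_norm M K Q f = Inf {c. 0 \<le> c \<and> Q {w \<in> space M. c < cmod (f w)} = op_zero K K}"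

text \<open>
  \<open>T\<close> together with \<open>\<tau> x = x\<^sub>1 \<otimes> \<dots> \<otimes> x\<^sub>n\<close> is a Hilbert space tensor product of the family \<open>H\<close>;
  this determines \<open>(T, \<tau>)\<close> up to a unique unitary isomorphism.
\<close>

definition hilbert_tensor_product ::
    "'i set \<Rightarrow> ('i \<Rightarrow> 'a hilb) \<Rightarrow> 't hilb \<Rightarrow> (('i \<Rightarrow> 'a) \<Rightarrow> 't) \<Rightarrow> bool" where
  "hilbert_tensor_product I H T \<tau> \<longleftrightarrow> hilbert_space T \<and>
     \<tau> \<in> (\<Pi>\<^sub>E i\<in>I. carrier (H i)) \<rightarrow> carrier T \<and>
     (\<forall>x \<in> (\<Pi>\<^sub>E i\<in>I. carrier (H i)). \<forall>i\<in>I. \<forall>u\<in>carrier (H i). \<forall>v\<in>carrier (H i).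
        \<tau> (x(i := u \<oplus>\<^bsub>H i\<^esub> v)) = \<tau> (x(i := u)) \<oplus>\<^bsub>T\<^esub> \<tau> (x(i := v))) \<and>
     (\<forall>x \<in> (\<Pi>\<^sub>E i\<in>I. carrier (H i)). \<forall>i\<in>I. \<forall>a. \<forall>u\<in>carrier (H i).
        \<tau> (x(i := a \<odot>\<^bsub>H i\<^esub> u)) = a \<odot>\<^bsub>T\<^esub> \<tau> (x(i := u))) \<and>
     (\<forall>x \<in> (\<Pi>\<^sub>E i\<in>I. carrier (H i)). \<forall>y \<in> (\<Pi>\<^sub>E i\<in>I. carrier (H i)).
        hinner T (\<tau> x) (\<tau> y) = (\<Prod>i\<in>I. hinner (H i) (x i) (y i))) \<and>
     total_in T (\<tau> ` (\<Pi>\<^sub>E i\<in>I. carrier (H i)))"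

text \<open>
  \<open>Q\<close> is the projection valued measure \<open>P\<^sub>1 \<otimes> \<dots> \<otimes> P\<^sub>n\<close> on the product \<open>\<sigma>\<close>-algebra.  The operator
  \<open>P\<^sub>1(G\<^sub>1) \<otimes> \<dots> \<otimes> P\<^sub>n(G\<^sub>n)\<close> is specified by its values on elementary tensors.
\<close>

definition product_pvm ::
    "'i set \<Rightarrow> ('i \<Rightarrow> 'w measure) \<Rightarrow> ('i \<Rightarrow> 'a hilb) \<Rightarrow> ('i \<Rightarrow> 'w set \<Rightarrow> 'a \<Rightarrow> 'a) \<Rightarrow>
     't hilb \<Rightarrow> (('i \<Rightarrow> 'a) \<Rightarrow> 't) \<Rightarrow> (('i \<Rightarrow> 'w) set \<Rightarrow> 't \<Rightarrow> 't) \<Rightarrow> bool" where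
  "product_pvm I \<Omega> H P T \<tau> Q \<longleftrightarrow> pvm_space (Pi\<^sub>M I \<Omega>) T Q \<and>
     (\<forall>G \<in> (\<Pi> i\<in>I. sets (\<Omega> i)). \<forall>x \<in> (\<Pi>\<^sub>E i\<in>I. carrier (H i)).
        Q (\<Pi>\<^sub>E i\<in>I. G i) (\<tau> x) = \<tau> (\<lambda>i\<in>I. P i (G i) (x i)))"


section \<open>Integral projective decompositions\<close>

definition upper_integral :: "'s measure \<Rightarrow> ('s \<Rightarrow> ennreal) \<Rightarrow> ennreal" where
  "upper_integral \<rho> h =
     (INF g \<in> {g \<in> borel_measurable \<rho>. AE s in \<rho>. h s \<le> g s}. \<integral>\<^sup>+ s. g s \<partial>\<rho>)"

definition integral_projective_decomposition ::
    "'i set \<Rightarrow> ('i \<Rightarrow> 'w measure) \<Rightarrow> ('i \<Rightarrow> 'a hilb) \<Rightarrow> ('i \<Rightarrow> 'w set \<Rightarrow> 'a \<Rightarrow> 'a) \<Rightarrow>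
     't hilb \<Rightarrow> (('i \<Rightarrow> 'w) set \<Rightarrow> 't \<Rightarrow> 't) \<Rightarrow> (('i \<Rightarrow> 'w) \<Rightarrow> complex) \<Rightarrow>
     's measure \<Rightarrow> ('i \<Rightarrow> 'w \<times> 's \<Rightarrow> complex) \<Rightarrow> bool" where
  "integral_projective_decomposition I \<Omega> H P T Q \<phi> \<rho> \<phi>s \<longleftrightarrow>
     sigma_finite_measure \<rho> \<and>
     (\<forall>i\<in>I. \<phi>s i \<in> borel_measurable (\<Omega> i \<Otimes>\<^sub>M \<rho>)) \<and>
     (\<forall>i\<in>I. \<forall>s\<in>space \<rho>. (\<lambda>w. \<phi>s i (w, s)) \<in> Linf (\<Omega> i) (H i) (P i)) \<and>
     upper_integral \<rho>
       (\<lambda>s. \<Prod>i\<in>I. ennreal (Linf_norm (\<Omega> i) (H i) (P i) (\<lambda>w. \<phi>s i (w, s)))) < \<infinity> \<and>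
     (\<exists>N \<in> sets (Pi\<^sub>M I \<Omega>). Q N = op_zero T T \<and>
        (\<forall>w \<in> space (Pi\<^sub>M I \<Omega>) - N.
           has_bochner_integral \<rho> (\<lambda>s. \<Prod>i\<in>I. \<phi>s i (w i, s)) (\<phi> w)))"


section \<open>Multiple operator integrals\<close>

definition has_pettis_integral ::
    "'a hilb \<Rightarrow> 'b hilb \<Rightarrow> 's measure \<Rightarrow> ('s \<Rightarrow> 'a \<Rightarrow> 'b) \<Rightarrow> ('a \<Rightarrow> 'b) \<Rightarrow> bool" where
  "has_pettis_integral H K \<rho> F A \<longleftrightarrow> A \<in> bounded_ops H K \<and>
     (\<forall>x\<in>carrier H. \<forall>y\<in>carrier K.
        has_bochner_integral \<rho> (\<lambda>s. hinner K (F s x) y) (hinner K (A x) y))"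

definition pettis_integral ::
    "'a hilb \<Rightarrow> 'b hilb \<Rightarrow> 's measure \<Rightarrow> ('s \<Rightarrow> 'a \<Rightarrow> 'b) \<Rightarrow> 'a \<Rightarrow> 'b" where
  "pettis_integral H K \<rho> F = (THE A. has_pettis_integral H K \<rho> F A)"

text \<open>
  \<open>alternating_product H A b n = A\<^sub>1 b\<^sub>1 A\<^sub>2 b\<^sub>2 \<dots> A\<^sub>n b\<^sub>n A\<^sub>n\<^sub>+\<^sub>1\<close>, where \<open>A\<^sub>j \<in> B(H\<^sub>j)\<close> and
  \<open>b\<^sub>j \<in> B(H\<^sub>j\<^sub>+\<^sub>1;H\<^sub>j)\<close>.
\<close>

primrec alternating_product ::
    "(nat \<Rightarrow> 'a hilb) \<Rightarrow> (nat \<Rightarrow> 'a \<Rightarrow> 'a) \<Rightarrow> (nat \<Rightarrow> 'a \<Rightarrow> 'a) \<Rightarrow> nat \<Rightarrow> 'a \<Rightarrow> 'a" where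
  "alternating_product H A b 0 = A 1"
| "alternating_product H A b (Suc n) =
     compose (carrier (H (n + 2))) (alternating_product H A b n)
       (compose (carrier (H (n + 2))) (b (n + 1)) (A (n + 2)))"

definition moi_integrand ::
    "nat \<Rightarrow> (nat \<Rightarrow> 'w measure) \<Rightarrow> (nat \<Rightarrow> 'a hilb) \<Rightarrow> (nat \<Rightarrow> 'w set \<Rightarrow> 'a \<Rightarrow> 'a) \<Rightarrow>
     (nat \<Rightarrow> 'w \<times> 's \<Rightarrow> complex) \<Rightarrow> (nat \<Rightarrow> 'a \<Rightarrow> 'a) \<Rightarrow> 's \<Rightarrow> 'a \<Rightarrow> 'a" where
  "moi_integrand k \<Omega> H P \<phi>s b s = alternating_product H
     (\<lambda>j. pvm_integral (\<Omega> j) (H j) (P j) (\<lambda>w. \<phi>s j (w, s))) b k"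

text \<open>The operator \<open>I\<^sup>P(\<Sigma>,\<rho>,\<phi>\<^sub>1,\<dots>,\<phi>\<^sub>k\<^sub>+\<^sub>1)[b]\<close>; all families are indexed by \<open>{1..k+1}\<close>.\<close>

definition moi ::
    "nat \<Rightarrow> (nat \<Rightarrow> 'w measure) \<Rightarrow> (nat \<Rightarrow> 'a hilb) \<Rightarrow> (nat \<Rightarrow> 'w set \<Rightarrow> 'a \<Rightarrow> 'a) \<Rightarrow>
     's measure \<Rightarrow> (nat \<Rightarrow> 'w \<times> 's \<Rightarrow> complex) \<Rightarrow> (nat \<Rightarrow> 'a \<Rightarrow> 'a) \<Rightarrow> 'a \<Rightarrow> 'a" where
  "moi k \<Omega> H P \<rho> \<phi>s b =
     pettis_integral (H (k + 1)) (H 1) \<rho> (moi_integrand k \<Omega> H P \<phi>s b)"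

definition cyclic_permutation :: "nat \<Rightarrow> (nat \<Rightarrow> nat) \<Rightarrow> bool" where
  "cyclic_permutation n \<gamma> \<longleftrightarrow> \<gamma> permutes {1..n} \<and>
     (\<exists>j::int. \<forall>i\<in>{1..n}. [int (\<gamma> i) = int i + j] (mod int n))"

end

theory Submission
  imports Defs
begin

text \<open>
  All \<open>H\<^sub>j\<close> are embedded into one Hilbert space, where the integrand of \<open>I\<^sup>P[b] b\<^sub>k\<^sub>+\<^sub>1\<close> is the product of
  the factors \<open>P\<^sub>i(\<phi>\<^sub>i(\<cdot>,\<sigma>)) b\<^sub>i\<close>.  Cutting the product at the cyclic shift writes the two integrands as
  \<open>M(\<sigma>) L(\<sigma>) b\<^sub>k\<^sub>+\<^sub>1\<close> and \<open>L(\<sigma>) b\<^sub>k\<^sub>+\<^sub>1 M(\<sigma>)\<close>.  With \<open>b\<^sub>k\<^sub>+\<^sub>1 = \<Sum>\<^sub>n \<langle>\<cdot>, u\<^sub>n\<rangle> v\<^sub>n\<close>, both traces equal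
  \<open>\<integral> \<Sum>\<^sub>n \<langle>M(\<sigma>) L(\<sigma>) v\<^sub>n, u\<^sub>n\<rangle> \<rho>(d\<sigma>)\<close>.  For the second one the sum over an orthonormal basis has to be
  interchanged with the integral, which is not allowed for weakly measurable integrands in a nonseparable
  space.  It is allowed here because \<open>L(\<sigma>) v\<^sub>n\<close> stays in a separable subspace, by a monotone class
  argument that uses the joint measurability of the \<open>\<phi>\<^sub>i\<close>.  That the integrals are trace class follows from
  the description of the trace norm as a supremum over contractions.  The same computation gives
  \<open>Tr(I\<^sup>P[\<dots>,c,\<dots>] B) = Tr(c D)\<close> with a trace class operator \<open>D\<close> that does not depend on \<open>c\<close>, and hence
  ultraweak continuity.
\<close>

section \<open>Complex Hilbert spaces as a type class\<close>

text \<open>All H_j share the element type \<open>'h\<close>, and a basis of each is a set of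
  elements of that type; so \<open>'h ell2\<close> contains an isometric copy of every H_j, and
  products of operators between different spaces become products of operators on one type. The
  price: every operator constructed there must be shown to map into the right subspace and to vanish
  on the right complement before it can be taken back.

  In a nonseparable space operator norms need not be measurable in \<sigma>. Domination is therefore
  by an integrable g obtained from the upper integral, and the bounds of the two halves of a product
  are chosen pointwise, with only their product controlled by g. Constants are immaterial for this,
  which is why the bound for P_i(\<phi>_i) may carry a factor 4 from polarization.

  The series for the trace class operator is indexed by nat even when the space has an uncountable
  basis: the root of its absolute value is nonzero on only countably many basis vectors.
  Countability is what allows dominated convergence to act on the series. Since the trace is defined
  with a basis that is merely chosen, its value has to be computed for every orthonormal
  basis.\<close>

class chilbert = real_inner + banach +
  fixes scaleC :: "complex \<Rightarrow> 'a \<Rightarrow> 'a" (infixr "*\<^sub>C" 75)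
    and cinner :: "'a \<Rightarrow> 'a \<Rightarrow> complex"
  assumes scaleC_add_right: "a *\<^sub>C (x + y) = a *\<^sub>C x + a *\<^sub>C y"
    and scaleC_add_left: "(a + b) *\<^sub>C x = a *\<^sub>C x + b *\<^sub>C x"
    and scaleC_scaleC: "a *\<^sub>C (b *\<^sub>C x) = (a * b) *\<^sub>C x"
    and scaleC_of_real: "complex_of_real r *\<^sub>C x = r *\<^sub>R x"
    and cinner_add_left: "cinner (x + y) z = cinner x z + cinner y z"
    and cinner_scaleC_left: "cinner (a *\<^sub>C x) y = a * cinner x y"
    and cinner_commute: "cinner x y = cnj (cinner y x)"
    and Re_cinner: "Re (cinner x y) = inner x y"

section \<open>Elementary rules for complex scalars and the inner product\<close>

lemma scaleC_one [simp]: "1 *\<^sub>C x = (x::'a::chilbert)"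
  using scaleC_of_real[of 1 x] by simp

lemma scaleC_0_left [simp]: "0 *\<^sub>C x = (0::'a::chilbert)"
  using scaleC_of_real[of 0 x] by simp

lemma scaleC_0_right [simp]: "a *\<^sub>C 0 = (0::'a::chilbert)"
  using scaleC_add_right[of a 0 0] by simp

lemma scaleC_minus_right: "a *\<^sub>C (- x) = - (a *\<^sub>C (x::'a::chilbert))"
  using scaleC_add_right[of a x "-x"] by (simp add: eq_neg_iff_add_eq_0 add.commute)

lemma scaleC_diff_right: "a *\<^sub>C (x - y) = a *\<^sub>C x - a *\<^sub>C (y::'a::chilbert)"
  using scaleC_add_right[of a x "-y"] by (simp add: scaleC_minus_right)

lemma scaleC_minus1 [simp]: "(-1) *\<^sub>C x = - (x::'a::chilbert)"
  using scaleC_of_real[of "-1" x] by simp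

lemma cinner_add_right: "cinner x (y + z) = cinner x y + cinner x (z::'a::chilbert)"
  by (metis cinner_add_left cinner_commute complex_cnj_add)

lemma cinner_scaleC_right: "cinner x (a *\<^sub>C y) = cnj a * cinner x (y::'a::chilbert)"
  by (metis cinner_scaleC_left cinner_commute complex_cnj_mult)

lemma cinner_scaleR_left: "cinner (r *\<^sub>R x) y = r *\<^sub>R cinner x (y::'a::chilbert)"
  by (metis cinner_scaleC_left scaleC_of_real scaleR_conv_of_real)

lemma cinner_scaleR_right: "cinner x (r *\<^sub>R y) = r *\<^sub>R cinner x (y::'a::chilbert)"
  by (metis cinner_scaleC_right complex_cnj_complex_of_real scaleC_of_real scaleR_conv_of_real)

lemma cinner_self: "cinner x x = complex_of_real ((norm (x::'a::chilbert))\<^sup>2)"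
proof -
  have "Im (cinner x x) = 0"
    using arg_cong[OF cinner_commute[of x x], of Im] by simp
  then show ?thesis
    by (simp add: complex_eq_iff Re_cinner power2_norm_eq_inner)
qed

lemma norm_scaleC [simp]: "norm (a *\<^sub>C x) = cmod a * norm (x::'a::chilbert)"
proof -
  have "complex_of_real ((norm (a *\<^sub>C x))\<^sup>2) = a * cnj a * complex_of_real ((norm x)\<^sup>2)"
    by (simp only: cinner_self[symmetric] cinner_scaleC_left cinner_scaleC_right mult_ac)
  also have "\<dots> = complex_of_real ((cmod a * norm x)\<^sup>2)"
    by (simp only: complex_norm_square[symmetric] power_mult_distrib of_real_mult)
  finally have "(norm (a *\<^sub>C x))\<^sup>2 = (cmod a * norm x)\<^sup>2"
    using of_real_eq_iff by blast
  then show ?thesis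
    by (simp add: power2_eq_iff_nonneg)
qed

lemma cmod_cinner_le: "cmod (cinner x y) \<le> norm x * norm (y::'a::chilbert)"
proof (cases "cinner x y = 0")
  case False
  \<comment> \<open>The unimodular factor u turns the inner product into its modulus and reduces the
    claim to the real Cauchy-Schwarz inequality.\<close>
  define u where "u = cnj (sgn (cinner x y))"
  have u: "cmod u = 1" using False by (simp add: u_def norm_sgn)
  have "cinner (u *\<^sub>C x) y = cnj (sgn (cinner x y)) * (cmod (cinner x y) * sgn (cinner x y))"
    by (simp add: cinner_scaleC_left u_def sgn_eq)
  also have "\<dots> = complex_of_real (cmod (cinner x y)) * (sgn (cinner x y) * cnj (sgn (cinner x y)))"
    by (simp add: mult_ac)
  also have "\<dots> = complex_of_real (cmod (cinner x y))"
    using False by (simp only: complex_norm_square[symmetric]) (simp add: norm_sgn)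
  finally have "cinner (u *\<^sub>C x) y = complex_of_real (cmod (cinner x y))" .
  then have "cmod (cinner x y) = inner (u *\<^sub>C x) y"
    by (metis Re_cinner Re_complex_of_real)
  also have "\<dots> \<le> norm (u *\<^sub>C x) * norm y" by (rule norm_cauchy_schwarz)
  finally show ?thesis by (simp add: u)
qed simp

lemma bounded_bilinear_cinner:
  "bounded_bilinear (cinner :: 'a::chilbert \<Rightarrow> 'a \<Rightarrow> complex)"
  by (unfold_locales) (auto simp: cinner_add_left cinner_add_right cinner_scaleR_left cinner_scaleR_right
     intro!: exI[of _ 1] cmod_cinner_le)

interpretation cinner: bounded_bilinear "cinner :: 'a::chilbert \<Rightarrow> 'a \<Rightarrow> complex"
  by (rule bounded_bilinear_cinner)

lemma bounded_linear_scaleC: "bounded_linear (\<lambda>x::'a::chilbert. a *\<^sub>C x)"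
proof (rule bounded_linear_intro[of _ "cmod a"])
  show "a *\<^sub>C r *\<^sub>R x = r *\<^sub>R a *\<^sub>C x" for r and x :: 'a
    by (metis mult.commute scaleC_of_real scaleC_scaleC)
qed (auto simp: scaleC_add_right)

lemmas scaleC_sum_right = linear_sum[OF bounded_linear.linear[OF bounded_linear_scaleC]]
lemmas tendsto_scaleC = bounded_linear.tendsto[OF bounded_linear_scaleC]

lemma cinner_ext: "(\<And>z. cinner x z = cinner y z) \<Longrightarrow> x = (y::'a::chilbert)"
proof -
  assume "\<And>z. cinner x z = cinner y z"
  then have "cinner (x - y) (x - y) = 0" by (simp add: cinner.diff_left)
  then show ?thesis by (simp add: cinner_self)
qed

lemma norm_le_by_cinner:
  assumes "\<And>y. cmod (cinner x y) \<le> C * norm y" and "0 \<le> C"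
  shows "norm (x::'a::chilbert) \<le> C"
proof (cases "x = 0")
  case False
  have "(norm x)\<^sup>2 \<le> C * norm x"
    using assms(1)[of x] by (simp add: cinner_self norm_power)
  then show ?thesis using False by (simp add: power2_eq_square)
qed (use assms(2) in simp)

declare cinner.zero_left [simp] cinner.zero_right [simp]

section \<open>Bounded complex linear maps\<close>

definition bounded_clinear :: "('a::chilbert \<Rightarrow> 'b::chilbert) \<Rightarrow> bool" where
  "bounded_clinear f \<longleftrightarrow> bounded_linear f \<and> (\<forall>a x. f (a *\<^sub>C x) = a *\<^sub>C f x)"

lemma bounded_clinear_imp_bounded_linear: "bounded_clinear f \<Longrightarrow> bounded_linear f"
  by (simp add: bounded_clinear_def)

lemma bounded_clinear_scaleC: "bounded_clinear f \<Longrightarrow> f (a *\<^sub>C x) = a *\<^sub>C f x"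
  by (simp add: bounded_clinear_def)

lemma bounded_clinear_add: "bounded_clinear f \<Longrightarrow> f (x + y) = f x + f y"
  by (simp add: bounded_clinear_def bounded_linear.linear linear_add)

lemma bounded_clinear_diff: "bounded_clinear f \<Longrightarrow> f (x - y) = f x - f y"
  by (simp add: bounded_clinear_def bounded_linear.linear linear_diff)

lemma bounded_clinear_zero: "bounded_clinear f \<Longrightarrow> f 0 = 0"
  by (simp add: bounded_clinear_def bounded_linear.linear linear_0)

lemma bounded_clinear_bound:
  assumes "bounded_clinear f" obtains K where "0 < K" "\<And>x. norm (f x) \<le> K * norm x"
  using bounded_linear.pos_bounded[OF bounded_clinear_imp_bounded_linear[OF assms]]
  by (metis mult.commute)

lemma bounded_clinear_intro:
  assumes "\<And>x y. f (x + y) = f x + f y" "\<And>a x. f (a *\<^sub>C x) = a *\<^sub>C f x"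
    and "\<And>x. norm (f x) \<le> K * norm x"
  shows "bounded_clinear f"
  unfolding bounded_clinear_def
proof (intro conjI allI bounded_linear_intro[of _ K])
  show "f (r *\<^sub>R x) = r *\<^sub>R f x" for r x
    using assms(2)[of "complex_of_real r" x] by (simp add: scaleC_of_real)
qed (use assms in \<open>auto simp: mult.commute\<close>)

lemma bounded_clinear_ident [simp]: "bounded_clinear (\<lambda>x. x)"
  by (simp add: bounded_clinear_def bounded_linear_ident)

lemma bounded_clinear_compose:
  "bounded_clinear f \<Longrightarrow> bounded_clinear g \<Longrightarrow> bounded_clinear (\<lambda>x. f (g x))"
  by (simp add: bounded_clinear_def bounded_linear_compose)

lemma bounded_clinear_plus:
  "bounded_clinear f \<Longrightarrow> bounded_clinear g \<Longrightarrow> bounded_clinear (\<lambda>x. f x + g x)"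
  by (simp add: bounded_clinear_def bounded_linear_add scaleC_add_right)

lemma bounded_clinear_minus:
  "bounded_clinear f \<Longrightarrow> bounded_clinear g \<Longrightarrow> bounded_clinear (\<lambda>x. f x - g x)"
  by (simp add: bounded_clinear_def bounded_linear_sub scaleC_diff_right)

lemma bounded_clinear_scale:
  "bounded_clinear f \<Longrightarrow> bounded_clinear (\<lambda>x. a *\<^sub>C f x)"
  by (simp add: bounded_clinear_def bounded_linear_compose[OF bounded_linear_scaleC] scaleC_scaleC mult.commute)


subsection \<open>Closed subspaces and orthogonal projections\<close>

definition csubspace :: "'a::chilbert set \<Rightarrow> bool" where
  "csubspace V \<longleftrightarrow> 0 \<in> V \<and> (\<forall>x\<in>V. \<forall>y\<in>V. x + y \<in> V) \<and> (\<forall>a. \<forall>x\<in>V. a *\<^sub>C x \<in> V)"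

lemma csubspaceD:
  assumes "csubspace V"
  shows "0 \<in> V" "x \<in> V \<Longrightarrow> y \<in> V \<Longrightarrow> x + y \<in> V" "x \<in> V \<Longrightarrow> a *\<^sub>C x \<in> V"
    "x \<in> V \<Longrightarrow> r *\<^sub>R x \<in> V" "x \<in> V \<Longrightarrow> y \<in> V \<Longrightarrow> x - y \<in> V"
proof -
  show "0 \<in> V" and add: "x \<in> V \<Longrightarrow> y \<in> V \<Longrightarrow> x + y \<in> V" and sc: "x \<in> V \<Longrightarrow> a *\<^sub>C x \<in> V" for x y a
    using assms by (auto simp: csubspace_def)
  show "x \<in> V \<Longrightarrow> r *\<^sub>R x \<in> V" for x r
    using sc[of x "complex_of_real r"] by (simp add: scaleC_of_real)
  show "x - y \<in> V" if "x \<in> V" "y \<in> V" for x y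
    using add[OF that(1) sc[OF that(2), of "-1"]] by simp
qed

lemma csubspace_sum:
  assumes "csubspace V" "\<And>i. i \<in> I \<Longrightarrow> f i \<in> V" shows "sum f I \<in> V"
  using assms(2) by (induction I rule: infinite_finite_induct) (auto simp: csubspaceD[OF assms(1)])

lemma csubspace_closure:
  assumes "csubspace V" shows "csubspace (closure V)"
  unfolding csubspace_def
proof (intro conjI ballI allI)
  show "0 \<in> closure V" using csubspaceD(1)[OF assms] closure_subset by blast
  show "x + y \<in> closure V" if xy: "x \<in> closure V" "y \<in> closure V" for x y
  proof -
    obtain f g where "\<And>n. f n \<in> V" "f \<longlonglongrightarrow> x" "\<And>n. g n \<in> V" "g \<longlonglongrightarrow> y"
      using xy unfolding closure_sequential by blast
    then show ?thesis unfolding closure_sequential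
      by (intro exI[of _ "\<lambda>n. f n + g n"]) (auto intro: csubspaceD[OF assms] tendsto_add)
  qed
  show "a *\<^sub>C x \<in> closure V" if x: "x \<in> closure V" for a x
  proof -
    obtain f where "\<And>n. f n \<in> V" "f \<longlonglongrightarrow> x"
      using x unfolding closure_sequential by blast
    then show ?thesis unfolding closure_sequential
      by (intro exI[of _ "\<lambda>n. a *\<^sub>C f n"]) (auto intro: csubspaceD[OF assms] tendsto_scaleC)
  qed
qed

text \<open>A minimizing sequence is Cauchy by the parallelogram law, because its midpoints lie in V
  and stay at distance at least d from x. At the minimizer, varying in a direction w gives
  orthogonality for the real inner product; applying this to i w as well gives the complex
  one.\<close>

lemma exists_orthogonal_projection:
  fixes V :: "'a::chilbert set"
  assumes V: "closed V" "csubspace V"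
  shows "\<exists>p\<in>V. \<forall>v\<in>V. cinner (x - p) v = 0"
proof -
  define d where "d = infdist x V"
  have ne: "V \<noteq> {}" using csubspaceD(1)[OF V(2)] by blast
  have d0: "0 \<le> d" by (simp add: d_def infdist_nonneg)
  have dle: "d \<le> norm (x - v)" if "v \<in> V" for v
    using infdist_le[OF that, of x] by (simp add: d_def dist_norm)
  have "\<exists>v\<in>V. norm (x - v) < d + 1 / real (Suc n)" for n
  proof (rule ccontr)
    assume "\<not> ?thesis"
    then have "d + 1 / real (Suc n) \<le> dist x v" if "v \<in> V" for v
      using that by (force simp: dist_norm not_less)
    then have "d + 1 / real (Suc n) \<le> (INF v\<in>V. dist x v)"
      using ne by (intro cINF_greatest) auto
    also have "\<dots> = d" using ne by (simp add: d_def infdist_notempty)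
    finally have "d + 1 / real (Suc n) \<le> d" .
    then show False by simp
  qed
  then obtain v where v: "\<And>n. v n \<in> V" "\<And>n. norm (x - v n) < d + 1 / real (Suc n)"
    by metis
  \<comment> \<open>Bounds the excess of the squared distance of \<open>v n\<close> over the minimal
    one; the parallelogram law controls the sequence by these numbers.\<close>
  define b where "b n = (d + 1 / real (Suc n))\<^sup>2 - d\<^sup>2" for n
  have "(\<lambda>n. (d + 1 / real (Suc n))\<^sup>2 - d\<^sup>2) \<longlonglongrightarrow> (d + 0)\<^sup>2 - d\<^sup>2"
    by (intro tendsto_intros LIMSEQ_inverse_real_of_nat[unfolded inverse_eq_divide])
  then have b0: "b \<longlonglongrightarrow> 0" by (simp add: b_def[abs_def])
  have para: "(norm (v m - v n))\<^sup>2 \<le> 2 * b m + 2 * b n" for m n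
  proof -
    have "(1/2) *\<^sub>R (v m + v n) \<in> V" by (intro csubspaceD[OF V(2)] v)
    then have "d\<^sup>2 \<le> (norm (x - (1/2) *\<^sub>R (v m + v n)))\<^sup>2"
      using dle d0 by (intro power_mono) auto
    moreover have "(norm (v m - v n))\<^sup>2 = 2 * (norm (x - v m))\<^sup>2 + 2 * (norm (x - v n))\<^sup>2
        - 4 * (norm (x - (1/2) *\<^sub>R (v m + v n)))\<^sup>2"
      by (simp add: power2_norm_eq_inner inner_diff_left inner_diff_right inner_add_left inner_add_right
           inner_commute field_simps)
    moreover have "(norm (x - v i))\<^sup>2 \<le> b i + d\<^sup>2" for i
      using power_mono[of "norm (x - v i)" "d + 1 / real (Suc i)" 2] v(2)[of i] by (simp add: b_def)
    ultimately show ?thesis by (smt (verit))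
  qed
  have "Cauchy v"
  proof (rule CauchyI)
    fix e :: real assume "0 < e"
    then have "0 < e\<^sup>2 / 4" by simp
    then obtain N where N: "\<And>n. n \<ge> N \<Longrightarrow> \<bar>b n\<bar> < e\<^sup>2 / 4"
      using LIMSEQ_D[OF b0, of "e\<^sup>2 / 4"] by auto
    show "\<exists>M. \<forall>m\<ge>M. \<forall>n\<ge>M. norm (v m - v n) < e"
    proof (intro exI[of _ N] allI impI)
      fix m n assume "N \<le> m" "N \<le> n"
      then have "(norm (v m - v n))\<^sup>2 < e\<^sup>2"
        using para[of m n] N[of m] N[of n] by linarith
      then show "norm (v m - v n) < e" using \<open>0 < e\<close> by (simp add: power2_less_imp_less)
    qed
  qed
  then obtain p where p: "v \<longlonglongrightarrow> p" using Cauchy_convergent convergent_def by blast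
  have pV: "p \<in> V" using closed_sequentially[OF V(1)] v(1) p by blast
  have "(\<lambda>n. d + 1 / real (Suc n)) \<longlonglongrightarrow> d + 0"
    by (intro tendsto_intros LIMSEQ_inverse_real_of_nat[unfolded inverse_eq_divide])
  moreover have "(\<lambda>n. norm (x - v n)) \<longlonglongrightarrow> norm (x - p)"
    by (intro tendsto_intros p)
  ultimately have pd: "norm (x - p) \<le> d"
    using LIMSEQ_le[of "\<lambda>n. norm (x - v n)" "norm (x - p)" "\<lambda>n. d + 1 / real (Suc n)" d] v(2) less_imp_le
    by auto
  have real_orth: "inner (x - p) w = 0" if w: "w \<in> V" for w
  proof (cases "w = 0")
    case False
    \<comment> \<open>This t minimizes the distance of x to the points p + t w; the minimum cannot
      undercut the distance to p.\<close>
    define t where "t = inner (x - p) w / (norm w)\<^sup>2"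
    have "norm (x - p) \<le> norm (x - (p + t *\<^sub>R w))"
      using pd dle[of "p + t *\<^sub>R w"] csubspaceD[OF V(2)] pV w by fastforce
    then have "(norm (x - p))\<^sup>2 \<le> (norm (x - p - t *\<^sub>R w))\<^sup>2"
      by (simp add: power_mono diff_diff_eq)
    also have "\<dots> = (norm (x - p))\<^sup>2 - 2 * t * inner (x - p) w + t\<^sup>2 * (norm w)\<^sup>2"
      by (simp only: power2_norm_eq_inner) 
         (simp add: inner_diff_left inner_diff_right inner_commute power2_eq_square algebra_simps)
    also have "\<dots> = (norm (x - p))\<^sup>2 - (inner (x - p) w)\<^sup>2 / (norm w)\<^sup>2"
      using False by (simp add: t_def power2_eq_square field_simps)
    finally have "(inner (x - p) w)\<^sup>2 / (norm w)\<^sup>2 \<le> 0" by simp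
    then show ?thesis using False by (simp add: divide_le_0_iff)
  qed simp
  have "cinner (x - p) w = 0" if w: "w \<in> V" for w
  proof -
    have "Re (cinner (x - p) w) = 0" using real_orth[OF w] by (simp add: Re_cinner)
    moreover have "Im (cinner (x - p) w) = Re (cinner (x - p) (\<i> *\<^sub>C w))"
      by (simp add: cinner_scaleC_right)
    then have "Im (cinner (x - p) w) = 0"
      using real_orth[of "\<i> *\<^sub>C w"] csubspaceD(3)[OF V(2) w] by (simp add: Re_cinner)
    ultimately show ?thesis by (simp add: complex_eq_iff)
  qed
  then show ?thesis using pV by blast
qed

definition cproj :: "'a::chilbert set \<Rightarrow> 'a \<Rightarrow> 'a" where
  "cproj V x = (SOME p. p \<in> V \<and> (\<forall>v\<in>V. cinner (x - p) v = 0))"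

context
  fixes V :: "'a::chilbert set"
  assumes V: "closed V" "csubspace V"
begin

lemma cproj_in: "cproj V x \<in> V"
  and cproj_orth: "v \<in> V \<Longrightarrow> cinner (x - cproj V x) v = 0"
  using someI_ex[of "\<lambda>p. p \<in> V \<and> (\<forall>v\<in>V. cinner (x - p) v = 0)"] exists_orthogonal_projection[OF V, of x]
  unfolding cproj_def by blast+

lemma cproj_unique:
  assumes "p \<in> V" "\<And>v. v \<in> V \<Longrightarrow> cinner (x - p) v = 0" shows "cproj V x = p"
proof -
  have "cproj V x - p \<in> V" using cproj_in assms(1) V(2) csubspaceD(5) by blast
  then have "cinner (x - p) (cproj V x - p) - cinner (x - cproj V x) (cproj V x - p) = 0"
    using cproj_orth assms(2) by simp
  then have "cinner (cproj V x - p) (cproj V x - p) = 0" by (simp add: cinner.diff_left)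
  then show ?thesis by (simp add: cinner_self)
qed

lemma cproj_ident: "x \<in> V \<Longrightarrow> cproj V x = x"
  by (rule cproj_unique) (auto simp: cinner.zero_left)

lemma cproj_zero: "(\<And>v. v \<in> V \<Longrightarrow> cinner x v = 0) \<Longrightarrow> cproj V x = 0"
  by (rule cproj_unique) (auto simp: csubspaceD[OF V(2)])

lemma cinner_cproj_left: "v \<in> V \<Longrightarrow> cinner (cproj V x) v = cinner x v"
  using cproj_orth[of v x] by (simp add: cinner.diff_left)

lemma cinner_cproj_right: "v \<in> V \<Longrightarrow> cinner v (cproj V x) = cinner v x"
  by (metis cinner_commute cinner_cproj_left)

lemma norm_cproj_le: "norm (cproj V x) \<le> norm x"
proof -
  have "(norm (cproj V x))\<^sup>2 = cmod (cinner x (cproj V x))"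
    by (metis cinner_cproj_left cinner_self cproj_in norm_of_real abs_power2)
  also have "\<dots> \<le> norm x * norm (cproj V x)" by (rule cmod_cinner_le)
  finally show ?thesis
    by (metis mult_right_le_imp_le norm_ge_zero power2_eq_square less_eq_real_def)
qed

lemma bounded_clinear_cproj: "bounded_clinear (cproj V)"
proof (rule bounded_clinear_intro[of _ 1])
  fix x y a
  show "cproj V (x + y) = cproj V x + cproj V y"
    by (rule cproj_unique)
       (auto simp: cproj_in csubspaceD[OF V(2)] cinner.diff_left cinner_add_left cinner_cproj_left)
  show "cproj V (a *\<^sub>C x) = a *\<^sub>C cproj V x"
    by (rule cproj_unique)
       (auto simp: cproj_in csubspaceD[OF V(2)] cinner.diff_left cinner_scaleC_left cinner_cproj_left)
  show "norm (cproj V x) \<le> 1 * norm x" using norm_cproj_le by simp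
qed

text \<open>The bipolar theorem for V. Vectors known only through inner products are placed in V by
  testing against the orthogonal complement. For the nontrivial direction x -
  \<open>cproj V x\<close> is itself a test vector, orthogonal to both x and
  \<open>cproj V x\<close>.\<close>

lemma in_closed_subspace_iff: "x \<in> V \<longleftrightarrow> (\<forall>y. (\<forall>v\<in>V. cinner y v = 0) \<longrightarrow> cinner x y = 0)"
proof
  assume r: "\<forall>y. (\<forall>v\<in>V. cinner y v = 0) \<longrightarrow> cinner x y = 0"
  have "cinner x (x - cproj V x) = 0" using r cproj_orth by blast
  moreover have "cinner (cproj V x) (x - cproj V x) = 0"
    by (metis cinner_commute complex_cnj_zero cproj_in cproj_orth)
  ultimately have "cinner (x - cproj V x) (x - cproj V x) = 0" by (simp add: cinner.diff_left)
  then show "x \<in> V" by (metis cinner_self cproj_in eq_iff_diff_eq_0 norm_eq_zero of_real_eq_0_iff power2_eq_square mult_eq_0_iff)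
next
  assume "x \<in> V"
  then show "\<forall>y. (\<forall>v\<in>V. cinner y v = 0) \<longrightarrow> cinner x y = 0"
    by (metis cinner_commute complex_cnj_zero)
qed

end


subsection \<open>Riesz representation and adjoints\<close>

lemma riesz_representation:
  fixes f :: "'a::chilbert \<Rightarrow> complex"
  assumes bl: "bounded_linear f" and sc: "\<And>a x. f (a *\<^sub>C x) = a * f x"
  shows "\<exists>z. \<forall>x. f x = cinner x z"
proof (cases "\<forall>x. f x = 0")
  case False
  then obtain u where u: "f u \<noteq> 0" by blast
  define V where "V = {x. f x = 0}"
  note lin = bounded_linear.linear[OF bl]
  have "V = f -` {0}" by (auto simp: V_def)
  then have V: "closed V" "csubspace V"
    using continuous_closed_vimage[of "{0}" f] bounded_linear.continuous[OF bl]
    by (auto simp: V_def csubspace_def linear_add[OF lin] linear_0[OF lin] sc linear_continuous_at[OF bl])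
  define w where "w = u - cproj V u"
  have "f (cproj V u) = 0" using cproj_in[OF V, of u] by (simp add: V_def)
  then have fw: "f w \<noteq> 0" using u by (simp add: w_def linear_diff[OF lin])
  then have w0: "w \<noteq> 0" using linear_0[OF lin] by auto
  have worth: "cinner v w = 0" if "v \<in> V" for v
    by (metis cinner_commute complex_cnj_zero cproj_orth[OF V that] w_def)
  \<comment> \<open>Subtracting (f x / f w) w from x lands in the kernel of f, to which w is
    orthogonal; this determines the coefficient.\<close>
  have "f x = cinner x ((cnj (f w) / complex_of_real ((norm w)\<^sup>2)) *\<^sub>C w)" for x
  proof -
    have "x - (f x / f w) *\<^sub>C w \<in> V" using fw by (simp add: V_def linear_diff[OF lin] sc)
    then have "cinner x w = (f x / f w) * complex_of_real ((norm w)\<^sup>2)"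
      using worth[of "x - (f x / f w) *\<^sub>C w"] by (simp add: cinner.diff_left cinner_scaleC_left cinner_self)
    then show ?thesis using fw w0 by (simp add: cinner_scaleC_right)
  qed
  then show ?thesis by blast
qed (auto intro!: exI[of _ 0])

text \<open>The source of the operators that are defined weakly: adjoints, integrals against
  operator valued measures, weak integrals. The form is conjugate linear in y, so Riesz is applied
  to its conjugate.\<close>

lemma sesquilinear_form_operator:
  fixes B :: "'a::chilbert \<Rightarrow> 'a \<Rightarrow> complex"
  assumes "\<And>x x' y. B (x + x') y = B x y + B x' y" "\<And>a x y. B (a *\<^sub>C x) y = a * B x y"
    and "\<And>x y y'. B x (y + y') = B x y + B x y'" "\<And>a x y. B x (a *\<^sub>C y) = cnj a * B x y"
    and bound: "\<And>x y. cmod (B x y) \<le> C * norm x * norm y" and "0 \<le> C"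
  shows "\<exists>A. bounded_clinear A \<and> (\<forall>x y. cinner (A x) y = B x y) \<and> (\<forall>x. norm (A x) \<le> C * norm x)"
proof -
  have "\<exists>z. \<forall>y. cnj (B x y) = cinner y z" for x
  proof (rule riesz_representation)
    show "bounded_linear (\<lambda>y. cnj (B x y))"
    proof (rule bounded_linear_intro[of _ "C * norm x"])
      show "cnj (B x (r *\<^sub>R y)) = r *\<^sub>R cnj (B x y)" for r y
        using assms(4)[of x "complex_of_real r" y] by (simp add: scaleC_of_real scaleR_conv_of_real)
      show "norm (cnj (B x y)) \<le> norm y * (C * norm x)" for y
        using bound[of x y] by (simp add: mult_ac)
    qed (use assms in auto)
  qed (use assms in auto)
  then obtain A where "\<And>x y. cnj (B x y) = cinner y (A x)" by metis
  then have A: "cinner (A x) y = B x y" for x y by (metis cinner_commute complex_cnj_cnj)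
  have n: "norm (A x) \<le> C * norm x" for x
    by (rule norm_le_by_cinner) (use A bound \<open>0 \<le> C\<close> in auto)
  moreover have "bounded_clinear A"
    by (rule bounded_clinear_intro[OF _ _ n]; rule cinner_ext)
       (auto simp: A assms cinner_add_left cinner_scaleC_left)
  ultimately show ?thesis using A by blast
qed

definition cadj :: "('a::chilbert \<Rightarrow> 'a) \<Rightarrow> 'a \<Rightarrow> 'a" where
  "cadj A = (SOME B. bounded_clinear B \<and> (\<forall>x y. cinner (B x) y = cinner x (A y)))"

lemma
  assumes A: "bounded_clinear A"
  shows bounded_clinear_cadj: "bounded_clinear (cadj A)"
    and cinner_cadj_left: "cinner (cadj A x) y = cinner x (A y)"
    and cinner_cadj_right: "cinner x (cadj A y) = cinner (A x) y"
proof -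
  obtain K where K: "0 < K" "\<And>x. norm (A x) \<le> K * norm x" using bounded_clinear_bound[OF A] by blast
  have "\<exists>B. bounded_clinear B \<and> (\<forall>x y. cinner (B x) y = cinner x (A y)) \<and> (\<forall>x. norm (B x) \<le> K * norm x)"
  proof (rule sesquilinear_form_operator)
    show "cmod (cinner x (A y)) \<le> K * norm x * norm y" for x y
      using cmod_cinner_le[of x "A y"] mult_left_mono[OF K(2)[of y] norm_ge_zero[of x]] by (simp add: mult_ac)
  qed (use K A in \<open>auto simp: cinner_add_left cinner_scaleC_left cinner_add_right cinner_scaleC_right
        bounded_clinear_add bounded_clinear_scaleC\<close>)
  then have "bounded_clinear (cadj A) \<and> (\<forall>x y. cinner (cadj A x) y = cinner x (A y))"
    unfolding cadj_def by (intro someI_ex[of "\<lambda>B. bounded_clinear B \<and> (\<forall>x y. cinner (B x) y = cinner x (A y))"]) blast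
  then show "bounded_clinear (cadj A)" and l: "cinner (cadj A x) y = cinner x (A y)" for x y by auto
  show "cinner x (cadj A y) = cinner (A x) y" by (metis cinner_commute l)
qed

lemma norm_cadj_le:
  assumes A: "bounded_clinear A" and "\<And>x. norm (A x) \<le> C * norm x" "0 \<le> C"
  shows "norm (cadj A x) \<le> C * norm x"
proof (rule norm_le_by_cinner)
  show "cmod (cinner (cadj A x) y) \<le> C * norm x * norm y" for y
    using cmod_cinner_le[of x "A y"] mult_left_mono[OF assms(2)[of y] norm_ge_zero[of x]]
    by (simp add: cinner_cadj_left[OF A] mult_ac)
qed (use assms(3) in simp)

subsection \<open>Positive operators and their square roots\<close>

definition positive_clinear :: "('a::chilbert \<Rightarrow> 'a) \<Rightarrow> bool" where
  "positive_clinear A \<longleftrightarrow> bounded_clinear A \<and> (\<forall>x. Im (cinner (A x) x) = 0 \<and> 0 \<le> Re (cinner (A x) x))"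

text \<open>Realness of the quadratic form at x + y relates the imaginary parts of the two mixed
  terms, realness at x + i y their real parts.\<close>

lemma positive_clinear_selfadjoint:
  assumes A: "positive_clinear A" shows "cinner (A x) y = cinner x (A y)"
proof -
  have bA: "bounded_clinear A" and real: "Im (cinner (A z) z) = 0" for z
    using A by (auto simp: positive_clinear_def)
  have "Im (cinner (A x) y + cinner (A y) x) = 0"
    using real[of "x + y"] real[of x] real[of y]
    by (simp add: bounded_clinear_add[OF bA] cinner_add_left cinner_add_right)
  moreover have "Re (cinner (A y) x) - Re (cinner (A x) y) = 0"
    using real[of "x + \<i> *\<^sub>C y"] real[of x] real[of y]
    by (simp add: bounded_clinear_add[OF bA] bounded_clinear_scaleC[OF bA] cinner_add_left cinner_add_right
        cinner_scaleC_left cinner_scaleC_right)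
  ultimately have "cinner (A x) y = cnj (cinner (A y) x)" by (simp add: complex_eq_iff)
  then show ?thesis by (metis cinner_commute)
qed

lemma positive_clinear_cauchy_schwarz:
  assumes A: "positive_clinear A"
  shows "(cmod (cinner (A x) y))\<^sup>2 \<le> Re (cinner (A x) x) * Re (cinner (A y) y)"
proof -
  have bA: "bounded_clinear A" and pos: "0 \<le> Re (cinner (A z) z)" for z
    using A by (auto simp: positive_clinear_def)
  have real: "(Re (cinner (A x) y))\<^sup>2 \<le> Re (cinner (A x) x) * Re (cinner (A y) y)" for x y
  proof -
    define a b c where "a = Re (cinner (A y) y)" and "b = Re (cinner (A x) y)" and "c = Re (cinner (A x) x)"
    have "Re (cinner (A y) x) = b"
      by (metis positive_clinear_selfadjoint[OF A] b_def cinner_commute complex_cnj(1) complex.sel(1) cnj.sel(1))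
    \<comment> \<open>A nonnegative quadratic in t, possibly degenerate. For a = 0 the value of t
      chosen below would make it -1 unless b = 0; otherwise the minimizer - b / a gives the
      discriminant inequality.\<close>
    then have q: "0 \<le> c + 2 * t * b + t\<^sup>2 * a" for t
      using pos[of "x + complex_of_real t *\<^sub>C y"]
      by (simp add: bounded_clinear_add[OF bA] bounded_clinear_scaleC[OF bA] cinner_add_left cinner_add_right
          cinner_scaleC_left cinner_scaleC_right a_def b_def c_def power2_eq_square algebra_simps)
    show ?thesis
    proof (cases "a = 0")
      case True
      have "b = 0"
      proof (rule ccontr)
        assume "b \<noteq> 0"
        then show False using q[of "- (c + 1) / (2 * b)"] True by (simp add: field_simps)
      qed
      then show ?thesis using True by (simp add: a_def b_def)
    next
      case False
      then have "0 < a" using pos[of y] by (simp add: a_def)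
      then have "0 \<le> c - b\<^sup>2 / a"
        using q[of "- b / a"] by (simp add: power2_eq_square field_simps)
      then show ?thesis using \<open>0 < a\<close> by (simp add: a_def b_def c_def field_simps)
    qed
  qed
  \<comment> \<open>Rotating y by u makes the mixed term real and leaves the form at y
    unchanged.\<close>
  define u where "u = sgn (cinner (A x) y)"
  show ?thesis
  proof (cases "cinner (A x) y = 0")
    case False
    then have u: "cmod u = 1" by (simp add: u_def norm_sgn)
    then have uu: "u * cnj u = 1" by (simp add: complex_norm_square[symmetric])
    have "cinner (A x) (u *\<^sub>C y) = cnj u * (complex_of_real (cmod (cinner (A x) y)) * u)"
      by (simp add: cinner_scaleC_right u_def sgn_eq)
    also have "\<dots> = complex_of_real (cmod (cinner (A x) y))" using uu by (simp add: mult.commute mult.left_commute)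
    finally have "Re (cinner (A x) (u *\<^sub>C y)) = cmod (cinner (A x) y)" by simp
    moreover have "cinner (A (u *\<^sub>C y)) (u *\<^sub>C y) = cinner (A y) y"
      using uu by (simp add: bounded_clinear_scaleC[OF bA] cinner_scaleC_left cinner_scaleC_right)
         (metis mult.assoc mult.commute mult.left_neutral)
    ultimately show ?thesis using real[of x "u *\<^sub>C y"] by simp
  qed (simp add: pos)
qed

lemma positive_clinear_eq_zero:
  assumes A: "positive_clinear A" and "Re (cinner (A x) x) = 0" shows "A x = 0"
proof -
  have "(cmod (cinner (A x) (A x)))\<^sup>2 \<le> 0"
    using positive_clinear_cauchy_schwarz[OF A, of x "A x"] assms(2) by simp
  then show ?thesis by (simp add: cinner_self)
qed

section \<open>Square roots by a power series\<close>

text \<open>The coefficients of \<open>1 - (1 - z)\<^bsup>1/2\<^esup>\<close>; the recursion says that their generating function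
  \<open>D\<close> satisfies \<open>2 D = z + D\<^sup>2\<close>.\<close>

fun sqrt_coeff :: "nat \<Rightarrow> real" where
  "sqrt_coeff n = (if n = 0 then 0 else if n = 1 then 1/2
     else 1/2 * (\<Sum>i\<in>{1..<n}. sqrt_coeff i * sqrt_coeff (n - i)))"

declare sqrt_coeff.simps [simp del]

lemma sqrt_coeff_0 [simp]: "sqrt_coeff 0 = 0"
  by (simp add: sqrt_coeff.simps)

lemma sqrt_coeff_nonneg: "0 \<le> sqrt_coeff n"
proof (induction n rule: less_induct)
  case (less n)
  then show ?case
    by (subst sqrt_coeff.simps) (auto intro!: sum_nonneg mult_nonneg_nonneg)
qed

text \<open>The coefficientwise form of D^2 = 2 D - z; the correction at n = 1 is the coefficient of
  z.\<close>

lemma sqrt_coeff_convolution: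
  "(\<Sum>i\<le>n. sqrt_coeff i * sqrt_coeff (n - i)) = 2 * sqrt_coeff n - (if n = 1 then 1 else 0)"
proof -
  have eq: "(\<Sum>i\<le>n. sqrt_coeff i * sqrt_coeff (n - i)) = (\<Sum>i\<in>{1..<n}. sqrt_coeff i * sqrt_coeff (n - i))"
    by (rule sum.mono_neutral_right) (auto simp: not_less less_Suc_eq_le Suc_le_eq)
  show ?thesis
    unfolding eq by (subst (3) sqrt_coeff.simps) auto
qed

text \<open>Let s N be the partial sums. Summing the convolution identity gives 2 s(N+1) - 1 <=
  s(N)^2: since the coefficient at 0 vanishes, both indices of a contributing product with i + j <=
  N + 1 are at most N. By induction s stays below 1.\<close>

lemma sum_sqrt_coeff_le: "(\<Sum>n\<le>N. sqrt_coeff n) \<le> 1"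
proof (induction N)
  case (Suc N)
  let ?c = sqrt_coeff
  have nn: "0 \<le> (\<Sum>n\<le>N. ?c n)" by (intro sum_nonneg sqrt_coeff_nonneg)
  have "(\<Sum>n\<le>Suc N. \<Sum>i\<le>n. ?c i * ?c (n - i)) = (\<Sum>(i,j)\<in>{(i,j). i + j \<le> Suc N}. ?c i * ?c j)"
    by (rule sum.triangle_reindex_eq[symmetric])
  also have "\<dots> = (\<Sum>(i,j)\<in>{(i,j). i + j \<le> Suc N \<and> i \<noteq> 0 \<and> j \<noteq> 0}. ?c i * ?c j)"
  proof (rule sum.mono_neutral_right)
    show "finite {(i, j). i + j \<le> Suc N}"
      by (rule finite_subset[of _ "{..Suc N} \<times> {..Suc N}"]) auto
  qed (auto intro!: gr0I)
  also have "\<dots> \<le> (\<Sum>(i,j)\<in>{..N} \<times> {..N}. ?c i * ?c j)"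
    by (rule sum_mono2) (auto simp: sqrt_coeff_nonneg)
  also have "\<dots> = (\<Sum>n\<le>N. ?c n) * (\<Sum>n\<le>N. ?c n)"
    by (simp add: sum_product sum.cartesian_product)
  also have "\<dots> \<le> 1 * 1" using Suc.IH nn by (intro mult_mono) auto
  finally have "(\<Sum>n\<le>Suc N. 2 * ?c n - (if n = 1 then 1 else 0)) \<le> 1"
    by (simp add: sqrt_coeff_convolution)
  moreover have "(\<Sum>n\<le>Suc N. (if n = 1 then 1 else 0 :: real)) = 1"
    by (subst sum.delta) auto
  ultimately show ?case
    by (simp only: sum_subtractf sum_distrib_left[symmetric])
qed simp

lemma summable_sqrt_coeff: "summable sqrt_coeff"
  by (rule bounded_imp_summable[of _ 1])
     (use sum_sqrt_coeff_le in \<open>auto simp: sqrt_coeff_nonneg lessThan_Suc_atMost[symmetric]\<close>)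

lemma suminf_sqrt_coeff_le: "suminf sqrt_coeff \<le> 1"
proof (rule suminf_le_const[OF summable_sqrt_coeff])
  show "sum sqrt_coeff {..<n} \<le> 1" for n
    using sum_sqrt_coeff_le[of "n - 1"] by (cases n) (auto simp: lessThan_Suc_atMost)
qed

text \<open>The root of 1 - C is S = 1 - D, where D is the power series evaluated at C. It converges
  because C is a contraction and the coefficients are summable, and D^2 = 2 D - C gives S^2 = 1 - C.
  Commutation passes from C to the series; uniqueness of roots depends on it.\<close>

lemma exists_sqrt_complement:
  fixes C :: "'a::chilbert \<Rightarrow> 'a"
  assumes C: "bounded_clinear C" "\<And>x. norm (C x) \<le> norm x" "\<And>x y. cinner (C x) y = cinner x (C y)"
  shows "\<exists>S. positive_clinear S \<and> (\<forall>x. S (S x) = x - C x) \<and>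
    (\<forall>A. bounded_clinear A \<and> (\<forall>x. A (C x) = C (A x)) \<longrightarrow> (\<forall>x. A (S x) = S (A x)))"
proof -
  let ?c = sqrt_coeff
  have Cn: "bounded_clinear (C ^^ n)" for n
  proof (induction n)
    case 0 then show ?case by (simp add: id_def)
  next
    case (Suc n) then show ?case using bounded_clinear_compose[OF C(1)] by (simp add: o_def)
  qed
  have nCn: "norm ((C ^^ n) x) \<le> norm x" for n x
    by (induction n) (auto intro: order_trans[OF C(2)])
  have saCn: "cinner ((C ^^ n) x) y = cinner x ((C ^^ n) y)" for n x y
  proof (induction n arbitrary: x y)
    case (Suc n)
    then show ?case by (simp add: C(3)) (metis funpow_swap1)
  qed simp
  define D where "D x = (\<Sum>n. ?c n *\<^sub>R (C ^^ n) x)" for x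
  have nsum: "summable (\<lambda>n. norm (?c n *\<^sub>R (C ^^ n) x))" for x
    by (rule summable_comparison_test'[of "\<lambda>n. ?c n * norm x" 0])
       (auto simp: sqrt_coeff_nonneg nCn intro!: mult_left_mono summable_mult2 summable_sqrt_coeff)
  have Ds: "(\<lambda>n. ?c n *\<^sub>R (C ^^ n) x) sums D x" for x
    unfolding D_def by (rule summable_sums, rule summable_norm_cancel, rule nsum)
  have Dn: "norm (D x) \<le> norm x" for x
  proof -
    have "norm (D x) \<le> (\<Sum>n. norm (?c n *\<^sub>R (C ^^ n) x))"
      unfolding D_def by (rule summable_norm[OF nsum])
    also have "\<dots> \<le> (\<Sum>n. ?c n * norm x)"
      by (intro suminf_le nsum summable_mult2 summable_sqrt_coeff)
         (auto simp: sqrt_coeff_nonneg nCn intro!: mult_left_mono)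
    also have "\<dots> = suminf ?c * norm x" by (rule suminf_mult2[symmetric, OF summable_sqrt_coeff])
    also have "\<dots> \<le> 1 * norm x" by (intro mult_right_mono suminf_sqrt_coeff_le) auto
    finally show ?thesis by simp
  qed
  have Dcomm: "A (D x) = D (A x)" if A: "bounded_clinear A" "\<And>x. A (C x) = C (A x)" for A x
  proof -
    have pw: "A ((C ^^ n) x) = (C ^^ n) (A x)" for n by (induction n) (auto simp: A(2))
    have "(\<lambda>n. A (?c n *\<^sub>R (C ^^ n) x)) sums A (D x)"
      by (rule bounded_linear.sums[OF bounded_clinear_imp_bounded_linear[OF A(1)] Ds])
    then have "(\<lambda>n. ?c n *\<^sub>R (C ^^ n) (A x)) sums A (D x)"
      using A(1) by (simp add: bounded_clinear_def bounded_linear.linear linear_scale pw)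
    then show ?thesis using Ds sums_unique2 by blast
  qed
  have bD: "bounded_clinear D"
  proof (rule bounded_clinear_intro[of _ 1])
    fix x y a
    have "(\<lambda>n. ?c n *\<^sub>R (C ^^ n) x + ?c n *\<^sub>R (C ^^ n) y) sums (D x + D y)"
      by (intro sums_add Ds)
    then have "(\<lambda>n. ?c n *\<^sub>R (C ^^ n) (x + y)) sums (D x + D y)"
      by (simp add: bounded_clinear_add[OF Cn] scaleR_add_right)
    then show "D (x + y) = D x + D y" using Ds sums_unique2 by blast
    show "D (a *\<^sub>C x) = a *\<^sub>C D x"
      by (rule Dcomm[symmetric])
         (use bounded_clinear_scale[OF bounded_clinear_ident, of a] in \<open>auto simp: bounded_clinear_scaleC[OF C(1)]\<close>)
  qed (use Dn in auto)
  have DD: "D (D x) = 2 *\<^sub>R D x - C x" for x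
  proof -
    \<comment> \<open>The terms of the double series for D (D x). Summed by rows they give D (D x);
      summed along the antidiagonals n + m = k they give 2 D x - C x by the convolution
      identity.\<close>
    define f where "f = (\<lambda>(n,m). (?c n * ?c m) *\<^sub>R (C ^^ (n + m)) x)"
    have hs: "((\<lambda>n. ?c n *\<^sub>R (C ^^ n) z) has_sum D z) UNIV" for z
      by (rule norm_summable_imp_has_sum[OF nsum Ds])
    have cs: "?c summable_on UNIV"
      using summable_sqrt_coeff by (subst summable_on_UNIV_nonneg_real_iff) (auto simp: sqrt_coeff_nonneg)
    have "(\<lambda>(n,m). ?c n * ?c m) summable_on UNIV \<times> UNIV"
      by (rule summable_on_SigmaI[where g = "\<lambda>n. ?c n * infsum ?c UNIV"])
         (use cs in \<open>auto simp: sqrt_coeff_nonneg intro!: has_sum_cmult_right summable_on_cmult_left\<close>)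
    then have "(\<lambda>p. (case p of (n,m) \<Rightarrow> ?c n * ?c m) * norm x) summable_on UNIV \<times> UNIV"
      by (rule summable_on_cmult_left)
    then have "f abs_summable_on UNIV \<times> UNIV"
      by (rule summable_on_comparison_test) (auto simp: f_def sqrt_coeff_nonneg nCn intro!: mult_left_mono)
    then obtain s where s: "(f has_sum s) (UNIV \<times> UNIV)"
      using abs_summable_summable summable_on_def by blast
    have "((\<lambda>n. ?c n *\<^sub>R (C ^^ n) (D x)) has_sum s) UNIV"
    proof (rule has_sum_SigmaD[OF s])
      fix n
      have "((\<lambda>m. ?c n *\<^sub>R (C ^^ n) (?c m *\<^sub>R (C ^^ m) x)) has_sum ?c n *\<^sub>R (C ^^ n) (D x)) UNIV"
        by (rule has_sum_bounded_linear[OF bounded_linear_compose[OF bounded_linear_scaleR_right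
             bounded_clinear_imp_bounded_linear[OF Cn]] hs])
      then show "((\<lambda>m. f (n, m)) has_sum ?c n *\<^sub>R (C ^^ n) (D x)) UNIV"
        using Cn by (simp add: f_def bounded_clinear_def bounded_linear.linear linear_scale funpow_add)
    qed
    then have s1: "s = D (D x)" using hs has_sum_unique by blast
    have "((\<lambda>(k,i). (?c i * ?c (k - i)) *\<^sub>R (C ^^ k) x) has_sum s) (Sigma UNIV (\<lambda>k. {..k}))"
      using s by (subst has_sum_reindex_bij_witness[where j = "\<lambda>(k,i). (i, k - i)" and i = "\<lambda>(n,m). (n + m, n)"
            and T = "UNIV \<times> UNIV" and h = f and s' = s]) (auto simp: f_def)
    then have "((\<lambda>k. \<Sum>i\<le>k. (?c i * ?c (k - i)) *\<^sub>R (C ^^ k) x) has_sum s) UNIV"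
      by (rule has_sum_SigmaD) (auto intro!: has_sum_finiteI)
    then have "(\<lambda>k. \<Sum>i\<le>k. (?c i * ?c (k - i)) *\<^sub>R (C ^^ k) x) sums s"
      by (rule has_sum_imp_sums)
    moreover have "(\<lambda>k. 2 *\<^sub>R (?c k *\<^sub>R (C ^^ k) x) - (if k = 1 then C x else 0)) sums (2 *\<^sub>R D x - C x)"
      using sums_single[of 1 "\<lambda>_. C x"] by (intro sums_diff bounded_linear.sums[OF bounded_linear_scaleR_right Ds]) auto
    moreover have "(\<Sum>i\<le>k. (?c i * ?c (k - i)) *\<^sub>R (C ^^ k) x)
        = 2 *\<^sub>R (?c k *\<^sub>R (C ^^ k) x) - (if k = 1 then C x else 0)" for k
      by (simp only: scaleR_sum_left[symmetric] sqrt_coeff_convolution) (simp add: scaleR_diff_left)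
    ultimately show ?thesis using s1 sums_unique2 by simp
  qed
  have "Im (cinner (D x) x) = 0" for x
  proof -
    have "(\<lambda>n. cinner (?c n *\<^sub>R (C ^^ n) x) x) sums cinner (D x) x"
      by (rule bounded_linear.sums[OF cinner.bounded_linear_left Ds])
    then have "(\<lambda>n. Im (cinner (?c n *\<^sub>R (C ^^ n) x) x)) sums Im (cinner (D x) x)"
      by (rule bounded_linear.sums[OF bounded_linear_Im])
    moreover have "Im (cinner ((C ^^ n) x) x) = 0" for n
    proof -
      have "cinner ((C ^^ n) x) x = cnj (cinner ((C ^^ n) x) x)"
        by (metis saCn cinner_commute)
      then show ?thesis by (metis complex_cnj_cancel_iff cnj.simps(2) neg_equal_zero)
    qed
    ultimately have "(\<lambda>n. 0) sums Im (cinner (D x) x)" by (simp add: cinner_scaleR_left)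
    then show ?thesis using sums_unique2 sums_zero by blast
  qed
  moreover have "Re (cinner (D x) x) \<le> Re (cinner x x)" for x
    using complex_Re_le_cmod[of "cinner (D x) x"] cmod_cinner_le[of "D x" x]
      mult_right_mono[OF Dn[of x] norm_ge_zero[of x]]
    by (simp add: cinner_self power2_eq_square)
  ultimately have "positive_clinear (\<lambda>x. x - D x)"
    unfolding positive_clinear_def
    by (auto simp: cinner.diff_left cinner_self intro!: bounded_clinear_minus bD)
  moreover have "(x - D x) - D (x - D x) = x - C x" for x
    by (simp add: bounded_clinear_diff[OF bD] DD scaleR_2)
  ultimately show ?thesis
    using Dcomm by (intro exI[of _ "\<lambda>x. x - D x"]) (auto simp: bounded_clinear_diff)
qed

text \<open>If K bounds T, then C = 1 - T / K is positive and at most 1, hence a contraction, and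
  sqrt K times the root of 1 - C is a root of T.\<close>

lemma exists_positive_sqrt:
  fixes T :: "'a::chilbert \<Rightarrow> 'a"
  assumes T: "positive_clinear T"
  shows "\<exists>S. positive_clinear S \<and> (\<forall>x. S (S x) = T x) \<and>
    (\<forall>A. bounded_clinear A \<and> (\<forall>x. A (T x) = T (A x)) \<longrightarrow> (\<forall>x. A (S x) = S (A x)))"
proof -
  have bT: "bounded_clinear T" and Tpos: "Im (cinner (T x) x) = 0" "0 \<le> Re (cinner (T x) x)" for x
    using T by (auto simp: positive_clinear_def)
  obtain K where K: "0 < K" "\<And>x. norm (T x) \<le> K * norm x" using bounded_clinear_bound[OF bT] by blast
  define C where "C x = x - complex_of_real (1 / K) *\<^sub>C T x" for x
  have bC: "bounded_clinear C"
    unfolding C_def by (intro bounded_clinear_minus bounded_clinear_ident bounded_clinear_scale bT)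
  have Cre: "Re (cinner (C x) x) = (norm x)\<^sup>2 - Re (cinner (T x) x) / K" for x
    by (simp add: C_def cinner.diff_left cinner_scaleC_left cinner_self)
  have "Re (cinner (T x) x) \<le> K * (norm x)\<^sup>2" for x
    using complex_Re_le_cmod[of "cinner (T x) x"] cmod_cinner_le[of "T x" x]
      mult_right_mono[OF K(2)[of x] norm_ge_zero[of x]] by (simp add: power2_eq_square)
  then have Cpos: "positive_clinear C"
    using bC Tpos K(1) unfolding positive_clinear_def Cre
    by (auto simp: C_def cinner.diff_left cinner_scaleC_left cinner_self field_simps)
  have Cle: "Re (cinner (C x) x) \<le> (norm x)\<^sup>2" for x
    using Tpos K(1) by (simp add: Cre)
  have "norm (C x) \<le> norm x" for x
  proof -
    \<comment> \<open>Cauchy-Schwarz for the form of C at the vectors x and C x, combined with C <=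
      1, yields the contraction bound.\<close>
    have "((norm (C x))\<^sup>2)\<^sup>2 = (cmod (cinner (C x) (C x)))\<^sup>2" by (simp add: cinner_self norm_power)
    also have "\<dots> \<le> Re (cinner (C x) x) * Re (cinner (C (C x)) (C x))"
      by (rule positive_clinear_cauchy_schwarz[OF Cpos])
    also have "\<dots> \<le> (norm x)\<^sup>2 * (norm (C x))\<^sup>2"
      using Cpos by (intro mult_mono Cle) (auto simp: positive_clinear_def)
    finally have *: "(norm (C x))\<^sup>2 * (norm (C x))\<^sup>2 \<le> (norm x)\<^sup>2 * (norm (C x))\<^sup>2"
      by (simp only: power2_eq_square)
    show ?thesis
    proof (cases "C x = 0")
      case False
      then have "0 < (norm (C x))\<^sup>2" by simp
      from mult_right_le_imp_le[OF * this] show ?thesis by (rule power2_le_imp_le) simp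
    qed simp
  qed
  from exists_sqrt_complement[OF bC this positive_clinear_selfadjoint[OF Cpos]]
  obtain S where S: "positive_clinear S" "\<And>x. S (S x) = x - C x"
    "\<And>A x. bounded_clinear A \<Longrightarrow> (\<And>x. A (C x) = C (A x)) \<Longrightarrow> A (S x) = S (A x)" by blast
  define R where "R x = complex_of_real (sqrt K) *\<^sub>C S x" for x
  have bS: "bounded_clinear S" using S(1) by (simp add: positive_clinear_def)
  have "positive_clinear R"
    using S(1) K(1) unfolding positive_clinear_def R_def
    by (auto simp: cinner_scaleC_left intro!: bounded_clinear_scale)
  moreover have "R (R x) = T x" for x
    using K(1) by (simp add: R_def bounded_clinear_scaleC[OF bS] scaleC_scaleC S(2) C_def flip: of_real_mult)
  moreover have "A (R x) = R (A x)" if A: "bounded_clinear A" "\<And>x. A (T x) = T (A x)" for A x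
  proof -
    have "A (C x) = C (A x)" for x
      by (simp add: C_def bounded_clinear_diff[OF A(1)] bounded_clinear_scaleC[OF A(1)] A(2))
    then show ?thesis using S(3)[OF A(1)] by (simp add: R_def bounded_clinear_scaleC[OF A(1)])
  qed
  ultimately show ?thesis by (intro exI[of _ R]) simp
qed

text \<open>Both roots are compared with a root S that commutes with everything commuting with the
  common square. It commutes in particular with R and with R', which reduces the claim to commuting
  roots.\<close>

lemma positive_sqrt_unique:
  assumes "positive_clinear R" "positive_clinear R'" "\<And>x. R (R x) = R' (R' x)"
  shows "R = R'"
proof -
  have uniq: "R = S" if R: "positive_clinear R" and S: "positive_clinear S" and eq: "\<And>x. R (R x) = S (S x)"
    and comm: "\<And>x. R (S x) = S (R x)" for R S :: "'a \<Rightarrow> 'a"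
  proof
    fix x
    have bR: "bounded_clinear R" and bS: "bounded_clinear S"
      using R S by (auto simp: positive_clinear_def)
    \<comment> \<open>By commutation (S + R) y = (S^2 - R^2) x = 0, so positivity forces S y = R y =
      0; then the inner product of y with itself is that of x with (S - R) y, which
      vanishes.\<close>
    define y where "y = S x - R x"
    have "S y + R y = 0"
      by (simp add: y_def bounded_clinear_diff[OF bS] bounded_clinear_diff[OF bR] eq comm)
    then have "Re (cinner (S y) y) + Re (cinner (R y) y) = 0"
      by (metis Re_complex_of_real cinner_add_left cinner.zero_left of_real_0 plus_complex.sel(1))
    then have "Re (cinner (S y) y) = 0" "Re (cinner (R y) y) = 0"
      using R S unfolding positive_clinear_def by (smt (verit))+
    then have "S y = 0" "R y = 0"
      using positive_clinear_eq_zero R S by blast+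
    then have "cinner y y = 0"
      by (metis (no_types, lifting) cinner.diff_left cinner.zero_right positive_clinear_selfadjoint[OF R]
          positive_clinear_selfadjoint[OF S] y_def diff_zero)
    then show "R x = S x" by (simp add: cinner_self y_def)
  qed
  have bR: "bounded_clinear R" using assms(1) by (simp add: positive_clinear_def)
  have bR': "bounded_clinear R'" using assms(2) by (simp add: positive_clinear_def)
  have "positive_clinear (\<lambda>x. R (R x))"
    using assms(1) positive_clinear_selfadjoint[OF assms(1)]
    by (auto simp: positive_clinear_def cinner_self intro: bounded_clinear_compose)
  from exists_positive_sqrt[OF this] obtain S where S: "positive_clinear S" "\<And>x. S (S x) = R (R x)"
    "\<And>A x. bounded_clinear A \<Longrightarrow> (\<And>x. A (R (R x)) = R (R (A x))) \<Longrightarrow> A (S x) = S (A x)" by blast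
  have "R (S x) = S (R x)" for x by (rule S(3)[OF bR]) simp
  then have "R = S" by (intro uniq) (use assms(1) S(1,2) in auto)
  have "R' (S x) = S (R' x)" for x by (rule S(3)[OF bR']) (simp add: assms(3))
  then have "R' = S" by (intro uniq) (use assms(2,3) S(1,2) in auto)
  with \<open>R = S\<close> show ?thesis by simp
qed

subsection \<open>Factorisation of dominated operators\<close>

text \<open>A substitute for the polar decomposition, applied to \<open>A\<close> and \<open>\<bar>A\<bar>\<close> in both directions.\<close>

lemma factor_through_dominating:
  fixes A R :: "'a::chilbert \<Rightarrow> 'a"
  assumes A: "bounded_clinear A" and R: "bounded_clinear R" and le: "\<And>x. norm (R x) \<le> norm (A x)"
  shows "\<exists>V. bounded_clinear V \<and> (\<forall>x. norm (V x) \<le> norm x) \<and> (\<forall>x. R x = V (A x))"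
proof -
  define M where "M = closure (range A)"
  have "csubspace (range A)"
    unfolding csubspace_def
  proof (intro conjI ballI allI)
    show "0 \<in> range A" by (metis bounded_clinear_zero[OF A] rangeI)
  qed (auto simp flip: bounded_clinear_add[OF A] bounded_clinear_scaleC[OF A])
  then have M: "closed M" "csubspace M" by (simp_all add: M_def csubspace_closure)
  \<comment> \<open>The closure of the graph of the assignment A x \<mapsto> R x, kept as a
    relation. \<open>Gle\<close> passes the norm inequality to limits, and together with linearity
    it makes the relation single valued.\<close>
  define G where "G a w \<longleftrightarrow> (\<exists>s. (\<lambda>n. A (s n)) \<longlonglongrightarrow> a \<and> (\<lambda>n. R (s n)) \<longlonglongrightarrow> w)" for a w
  have Gle: "norm w \<le> norm a" if "G a w" for a w
  proof -
    obtain s where s: "(\<lambda>n. A (s n)) \<longlonglongrightarrow> a" "(\<lambda>n. R (s n)) \<longlonglongrightarrow> w" using \<open>G a w\<close> G_def by blast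
    show ?thesis
      by (rule LIMSEQ_le[OF tendsto_norm[OF s(2)] tendsto_norm[OF s(1)]]) (use le in auto)
  qed
  have Gadd: "G (a + a') (w + w')" if aw: "G a w" "G a' w'" for a w a' w'
  proof -
    obtain s s' where "(\<lambda>n. A (s n)) \<longlonglongrightarrow> a" "(\<lambda>n. R (s n)) \<longlonglongrightarrow> w" 
       "(\<lambda>n. A (s' n)) \<longlonglongrightarrow> a'" "(\<lambda>n. R (s' n)) \<longlonglongrightarrow> w'" using aw G_def by metis
    then show ?thesis unfolding G_def
      by (intro exI[of _ "\<lambda>n. s n + s' n"])
         (simp add: bounded_clinear_add[OF A] bounded_clinear_add[OF R] tendsto_add)
  qed
  have Gscale: "G (c *\<^sub>C a) (c *\<^sub>C w)" if "G a w" for a w c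
  proof -
    obtain s where "(\<lambda>n. A (s n)) \<longlonglongrightarrow> a" "(\<lambda>n. R (s n)) \<longlonglongrightarrow> w" using \<open>G a w\<close> G_def by blast
    then show ?thesis unfolding G_def
      by (intro exI[of _ "\<lambda>n. c *\<^sub>C s n"])
         (simp add: bounded_clinear_scaleC[OF A] bounded_clinear_scaleC[OF R] tendsto_scaleC)
  qed
  have Guniq: "w = w'" if "G a w" "G a w'" for a w w'
    using Gle[OF Gadd[OF that(1) Gscale[OF that(2), of "-1"]]] by simp
  have "\<exists>w. G a w" if aM: "a \<in> M" for a
  proof -
    obtain s where s: "(\<lambda>n. A (s n)) \<longlonglongrightarrow> a"
    proof -
      obtain f where f: "\<And>n. f n \<in> range A" "f \<longlonglongrightarrow> a"
        using aM unfolding M_def closure_sequential by blast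
      then have "\<forall>n. \<exists>z. f n = A z" by blast
      from choice[OF this] obtain s where "f = (\<lambda>n. A (s n))" by auto
      then show ?thesis using f(2) that by auto
    qed
    have "Cauchy (\<lambda>n. A (s n))" using s LIMSEQ_imp_Cauchy by blast
    moreover have "norm (R (s m) - R (s n)) \<le> norm (A (s m) - A (s n))" for m n
      using le[of "s m - s n"] by (simp add: bounded_clinear_diff[OF A] bounded_clinear_diff[OF R])
    ultimately have "Cauchy (\<lambda>n. R (s n))"
      unfolding Cauchy_iff by (meson le_less_trans)
    then show ?thesis using s unfolding G_def by (meson Cauchy_convergent convergent_def)
  qed
  then obtain U where U: "\<And>a. a \<in> M \<Longrightarrow> G a (U a)" by metis
  note in_M = cproj_in[OF M]
  \<comment> \<open>The projection extends the factor by zero to the complement of the closed range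
    of A.\<close>
  define V where "V x = U (cproj M x)" for x
  have GV: "G (cproj M x) (V x)" for x using U[OF in_M] by (simp add: V_def)
  have Vle: "norm (V x) \<le> norm x" for x using Gle[OF GV[of x]] norm_cproj_le[OF M, of x] by linarith
  have "bounded_clinear V"
  proof (rule bounded_clinear_intro[of _ 1])
    note bP = bounded_clinear_cproj[OF M]
    show "V (x + y) = V x + V y" for x y
      using Guniq[OF GV[of "x + y"]] Gadd[OF GV[of x] GV[of y]] by (simp add: bounded_clinear_add[OF bP])
    show "V (a *\<^sub>C x) = a *\<^sub>C V x" for a x
      using Guniq[OF GV[of "a *\<^sub>C x"]] Gscale[OF GV[of x]] by (simp add: bounded_clinear_scaleC[OF bP])
  qed (use Vle in auto)
  moreover have "R x = V (A x)" for x
  proof -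
    have "A x \<in> M" using closure_subset[of "range A"] by (auto simp: M_def)
    then have "G (A x) (V (A x))" using GV[of "A x"] by (simp add: cproj_ident[OF M])
    moreover have "G (A x) (R x)" unfolding G_def by (intro exI[of _ "\<lambda>_. x"]) auto
    ultimately show ?thesis using Guniq by blast
  qed
  ultimately show ?thesis using Vle by blast
qed

subsection \<open>Orthonormal bases of closed subspaces\<close>

definition orthonormal :: "'a::chilbert set \<Rightarrow> bool" where
  "orthonormal E \<longleftrightarrow> (\<forall>e\<in>E. \<forall>f\<in>E. cinner e f = (if e = f then 1 else 0))"

text \<open>Maximality in V instead of density of the span; \<open>onb_has_sum\<close> links the
  two.\<close>

definition onb :: "'a::chilbert set \<Rightarrow> 'a set \<Rightarrow> bool" where
  "onb V E \<longleftrightarrow> E \<subseteq> V \<and> orthonormal E \<and> (\<forall>x\<in>V. (\<forall>e\<in>E. cinner x e = 0) \<longrightarrow> x = 0)"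

lemma orthonormal_subset: "orthonormal E \<Longrightarrow> F \<subseteq> E \<Longrightarrow> orthonormal F"
  unfolding orthonormal_def by blast

text \<open>Completing the square. With the Fourier coefficients for c it gives Bessel's inequality,
  and for general c it shows that the Fourier sum is the best approximation.\<close>

lemma norm_diff_orthonormal_sum:
  assumes "orthonormal F" "finite F"
  shows "(norm (x - (\<Sum>e\<in>F. c e *\<^sub>C e)))\<^sup>2
    = (norm x)\<^sup>2 - (\<Sum>e\<in>F. (cmod (cinner x e))\<^sup>2) + (\<Sum>e\<in>F. (cmod (cinner x e - c e))\<^sup>2)"
proof -
  let ?s = "\<Sum>e\<in>F. c e *\<^sub>C e"
  have xs: "cinner x ?s = (\<Sum>e\<in>F. cnj (c e) * cinner x e)"
    by (simp add: cinner.sum_right cinner_scaleC_right)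
  have se: "cinner ?s f = c f" if "f \<in> F" for f
  proof -
    have "cinner ?s f = (\<Sum>e\<in>F. c e * cinner e f)" by (simp add: cinner.sum_left cinner_scaleC_left)
    also have "\<dots> = (\<Sum>e\<in>F. if e = f then c e else 0)"
      using assms(1) that by (intro sum.cong) (auto simp: orthonormal_def)
    finally show ?thesis using that assms(2) by simp
  qed
  have "cinner ?s ?s = (\<Sum>e\<in>F. cnj (c e) * cinner ?s e)"
    by (subst cinner.sum_right) (simp add: cinner_scaleC_right)
  also have "\<dots> = (\<Sum>e\<in>F. cnj (c e) * c e)" using se by simp
  finally have ss: "cinner ?s ?s = (\<Sum>e\<in>F. cnj (c e) * c e)" .
  have "(norm (x - ?s))\<^sup>2 = (norm x)\<^sup>2 - 2 * Re (cinner x ?s) + Re (cinner ?s ?s)"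
    by (simp add: power2_norm_eq_inner inner_diff_left inner_diff_right inner_commute Re_cinner)
  also have "\<dots> = (norm x)\<^sup>2 + (\<Sum>e\<in>F. - 2 * Re (cnj (c e) * cinner x e) + Re (cnj (c e) * c e))"
    unfolding xs ss by (simp add: sum.distrib sum_distrib_left sum_negf sum_subtractf algebra_simps)
  also have "(\<Sum>e\<in>F. - 2 * Re (cnj (c e) * cinner x e) + Re (cnj (c e) * c e))
      = (\<Sum>e\<in>F. (cmod (cinner x e - c e))\<^sup>2 - (cmod (cinner x e))\<^sup>2)"
    by (intro sum.cong refl) (simp add: cmod_power2, simp add: power2_eq_square algebra_simps)
  finally show ?thesis by (simp add: sum_subtractf)
qed

lemma bessel_inequality:
  assumes "orthonormal F" "finite F"
  shows "(\<Sum>e\<in>F. (cmod (cinner x e))\<^sup>2) \<le> (norm x)\<^sup>2"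
  using norm_diff_orthonormal_sum[OF assms, of x "\<lambda>e. cinner x e"] 
  by (smt (verit, best) diff_self norm_zero power_zero_numeral sum.neutral_const zero_le_power2 sum.cong)

text \<open>Bessel for both vectors and Cauchy-Schwarz for finite sums. In other words, the rank one
  operator built from u and v has trace norm at most norm u * norm v.\<close>

lemma bessel_product:
  assumes "orthonormal F" "finite F"
  shows "(\<Sum>e\<in>F. cmod (cinner e u * cinner v e)) \<le> norm u * norm v"
proof -
  have l2: "L2_set (\<lambda>e. cmod (cinner w e)) F \<le> norm w" for w
    unfolding L2_set_def using bessel_inequality[OF assms, of w] by (simp add: real_le_lsqrt)
  have "(\<Sum>e\<in>F. cmod (cinner e u * cinner v e)) = (\<Sum>e\<in>F. \<bar>cmod (cinner u e)\<bar> * \<bar>cmod (cinner v e)\<bar>)"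
    by (intro sum.cong refl) (metis abs_norm_cancel cinner_commute complex_mod_cnj norm_mult)
  also have "\<dots> \<le> L2_set (\<lambda>e. cmod (cinner u e)) F * L2_set (\<lambda>e. cmod (cinner v e)) F"
    by (rule L2_set_mult_ineq)
  also have "\<dots> \<le> norm u * norm v" by (intro mult_mono l2) (auto simp: L2_set_nonneg)
  finally show ?thesis .
qed

text \<open>By Bessel the squared coefficients are summable, and a summable family has countable
  support. This is what cuts an uncountable basis down to a countable part.\<close>

lemma countable_nonorthogonal:
  assumes "orthonormal E" shows "countable {e\<in>E. cinner x e \<noteq> 0}"
proof -
  have "(\<lambda>e. (cmod (cinner x e))\<^sup>2) summable_on E"
  proof (rule nonneg_bdd_above_summable_on)
    show "bdd_above (sum (\<lambda>e. (cmod (cinner x e))\<^sup>2) ` {F. F \<subseteq> E \<and> finite F})"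
      using bessel_inequality[OF orthonormal_subset[OF assms], of _ x]
      by (auto simp: bdd_above_def intro!: exI[of _ "(norm x)\<^sup>2"])
  qed simp
  then have "countable {e\<in>E. (cmod (cinner x e))\<^sup>2 \<noteq> 0}" by (rule summable_countable_real)
  then show ?thesis by simp
qed

lemma onb_has_sum:
  assumes V: "closed V" "csubspace V" and E: "onb V E" and x: "x \<in> V"
  shows "((\<lambda>e. cinner x e *\<^sub>C e) has_sum x) E"
proof -
  have EV: "E \<subseteq> V" and on: "orthonormal E" and tot: "\<And>x. x \<in> V \<Longrightarrow> (\<And>e. e \<in> E \<Longrightarrow> cinner x e = 0) \<Longrightarrow> x = 0"
    using E by (auto simp: onb_def)
  define S where "S = {\<Sum>e\<in>F. c e *\<^sub>C e |F c. finite F \<and> F \<subseteq> E}"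
  have "csubspace S"
    unfolding csubspace_def
  proof (intro conjI ballI allI)
    show "0 \<in> S" unfolding S_def by (intro CollectI exI[of _ "{}"]) auto
    show "x + y \<in> S" if xy: "x \<in> S" "y \<in> S" for x y
    proof -
      obtain F c G d where F: "finite F" "F \<subseteq> E" "x = (\<Sum>e\<in>F. c e *\<^sub>C e)"
        and G: "finite G" "G \<subseteq> E" "y = (\<Sum>e\<in>G. d e *\<^sub>C e)" using xy unfolding S_def by blast
      have "x = (\<Sum>e\<in>F\<union>G. (if e \<in> F then c e else 0) *\<^sub>C e)"
        unfolding F(3) using F(1) G(1) by (intro sum.mono_neutral_cong_left) auto
      moreover have "y = (\<Sum>e\<in>F\<union>G. (if e \<in> G then d e else 0) *\<^sub>C e)"
        unfolding G(3) using F(1) G(1) by (intro sum.mono_neutral_cong_left) auto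
      ultimately have xy: "x + y = (\<Sum>e\<in>F\<union>G. ((if e \<in> F then c e else 0) + (if e \<in> G then d e else 0)) *\<^sub>C e)"
        by (simp only: scaleC_add_left sum.distrib)
      show ?thesis
        unfolding S_def by (rule CollectI, intro exI conjI, rule xy) (use F G in auto)
    qed
    show "a *\<^sub>C x \<in> S" if x: "x \<in> S" for a x
    proof -
      obtain F c where F: "finite F" "F \<subseteq> E" "x = (\<Sum>e\<in>F. c e *\<^sub>C e)" using x unfolding S_def by blast
      have ax: "a *\<^sub>C x = (\<Sum>e\<in>F. (a * c e) *\<^sub>C e)" unfolding F(3) by (simp add: scaleC_sum_right scaleC_scaleC)
      show ?thesis
        unfolding S_def by (rule CollectI, intro exI conjI, rule ax) (use F in auto)
    qed
  qed
  then have W: "closed (closure S)" "csubspace (closure S)" by (simp_all add: csubspace_closure)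
  have "S \<subseteq> V" unfolding S_def using EV by (auto intro!: csubspace_sum[OF V(2)] csubspaceD(3)[OF V(2)])
  then have WV: "closure S \<subseteq> V" using V(1) by (rule closure_minimal)
  have ES: "E \<subseteq> closure S"
  proof
    fix e assume "e \<in> E"
    have "e \<in> S" using \<open>e \<in> E\<close> unfolding S_def by (intro CollectI exI[of _ "{e}"] exI[of _ "\<lambda>_. 1"]) auto
    then show "e \<in> closure S" using closure_subset by blast
  qed
  \<comment> \<open>The residual of the projection onto the closed span lies in V and is orthogonal
    to E, so it vanishes by maximality.\<close>
  have "x - cproj (closure S) x = 0"
    using cproj_in[OF W, of x] WV x cproj_orth[OF W, of _ x] ES by (intro tot csubspaceD(5)[OF V(2)]) auto
  then have xS: "x \<in> closure S" using cproj_in[OF W, of x] by simp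
  show ?thesis
    unfolding has_sum_def tendsto_iff
  proof (intro allI impI)
    fix r :: real assume "0 < r"
    then obtain y where y: "y \<in> S" "dist y x < r" using xS by (meson closure_approachable)
    obtain F c where F: "finite F" "F \<subseteq> E" "y = (\<Sum>e\<in>F. c e *\<^sub>C e)" using y(1) unfolding S_def by blast
    show "\<forall>\<^sub>F G in finite_subsets_at_top E. dist (\<Sum>e\<in>G. cinner x e *\<^sub>C e) x < r"
      unfolding eventually_finite_subsets_at_top
    proof (intro exI[of _ F] conjI allI impI)
      \<comment> \<open>y is also a combination over G, hence no closer to x than the Fourier sum
        over G.\<close>
      fix G assume G: "finite G \<and> F \<subseteq> G \<and> G \<subseteq> E"
      have oG: "orthonormal G" using orthonormal_subset[OF on] G by blast
      have "y = (\<Sum>e\<in>G. (if e \<in> F then c e else 0) *\<^sub>C e)"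
        unfolding F(3) using F(1) G by (intro sum.mono_neutral_cong_left) auto
      then have "(norm (x - y))\<^sup>2 \<ge> (norm x)\<^sup>2 - (\<Sum>e\<in>G. (cmod (cinner x e))\<^sup>2)"
        using G by (simp add: norm_diff_orthonormal_sum[OF oG] sum_nonneg)
      then have "(norm (x - (\<Sum>e\<in>G. cinner x e *\<^sub>C e)))\<^sup>2 \<le> (norm (x - y))\<^sup>2"
        using G by (simp add: norm_diff_orthonormal_sum[OF oG])
      then have "norm (x - (\<Sum>e\<in>G. cinner x e *\<^sub>C e)) \<le> norm (x - y)"
        by (rule power2_le_imp_le) simp
      then show "dist (\<Sum>e\<in>G. cinner x e *\<^sub>C e) x < r"
        using y(2) by (simp add: dist_norm norm_minus_commute)
    qed (use F in auto)
  qed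
qed

lemma onb_parseval:
  assumes "closed V" "csubspace V" "onb V E" "x \<in> V"
  shows "((\<lambda>e. cinner e y * cinner x e) has_sum cinner x y) E"
  using has_sum_bounded_linear[OF cinner.bounded_linear_left onb_has_sum[OF assms], of y]
  by (simp add: cinner_scaleC_left mult.commute)


subsection \<open>Nuclear representations and trace bounds\<close>

text \<open>Neither family is required to be orthogonal and zero vectors are allowed, so the
  representation survives composition with bounded operators. Indexing by nat makes the series
  accessible to dominated convergence.\<close>

definition nuclear_rep :: "(nat \<Rightarrow> 'a::chilbert) \<Rightarrow> (nat \<Rightarrow> 'a) \<Rightarrow> ('a \<Rightarrow> 'a) \<Rightarrow> bool" where
  "nuclear_rep u v A \<longleftrightarrow> summable (\<lambda>n. norm (u n) * norm (v n)) \<and>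
     (\<forall>x. (\<lambda>n. cinner x (u n) *\<^sub>C v n) sums A x)"

text \<open>The least \<open>M\<close> is the trace norm; unlike the series in the definition of trace class, this
  characterisation passes through weak integrals.\<close>

definition trace_bound :: "('a::chilbert \<Rightarrow> 'a) \<Rightarrow> real \<Rightarrow> bool" where
  "trace_bound A M \<longleftrightarrow> (\<forall>C F. bounded_clinear C \<and> (\<forall>x. norm (C x) \<le> norm x) \<and> finite F \<and> orthonormal F \<longrightarrow>
     (\<Sum>e\<in>F. cmod (cinner (A e) (C e))) \<le> M)"

lemma nuclear_rep_compose:
  assumes A: "nuclear_rep u v A" and L: "bounded_clinear L" and M: "bounded_clinear M"
  shows "nuclear_rep (\<lambda>n. cadj M (u n)) (\<lambda>n. L (v n)) (\<lambda>x. L (A (M x)))"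
  unfolding nuclear_rep_def
proof (intro conjI allI)
  obtain K where K: "0 < K" "\<And>x. norm (L x) \<le> K * norm x" using bounded_clinear_bound[OF L] by blast
  obtain K' where K': "0 < K'" "\<And>x. norm (cadj M x) \<le> K' * norm x"
    using bounded_clinear_bound[OF bounded_clinear_cadj[OF M]] by blast
  have s: "summable (\<lambda>n. norm (u n) * norm (v n))" using A by (simp add: nuclear_rep_def)
  show "summable (\<lambda>n. norm (cadj M (u n)) * norm (L (v n)))"
  proof (rule summable_comparison_test'[OF summable_mult[OF s, of "K' * K"], of 0])
    show "norm (norm (cadj M (u n)) * norm (L (v n))) \<le> K' * K * (norm (u n) * norm (v n))" for n
      using mult_mono[OF K'(2)[of "u n"] K(2)[of "v n"]] K'(1) by (simp add: mult_ac)
  qed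
  fix x
  have "(\<lambda>n. L (cinner (M x) (u n) *\<^sub>C v n)) sums L (A (M x))"
    using A by (intro bounded_linear.sums[OF bounded_clinear_imp_bounded_linear[OF L]]) (simp add: nuclear_rep_def)
  then show "(\<lambda>n. cinner x (cadj M (u n)) *\<^sub>C L (v n)) sums L (A (M x))"
    by (simp add: bounded_clinear_scaleC[OF L] cinner_cadj_right[OF M])
qed

text \<open>The double family over n and e is absolutely summable by \<open>bessel_product\<close>.
  Summing over e first gives the right-hand side by Parseval in V, summing over n first gives the
  diagonal of A; so the value does not depend on the basis. Parseval needs \<open>v n\<close> in V,
  while \<open>u n\<close> is arbitrary.\<close>

lemma nuclear_rep_trace:
  assumes A: "nuclear_rep u v A" and V: "closed V" "csubspace V" and E: "onb V E" and v: "\<And>n. v n \<in> V"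
  shows "((\<lambda>e. cinner (A e) e) has_sum (\<Sum>n. cinner (v n) (u n))) E"
proof -
  have s: "summable (\<lambda>n. norm (u n) * norm (v n))" and Ax: "\<And>x. (\<lambda>n. cinner x (u n) *\<^sub>C v n) sums A x"
    using A by (auto simp: nuclear_rep_def)
  have on: "orthonormal E" using E by (simp add: onb_def)
  define f where "f = (\<lambda>(n, e). cinner e (u n) * cinner (v n) e)"
  have inner: "(\<lambda>e. cmod (f (n, e))) summable_on E" "infsum (\<lambda>e. cmod (f (n, e))) E \<le> norm (u n) * norm (v n)" for n
  proof -
    have b: "sum (\<lambda>e. cmod (f (n, e))) F \<le> norm (u n) * norm (v n)" if "F \<subseteq> E" "finite F" for F
      using bessel_product[OF orthonormal_subset[OF on that(1)] that(2), of "u n" "v n"] by (simp add: f_def)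
    show sm: "(\<lambda>e. cmod (f (n, e))) summable_on E"
      by (rule nonneg_bdd_above_summable_on) (use b in \<open>auto simp: bdd_above_def\<close>)
    show "infsum (\<lambda>e. cmod (f (n, e))) E \<le> norm (u n) * norm (v n)"
      by (rule infsum_le_finite_sums[OF sm]) (use b in auto)
  qed
  have su: "(\<lambda>n. norm (u n) * norm (v n)) summable_on UNIV"
    using s by (subst summable_on_UNIV_nonneg_real_iff) auto
  have "(\<lambda>p. norm (f p)) summable_on UNIV \<times> E"
    unfolding Infinite_Sum.abs_summable_on_Sigma_iff
  proof (intro conjI ballI)
    show "(\<lambda>n. norm (infsum (\<lambda>e. cmod (f (n, e))) E)) summable_on UNIV"
      by (rule summable_on_comparison_test[OF su]) (use inner in \<open>auto simp: infsum_nonneg\<close>)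
  qed (use inner in auto)
  then obtain t where t: "(f has_sum t) (UNIV \<times> E)"
    using abs_summable_summable summable_on_def by blast
  have "((\<lambda>n. cinner (v n) (u n)) has_sum t) UNIV"
    by (rule has_sum_SigmaD[OF t]) (use onb_parseval[OF V E v] in \<open>auto simp: f_def\<close>)
  then have "(\<lambda>n. cinner (v n) (u n)) sums t" by (rule has_sum_imp_sums)
  then have t_eq: "t = (\<Sum>n. cinner (v n) (u n))" by (rule sums_unique)
  have t': "((\<lambda>(e, n). f (n, e)) has_sum t) (E \<times> UNIV)"
    using t by (subst has_sum_reindex_bij_witness[where j = "\<lambda>(e, n). (n, e)" and i = "\<lambda>(n, e). (e, n)"
            and T = "UNIV \<times> E" and h = f and s' = t]) auto
  have "((\<lambda>e. cinner (A e) e) has_sum t) E"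
  proof (rule has_sum_SigmaD[OF t'])
    fix e assume e: "e \<in> E"
    have "(\<lambda>n. cinner (cinner e (u n) *\<^sub>C v n) e) sums cinner (A e) e"
      by (rule bounded_linear.sums[OF cinner.bounded_linear_left Ax])
    then have "(\<lambda>n. f (n, e)) sums cinner (A e) e" by (simp add: f_def cinner_scaleC_left)
    moreover have "summable (\<lambda>n. norm (f (n, e)))"
    proof (rule summable_comparison_test'[OF s, of 0])
      show "norm (norm (f (n, e))) \<le> norm (u n) * norm (v n)" for n
        using bessel_product[OF orthonormal_subset[OF on, of "{e}"], of "u n" "v n"] e by (simp add: f_def)
    qed
    ultimately show "((\<lambda>n. case (e, n) of (e, n) \<Rightarrow> f (n, e)) has_sum cinner (A e) e) UNIV"
      by (simp add: norm_summable_imp_has_sum)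
  qed
  then show ?thesis by (simp add: t_eq)
qed

text \<open>Moving C to the other side replaces \<open>v n\<close> by its image under the adjoint of
  C, of no greater norm; \<open>bessel_product\<close> then bounds every term of the series.\<close>

lemma nuclear_rep_trace_bound:
  fixes A :: "'a::chilbert \<Rightarrow> 'a"
  assumes A: "nuclear_rep u v A" shows "trace_bound A (\<Sum>n. norm (u n) * norm (v n))"
  unfolding trace_bound_def
proof (intro allI impI, elim conjE)
  fix C :: "'a \<Rightarrow> 'a" and F :: "'a set"
  assume C: "bounded_clinear C" "\<forall>x. norm (C x) \<le> norm x" and F: "finite F" "orthonormal F"
  have s: "summable (\<lambda>n. norm (u n) * norm (v n))" and Ax: "\<And>x. (\<lambda>n. cinner x (u n) *\<^sub>C v n) sums A x"
    using A by (auto simp: nuclear_rep_def)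
  let ?h = "\<lambda>e n. cmod (cinner e (u n) * cinner (cadj C (v n)) e)"
  have b: "(\<Sum>e\<in>F. ?h e n) \<le> norm (u n) * norm (v n)" for n
  proof -
    have "(\<Sum>e\<in>F. ?h e n) \<le> norm (u n) * norm (cadj C (v n))" by (rule bessel_product[OF F(2,1)])
    also have "\<dots> \<le> norm (u n) * norm (v n)"
      using norm_cadj_le[OF C(1), of 1] C(2) by (intro mult_left_mono) auto
    finally show ?thesis .
  qed
  have sh: "summable (?h e)" if "e \<in> F" for e
  proof (rule summable_comparison_test'[OF s, of 0])
    show "norm (?h e n) \<le> norm (u n) * norm (v n)" for n
      using member_le_sum[OF that, of "\<lambda>e. ?h e n"] b[of n] F(1) by simp
  qed
  have "cmod (cinner (A e) (C e)) \<le> (\<Sum>n. ?h e n)" if e: "e \<in> F" for e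
  proof -
    have "(\<lambda>n. cinner (cinner e (u n) *\<^sub>C v n) (C e)) sums cinner (A e) (C e)"
      by (rule bounded_linear.sums[OF cinner.bounded_linear_left Ax])
    then have "cinner (A e) (C e) = (\<Sum>n. cinner e (u n) * cinner (cadj C (v n)) e)"
      by (simp add: cinner_scaleC_left cinner_cadj_left[OF C(1)] sums_iff)
    then show ?thesis using summable_norm[OF sh[OF e]] by simp
  qed
  then have "(\<Sum>e\<in>F. cmod (cinner (A e) (C e))) \<le> (\<Sum>e\<in>F. \<Sum>n. ?h e n)"
    by (rule sum_mono)
  also have "\<dots> = (\<Sum>n. \<Sum>e\<in>F. ?h e n)" by (rule suminf_sum[symmetric, OF sh])
  also have "\<dots> \<le> (\<Sum>n. norm (u n) * norm (v n))"
    by (rule suminf_le[OF b summable_sum[OF sh] s])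
  finally show "(\<Sum>e\<in>F. cmod (cinner (A e) (C e))) \<le> (\<Sum>n. norm (u n) * norm (v n))" .
qed

section \<open>Absolute values and criteria for the trace class\<close>

definition cabs :: "('a::chilbert \<Rightarrow> 'a) \<Rightarrow> 'a \<Rightarrow> 'a" where
  "cabs A = (THE R. positive_clinear R \<and> (\<forall>x. R (R x) = cadj A (A x)))"

lemma
  assumes A: "bounded_clinear A"
  shows positive_cabs: "positive_clinear (cabs A)" and cabs_square: "cabs A (cabs A x) = cadj A (A x)"
    and norm_cabs: "norm (cabs A x) = norm (A x)"
proof -
  have "positive_clinear (\<lambda>x. cadj A (A x))"
    unfolding positive_clinear_def
    by (auto simp: cinner_cadj_left[OF A] cinner_self intro: bounded_clinear_compose bounded_clinear_cadj A)
  from exists_positive_sqrt[OF this]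
  obtain R where R: "positive_clinear R" "\<And>x. R (R x) = cadj A (A x)" by blast
  have "positive_clinear (cabs A) \<and> (\<forall>x. cabs A (cabs A x) = cadj A (A x))"
    unfolding cabs_def
  proof (rule theI[of _ R])
    show "R' = R" if "positive_clinear R' \<and> (\<forall>x. R' (R' x) = cadj A (A x))" for R'
      by (rule positive_sqrt_unique) (use that R in auto)
  qed (use R in auto)
  then show p: "positive_clinear (cabs A)" and sq: "cabs A (cabs A x) = cadj A (A x)" for x by auto
  have "complex_of_real ((norm (cabs A x))\<^sup>2) = complex_of_real ((norm (A x))\<^sup>2)"
    by (simp only: cinner_self[symmetric] positive_clinear_selfadjoint[OF p] sq cinner_cadj_right[OF A])
  then have "(norm (cabs A x))\<^sup>2 = (norm (A x))\<^sup>2" by (simp only: of_real_eq_iff)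
  then show "norm (cabs A x) = norm (A x)" by (simp add: power2_eq_iff_nonneg)
qed

lemma cabs_unique:
  assumes "bounded_clinear A" "positive_clinear R" "\<And>x. R (R x) = cadj A (A x)" shows "R = cabs A"
  by (rule positive_sqrt_unique[OF assms(2) positive_cabs[OF assms(1)]]) (simp add: assms(3) cabs_square[OF assms(1)])

text \<open>The absolute value is V A with a contraction V, so its diagonal at e is the inner
  product of A e with the adjoint of V at e. Such sums are covered because a trace bound quantifies
  over all contractions.\<close>

lemma trace_bound_imp_summable:
  assumes A: "bounded_clinear A" and tb: "trace_bound A M" and E: "orthonormal E"
  shows "(\<lambda>e. Re (cinner (cabs A e) e)) summable_on E"
proof -
  have R: "positive_clinear (cabs A)" and bR: "bounded_clinear (cabs A)"
    using positive_cabs[OF A] by (auto simp: positive_clinear_def)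
  obtain V where V: "bounded_clinear V" "\<And>x. norm (V x) \<le> norm x" "\<And>x. cabs A x = V (A x)"
    using factor_through_dominating[OF A bR] norm_cabs[OF A] by auto
  have "sum (\<lambda>e. Re (cinner (cabs A e) e)) F \<le> M" if F: "F \<subseteq> E" "finite F" for F
  proof -
    have "norm (cadj V x) \<le> norm x" for x using norm_cadj_le[OF V(1), of 1] V(2) by auto
    then have "(\<Sum>e\<in>F. cmod (cinner (A e) (cadj V e))) \<le> M"
      using tb F orthonormal_subset[OF E F(1)] bounded_clinear_cadj[OF V(1)] by (auto simp: trace_bound_def)
    moreover have "Re (cinner (cabs A e) e) \<le> cmod (cinner (A e) (cadj V e))" for e
      by (simp add: cinner_cadj_right[OF V(1)] V(3) complex_Re_le_cmod)
    then have "sum (\<lambda>e. Re (cinner (cabs A e) e)) F \<le> (\<Sum>e\<in>F. cmod (cinner (A e) (cadj V e)))"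
      by (rule sum_mono)
    ultimately show ?thesis by linarith
  qed
  then show ?thesis
    using R by (intro nonneg_bdd_above_summable_on) (auto simp: bdd_above_def positive_clinear_def)
qed

text \<open>Enumerates a countable, possibly finite set by all natural numbers; spare indices give
  0, which adds nothing to sums whose terms vanish at 0.\<close>

definition enum0 :: "'a::zero set \<Rightarrow> nat \<Rightarrow> 'a" where
  "enum0 D n = (if n \<in> to_nat_on D ` D then from_nat_into D n else 0)"

lemma has_sum_enum0:
  fixes f :: "'a::zero \<Rightarrow> 'b::{comm_monoid_add, topological_space}"
  assumes D: "countable D" and f: "(f has_sum t) D" and f0: "f 0 = 0"
  shows "((\<lambda>n. f (enum0 D n)) has_sum t) UNIV"
proof -
  have inj: "inj_on (to_nat_on D) D" using D by (simp add: inj_on_to_nat_on)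
  have "(((\<lambda>n. f (enum0 D n)) \<circ> to_nat_on D) has_sum t) D"
    by (rule has_sum_cong[THEN iffD1, OF _ f]) (simp add: enum0_def from_nat_into_to_nat_on[OF D])
  then have "((\<lambda>n. f (enum0 D n)) has_sum t) (to_nat_on D ` D)" by (simp add: has_sum_reindex[OF inj])
  then show ?thesis
    by (rule has_sum_cong_neutral[THEN iffD1, rotated -1]) (auto simp: enum0_def f0)
qed

text \<open>With S the root of the absolute value, A = U S S for a contraction U, and expanding S x
  in the basis gives A x as the sum of <x, S e> U (S e). The squared norms of the S e are the
  diagonal of the absolute value, hence summable; so only countably many S e are nonzero, and these
  are enumerated by nat.\<close>

lemma summable_imp_nuclear_rep:
  assumes A: "bounded_clinear A" and V: "closed V" "csubspace V" and E: "onb V E"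
    and zero: "\<And>x. (\<And>v. v \<in> V \<Longrightarrow> cinner x v = 0) \<Longrightarrow> A x = 0"
    and sm: "(\<lambda>e. Re (cinner (cabs A e) e)) summable_on E"
  shows "\<exists>u v. nuclear_rep u v A"
proof -
  have R: "positive_clinear (cabs A)" and bR: "bounded_clinear (cabs A)"
    using positive_cabs[OF A] by (auto simp: positive_clinear_def)
  obtain U where U: "bounded_clinear U" "\<And>x. norm (U x) \<le> norm x" "\<And>x. A x = U (cabs A x)"
    using factor_through_dominating[OF bR A] norm_cabs[OF A] by auto
  obtain S where S: "positive_clinear S" "\<And>x. S (S x) = cabs A x"
    using exists_positive_sqrt[OF R] by blast
  have bS: "bounded_clinear S" using S(1) by (simp add: positive_clinear_def)
  note sa = positive_clinear_selfadjoint[OF S(1)]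
  have nS: "(norm (S x))\<^sup>2 = Re (cinner (cabs A x) x)" for x
  proof -
    have "cinner (S x) (S x) = cinner (cabs A x) x" by (metis sa S(2))
    then show ?thesis by (metis cinner_self Re_complex_of_real)
  qed
  \<comment> \<open>The basis spans only V, so S x has to lie there. By self-adjointness this
    follows once S vanishes on the orthogonal complement.\<close>
  have SV: "S x \<in> V" for x
    unfolding in_closed_subspace_iff[OF V]
  proof (intro allI impI)
    fix y assume "\<forall>v\<in>V. cinner y v = 0"
    then have "norm (cabs A y) = 0" using zero[of y] by (simp add: norm_cabs[OF A])
    then have "S y = 0" using nS[of y] by simp
    then show "cinner (S x) y = 0" by (simp add: sa)
  qed
  have hs: "((\<lambda>e. cinner x (S e) *\<^sub>C U (S e)) has_sum A x) E" for x
  proof -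
    have "((\<lambda>e. U (S (cinner (S x) e *\<^sub>C e))) has_sum U (S (S x))) E"
      by (rule has_sum_bounded_linear[OF bounded_linear_compose[OF U(1)[THEN bounded_clinear_imp_bounded_linear]
           bS[THEN bounded_clinear_imp_bounded_linear]] onb_has_sum[OF V E SV]])
    then show ?thesis
      by (simp add: bounded_clinear_scaleC[OF U(1)] bounded_clinear_scaleC[OF bS] sa S(2) U(3)[symmetric])
  qed
  have sm2: "(\<lambda>e. (norm (S e))\<^sup>2) summable_on E" using sm by (simp add: nS)
  have sm3: "(\<lambda>e. norm (S e) * norm (U (S e))) summable_on E"
    by (rule summable_on_comparison_test[OF sm2]) (use U(2) in \<open>auto simp: power2_eq_square intro!: mult_left_mono\<close>)
  define D where "D = {e\<in>E. (norm (S e))\<^sup>2 \<noteq> 0}"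
  have D: "countable D" unfolding D_def by (rule summable_countable_real[OF sm2])
  define w where "w n = S (enum0 D n)" for n
  have S0: "S 0 = 0" by (rule bounded_clinear_zero[OF bS])
  have transfer: "((\<lambda>n. h (w n)) has_sum t) UNIV" if t: "((\<lambda>e. h (S e)) has_sum t) E" and h: "h 0 = 0"
    for h :: "'a \<Rightarrow> 'b::{comm_monoid_add, topological_space}" and t
  proof -
    have "((\<lambda>e. h (S e)) has_sum t) D"
      using t by (rule has_sum_cong_neutral[THEN iffD1, rotated -1]) (auto simp: D_def h)
    then show ?thesis unfolding w_def by (rule has_sum_enum0[OF D]) (simp add: S0 h)
  qed
  have "nuclear_rep w (\<lambda>n. U (w n)) A"
    unfolding nuclear_rep_def
  proof (intro conjI allI)
    obtain t where "((\<lambda>e. norm (S e) * norm (U (S e))) has_sum t) E" using sm3 summable_on_def by blast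
    then have "((\<lambda>n. norm (w n) * norm (U (w n))) has_sum t) UNIV" by (rule transfer) simp
    then show "summable (\<lambda>n. norm (w n) * norm (U (w n)))" using has_sum_imp_sums sums_summable by blast
    show "(\<lambda>n. cinner x (w n) *\<^sub>C U (w n)) sums A x" for x
      by (rule has_sum_imp_sums, rule transfer[OF hs]) simp
  qed
  then show ?thesis by blast
qed

section \<open>Integrals against positive operator valued measures\<close>

lemma bounded_clinear_sum_fun:
  "(\<And>i. i \<in> I \<Longrightarrow> bounded_clinear (f i)) \<Longrightarrow> bounded_clinear (\<lambda>x. \<Sum>i\<in>I. f i x)"
proof (induction I rule: infinite_finite_induct)
  case (insert i I)
  then show ?case by (simp add: bounded_clinear_plus)
qed (simp_all add: bounded_clinear_def)

text \<open>The factors 1/2 sit inside the vectors so that the coefficients are exactly the powers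
  of i prescribed by \<open>complex_measure_integral\<close>.\<close>

lemma polarization:
  assumes A: "bounded_clinear (A::'a::chilbert \<Rightarrow> 'a)"
  shows "(\<Sum>n<4. \<i> ^ n * cinner (A ((1/2) *\<^sub>C (x + \<i> ^ n *\<^sub>C y))) ((1/2) *\<^sub>C (x + \<i> ^ n *\<^sub>C y))) = cinner (A x) y"
proof -
  have "\<i> ^ n * cinner (A (x + \<i> ^ n *\<^sub>C y)) (x + \<i> ^ n *\<^sub>C y) =
    \<i> ^ n * cinner (A x) x + (\<i> ^ n * cnj (\<i> ^ n)) * cinner (A x) y
     + \<i> ^ n * \<i> ^ n * cinner (A y) x + \<i> ^ n * (\<i> ^ n * cnj (\<i> ^ n)) * cinner (A y) y" for n
    by (simp add: bounded_clinear_add[OF A] bounded_clinear_scaleC[OF A] cinner_add_left cinner_add_right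
        cinner_scaleC_left cinner_scaleC_right algebra_simps)
  moreover have "\<i> ^ n * cnj (\<i> ^ n) = 1" for n
    by (simp add: complex_norm_square[symmetric] norm_power del: complex_cnj_power)
  ultimately have "\<i> ^ n * cinner (A (x + \<i> ^ n *\<^sub>C y)) (x + \<i> ^ n *\<^sub>C y) =
    \<i> ^ n * cinner (A x) x + cinner (A x) y + \<i> ^ n * \<i> ^ n * cinner (A y) x + \<i> ^ n * cinner (A y) y" for n
    by simp
  then have "(\<Sum>n<4. \<i> ^ n * cinner (A (x + \<i> ^ n *\<^sub>C y)) (x + \<i> ^ n *\<^sub>C y)) = 4 * cinner (A x) y"
    by (simp add: eval_nat_numeral algebra_simps)
  then show ?thesis
    by (simp add: bounded_clinear_scaleC[OF A] cinner_scaleC_left cinner_scaleC_right mult.left_commute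
        sum_distrib_left[symmetric] sum_divide_distrib[symmetric])
qed

lemma complex_simple_approximation:
  fixes f :: "'w \<Rightarrow> complex"
  assumes f: "f \<in> borel_measurable M"
  obtains F where "\<And>i. simple_function M (F i)" "\<And>w. w \<in> space M \<Longrightarrow> (\<lambda>i. F i w) \<longlonglongrightarrow> f w"
    "\<And>i w. w \<in> space M \<Longrightarrow> cmod (F i w) \<le> 2 * cmod (f w)"
proof -
  from borel_measurable_implies_sequence_metric[OF f, of 0] obtain F where
    "(\<forall>i. simple_function M (F i)) \<and> (\<forall>w\<in>space M. (\<lambda>i. F i w) \<longlonglongrightarrow> f w) \<and>
     (\<forall>i. \<forall>w\<in>space M. dist (F i w) 0 \<le> 2 * dist (f w) 0)" ..
  then show ?thesis by (intro that[of F]) auto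
qed

text \<open>K may exceed the range: it will be the range of a simple function of two variables,
  while f is a section of that function.\<close>

lemma integral_finite_range:
  fixes f :: "'w \<Rightarrow> complex"
  assumes N: "finite_measure N" and fin: "finite K" and K: "f ` space N \<subseteq> K"
    and ms: "\<And>v. v \<in> K \<Longrightarrow> f -` {v} \<inter> space N \<in> sets N"
  shows "(\<integral>w. f w \<partial>N) = (\<Sum>v\<in>K. v * complex_of_real (measure N (f -` {v} \<inter> space N)))"
proof -
  interpret finite_measure N by (rule N)
  have eq: "f w = (\<Sum>v\<in>K. v * complex_of_real (indicator (f -` {v} \<inter> space N) w))" if "w \<in> space N" for w
  proof -
    have "(\<Sum>v\<in>K. v * complex_of_real (indicator (f -` {v} \<inter> space N) w)) = (\<Sum>v\<in>K. if f w = v then v else 0)"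
      using that by (intro sum.cong) (auto simp: indicator_def)
    also have "\<dots> = f w" using that fin K by auto
    finally show ?thesis by simp
  qed
  have "(\<integral>w. f w \<partial>N) = (\<integral>w. (\<Sum>v\<in>K. v * complex_of_real (indicator (f -` {v} \<inter> space N) w)) \<partial>N)"
    by (rule Bochner_Integration.integral_cong[OF refl], rule eq)
  also have "\<dots> = (\<Sum>v\<in>K. v * complex_of_real (measure N (f -` {v} \<inter> space N)))"
    using ms by (subst Bochner_Integration.integral_sum) (auto simp: less_top[symmetric])
  finally show ?thesis .
qed

text \<open>After transfer to the common space the total mass of a projection valued measure is the
  projection onto a subspace, so it is only asked to be a contraction. Positivity of the values
  makes every diagonal coefficient a finite measure.\<close>

definition povm :: "'w measure \<Rightarrow> ('w set \<Rightarrow> 'a::chilbert \<Rightarrow> 'a) \<Rightarrow> bool" where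
  "povm M p \<longleftrightarrow> (\<forall>G\<in>sets M. positive_clinear (p G)) \<and> (\<forall>z. norm (p (space M) z) \<le> norm z) \<and>
     (\<forall>G :: nat \<Rightarrow> 'w set. range G \<subseteq> sets M \<and> disjoint_family G \<longrightarrow>
       (\<forall>x y. (\<lambda>n. cinner (p (G n) x) y) sums cinner (p (\<Union>n. G n) x) y))"

definition povm_measure :: "'w measure \<Rightarrow> ('w set \<Rightarrow> 'a::chilbert \<Rightarrow> 'a) \<Rightarrow> 'a \<Rightarrow> 'w measure" where
  "povm_measure M p z = measure_of (space M) (sets M) (\<lambda>G. ennreal (Re (cinner (p G z) z)))"

text \<open>The integral against the complex measure \<open>\<langle>p(\<cdot>) x, y\<rangle>\<close>, decomposed by polarization.\<close>

definition povm_form ::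
    "'w measure \<Rightarrow> ('w set \<Rightarrow> 'a::chilbert \<Rightarrow> 'a) \<Rightarrow> ('w \<Rightarrow> complex) \<Rightarrow> 'a \<Rightarrow> 'a \<Rightarrow> complex" where
  "povm_form M p f x y =
     (\<Sum>n<4. \<i> ^ n * (\<integral>w. f w \<partial>povm_measure M p ((1/2) *\<^sub>C (x + \<i> ^ n *\<^sub>C y))))"

definition ess_bounded_by ::
    "'w measure \<Rightarrow> ('w set \<Rightarrow> 'a::chilbert \<Rightarrow> 'a) \<Rightarrow> ('w \<Rightarrow> complex) \<Rightarrow> real \<Rightarrow> bool" where
  "ess_bounded_by M p f c \<longleftrightarrow> f \<in> borel_measurable M \<and> 0 \<le> c \<and>
     (\<forall>z. p {w\<in>space M. c < cmod (f w)} z = 0)"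

definition povm_integral ::
    "'w measure \<Rightarrow> ('w set \<Rightarrow> 'a::chilbert \<Rightarrow> 'a) \<Rightarrow> ('w \<Rightarrow> complex) \<Rightarrow> 'a \<Rightarrow> 'a" where
  "povm_integral M p f = (SOME A. bounded_clinear A \<and> (\<forall>x y. cinner (A x) y = povm_form M p f x y))"

context
  fixes M :: "'w measure" and p :: "'w set \<Rightarrow> 'a::chilbert \<Rightarrow> 'a"
  assumes povm: "povm M p"
begin

lemma povm_positive: "G \<in> sets M \<Longrightarrow> positive_clinear (p G)"
  and povm_clinear: "G \<in> sets M \<Longrightarrow> bounded_clinear (p G)"
  using povm by (auto simp: povm_def positive_clinear_def)

lemma povm_sums:
  fixes G :: "nat \<Rightarrow> 'w set"
  shows "range G \<subseteq> sets M \<Longrightarrow> disjoint_family G \<Longrightarrow> (\<lambda>n. cinner (p (G n) x) y) sums cinner (p (\<Union>n. G n) x) y"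
  using povm by (simp add: povm_def)

lemma povm_empty: "p {} x = 0"
proof (rule cinner_ext)
  fix y
  \<comment> \<open>The empty set is a disjoint union of infinitely many copies of itself, and a
    constant series converges only if the constant is 0.\<close>
  have "(\<lambda>n::nat. cinner (p {} x) y) sums cinner (p (\<Union>n::nat. {}) x) y"
    by (rule povm_sums) (auto simp: disjoint_family_on_def)
  then have "summable (\<lambda>n::nat. cinner (p {} x) y)" by (rule sums_summable)
  then show "cinner (p {} x) y = cinner 0 y" by (simp add: summable_const_iff)
qed

lemma sets_povm_measure [simp, measurable_cong]: "sets (povm_measure M p z) = sets M"
  and space_povm_measure [simp]: "space (povm_measure M p z) = space M"
  by (simp_all add: povm_measure_def)

lemma emeasure_povm_measure:
  assumes "G \<in> sets M" shows "emeasure (povm_measure M p z) G = ennreal (Re (cinner (p G z) z))"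
  unfolding povm_measure_def
proof (rule emeasure_measure_of_sigma[OF _ _ _ assms])
  show "sigma_algebra (space M) (sets M)" by (rule sets.sigma_algebra_axioms)
  show "positive (sets M) (\<lambda>G. ennreal (Re (cinner (p G z) z)))"
    by (simp add: positive_def povm_empty)
  show "countably_additive (sets M) (\<lambda>G. ennreal (Re (cinner (p G z) z)))"
  proof (rule countably_additiveI)
    fix G :: "nat \<Rightarrow> 'w set"
    assume G: "range G \<subseteq> sets M" "disjoint_family G"
    have "(\<lambda>n. Re (cinner (p (G n) z) z)) sums Re (cinner (p (\<Union>n. G n) z) z)"
      by (rule bounded_linear.sums[OF bounded_linear_Re povm_sums[OF G]])
    then show "(\<Sum>n. ennreal (Re (cinner (p (G n) z) z))) = ennreal (Re (cinner (p (\<Union>n. G n) z) z))"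
      using povm_positive G(1)
      by (intro suminf_ennreal_eq) (auto simp: positive_clinear_def)
  qed
qed

lemma finite_povm_measure: "finite_measure (povm_measure M p z)"
  by (rule finite_measureI) (simp add: emeasure_povm_measure)

lemma measure_povm_measure:
  "G \<in> sets M \<Longrightarrow> complex_of_real (measure (povm_measure M p z) G) = cinner (p G z) z"
  using povm_positive[of G]
  by (simp add: measure_def emeasure_povm_measure positive_clinear_def complex_eq_iff)

lemma measure_povm_space_le: "measure (povm_measure M p z) (space M) \<le> (norm z)\<^sup>2"
proof -
  have "complex_of_real (measure (povm_measure M p z) (space M)) = cinner (p (space M) z) z"
    by (rule measure_povm_measure) simp
  then have "measure (povm_measure M p z) (space M) = cmod (cinner (p (space M) z) z)"
    by (metis measure_nonneg norm_of_real abs_of_nonneg)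
  also have "\<dots> \<le> norm (p (space M) z) * norm z" by (rule cmod_cinner_le)
  also have "\<dots> \<le> norm z * norm z" using povm by (intro mult_right_mono) (auto simp: povm_def)
  finally show ?thesis by (simp add: power2_eq_square)
qed

lemma ess_bounded_by_AE:
  assumes f: "ess_bounded_by M p f c" shows "AE w in povm_measure M p z. cmod (f w) \<le> c"
proof (rule AE_I)
  have [measurable]: "f \<in> borel_measurable M" using f by (simp add: ess_bounded_by_def)
  show m: "{w \<in> space M. c < cmod (f w)} \<in> sets (povm_measure M p z)" by simp
  show "emeasure (povm_measure M p z) {w \<in> space M. c < cmod (f w)} = 0"
    using f by (subst emeasure_povm_measure) (auto simp: ess_bounded_by_def)
qed auto

lemma ess_bounded_by_integrable:
  assumes f: "ess_bounded_by M p f c" shows "integrable (povm_measure M p z) f"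
proof -
  interpret finite_measure "povm_measure M p z" by (rule finite_povm_measure)
  show ?thesis
    using f ess_bounded_by_AE[OF f] by (intro integrable_const_bound[where B = c]) (auto simp: ess_bounded_by_def)
qed

text \<open>Each of the four polarized vectors has norm at most half of norm x + norm y, so the
  numerical constants cancel. The bound is not of product form yet; rescaling x and y separately
  achieves that in the construction of \<open>povm_integral\<close>.\<close>

lemma povm_form_bound:
  assumes f: "ess_bounded_by M p f c"
  shows "cmod (povm_form M p f x y) \<le> c * (norm x + norm y)\<^sup>2"
proof -
  have c: "0 \<le> c" using f by (simp add: ess_bounded_by_def)
  have int: "cmod (\<integral>w. f w \<partial>povm_measure M p z) \<le> c * (norm z)\<^sup>2" for z
  proof -
    interpret finite_measure "povm_measure M p z" by (rule finite_povm_measure)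
    have "cmod (\<integral>w. f w \<partial>povm_measure M p z) \<le> (\<integral>w. cmod (f w) \<partial>povm_measure M p z)" by simp
    also have "\<dots> \<le> (\<integral>w. c \<partial>povm_measure M p z)"
      by (rule integral_mono_AE) (use ess_bounded_by_AE[OF f] ess_bounded_by_integrable[OF f] in auto)
    also have "\<dots> \<le> c * (norm z)\<^sup>2"
      using mult_left_mono[OF measure_povm_space_le c] by (simp add: mult.commute)
    finally show ?thesis .
  qed
  have "cmod (\<i> ^ n * (\<integral>w. f w \<partial>povm_measure M p ((1/2) *\<^sub>C (x + \<i> ^ n *\<^sub>C y)))) \<le> c * (norm x + norm y)\<^sup>2 / 4"
    for n
  proof -
    have "norm (x + \<i> ^ n *\<^sub>C y) \<le> norm x + norm y"
      using norm_triangle_ineq[of x "\<i> ^ n *\<^sub>C y"] by (simp add: norm_power)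
    then have "norm ((1/2) *\<^sub>C (x + \<i> ^ n *\<^sub>C y)) \<le> (norm x + norm y) / 2" by (simp add: norm_divide)
    then have "c * (norm ((1/2) *\<^sub>C (x + \<i> ^ n *\<^sub>C y)))\<^sup>2 \<le> c * ((norm x + norm y) / 2)\<^sup>2"
      using c by (intro mult_left_mono power_mono norm_ge_zero)
    then show ?thesis
      using int[of "(1/2) *\<^sub>C (x + \<i> ^ n *\<^sub>C y)"] by (simp add: norm_mult norm_power power_divide)
  qed
  then have "cmod (povm_form M p f x y) \<le> (\<Sum>n<(4::nat). c * (norm x + norm y)\<^sup>2 / 4)"
    unfolding povm_form_def by (rule order_trans[OF norm_sum sum_mono])
  then show ?thesis by simp
qed

lemma povm_form_simple:
  assumes fin: "finite K" and K: "f ` space M \<subseteq> K"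
    and ms: "\<And>v. v \<in> K \<Longrightarrow> f -` {v} \<inter> space M \<in> sets M"
  shows "povm_form M p f x y = cinner (\<Sum>v\<in>K. v *\<^sub>C p (f -` {v} \<inter> space M) x) y"
proof -
  let ?T = "\<lambda>x. \<Sum>v\<in>K. v *\<^sub>C p (f -` {v} \<inter> space M) x"
  have int: "(\<integral>w. f w \<partial>povm_measure M p z) = cinner (?T z) z" for z
    using integral_finite_range[OF finite_povm_measure fin, of f z] K ms
    by (simp add: measure_povm_measure cinner.sum_left cinner_scaleC_left)
  have "bounded_clinear ?T"
    by (intro bounded_clinear_sum_fun bounded_clinear_scale povm_clinear ms)
  then show ?thesis
    unfolding povm_form_def int by (rule polarization)
qed

lemma povm_form_tendsto:
  assumes f: "ess_bounded_by M p f c" and F: "\<And>i. F i \<in> borel_measurable M"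
    and lim: "\<And>w. w \<in> space M \<Longrightarrow> (\<lambda>i. F i w) \<longlonglongrightarrow> f w"
    and le: "\<And>i w. w \<in> space M \<Longrightarrow> cmod (F i w) \<le> 2 * cmod (f w)"
  shows "(\<lambda>i. povm_form M p (F i) x y) \<longlonglongrightarrow> povm_form M p f x y"
proof -
  have "(\<lambda>i. \<integral>w. F i w \<partial>povm_measure M p z) \<longlonglongrightarrow> (\<integral>w. f w \<partial>povm_measure M p z)" for z
  proof (rule integral_dominated_convergence[where w = "\<lambda>w. 2 * cmod (f w)"])
    show "integrable (povm_measure M p z) (\<lambda>w. 2 * cmod (f w))"
      using ess_bounded_by_integrable[OF f] by auto
  qed (use f F lim le in \<open>auto simp: ess_bounded_by_def\<close>)
  then show ?thesis unfolding povm_form_def by (intro tendsto_intros) auto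
qed

text \<open>Linearity in x and y is not visible in the polarized formula. It holds for simple
  functions, where the form belongs to a finite sum of operators, and passes to the limit. The
  factor 4 comes from estimating the four polarized terms separately.\<close>

lemma
  assumes f: "ess_bounded_by M p f c"
  shows bounded_clinear_povm_integral: "bounded_clinear (povm_integral M p f)"
    and cinner_povm_integral: "cinner (povm_integral M p f x) y = povm_form M p f x y"
    and norm_povm_integral_le: "norm (povm_integral M p f x) \<le> 4 * c * norm x"
proof -
  let ?B = "povm_form M p f"
  have fm: "f \<in> borel_measurable M" and c: "0 \<le> c" using f by (auto simp: ess_bounded_by_def)
  obtain F where F: "\<And>i. simple_function M (F i)" "\<And>w. w \<in> space M \<Longrightarrow> (\<lambda>i. F i w) \<longlonglongrightarrow> f w"
      "\<And>i w. w \<in> space M \<Longrightarrow> cmod (F i w) \<le> 2 * cmod (f w)"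
    by (rule complex_simple_approximation[OF fm]) blast
  define T where "T i x = (\<Sum>v\<in>F i ` space M. v *\<^sub>C p (F i -` {v} \<inter> space M) x)" for i x
  have ms: "F i -` {v} \<inter> space M \<in> sets M" for i v
    using simple_functionD(2)[OF F(1), of i "{v}"] by simp
  have bT: "bounded_clinear (T i)" for i
    unfolding T_def by (intro bounded_clinear_sum_fun bounded_clinear_scale povm_clinear ms)
  have "povm_form M p (F i) x y = cinner (T i x) y" for i x y
    unfolding T_def by (rule povm_form_simple) (use F(1)[of i] ms in \<open>auto simp: simple_function_def\<close>)
  then have lim: "(\<lambda>i. cinner (T i x) y) \<longlonglongrightarrow> ?B x y" for x y
    using povm_form_tendsto[OF f borel_measurable_simple_function[OF F(1)] F(2,3)] by simp
  have add_left: "?B (x + x') y = ?B x y + ?B x' y" for x x' y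
    by (rule LIMSEQ_unique[OF lim])
       (simp add: bounded_clinear_add[OF bT] cinner_add_left tendsto_add lim)
  have scale_left: "?B (a *\<^sub>C x) y = a * ?B x y" for a x y
    by (rule LIMSEQ_unique[OF lim])
       (simp add: bounded_clinear_scaleC[OF bT] cinner_scaleC_left tendsto_mult_left lim)
  have add_right: "?B x (y + y') = ?B x y + ?B x y'" for x y y'
    by (rule LIMSEQ_unique[OF lim]) (simp add: cinner_add_right tendsto_add lim)
  have scale_right: "?B x (a *\<^sub>C y) = cnj a * ?B x y" for a x y
    by (rule LIMSEQ_unique[OF lim]) (simp add: cinner_scaleC_right tendsto_mult_left lim)
  have bound: "cmod (?B x y) \<le> 4 * c * norm x * norm y" for x y
  proof (cases "x = 0 \<or> y = 0")
    case True
    then have "?B x y = 0" using scale_left[of 0 x y] scale_right[of x 0 y] by auto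
    then show ?thesis using c by simp
  next
    case False
    \<comment> \<open>On unit vectors the bound of \<open>povm_form_bound\<close> reads 4 * c;
      homogeneity then yields the product form.\<close>
    define a b where "a = inverse (norm x)" and "b = inverse (norm y)"
    have ab: "0 < a" "0 < b" "a * norm x = 1" "b * norm y = 1" using False by (auto simp: a_def b_def)
    have "cmod (?B (complex_of_real a *\<^sub>C x) (complex_of_real b *\<^sub>C y)) \<le> c * (1 + 1)\<^sup>2"
      using povm_form_bound[OF f, of "complex_of_real a *\<^sub>C x" "complex_of_real b *\<^sub>C y"] ab by simp
    then have "a * b * cmod (?B x y) \<le> 4 * c"
      using ab by (simp add: scale_left scale_right norm_mult mult.commute mult.left_commute)
    then have "(norm x * norm y) * (a * b * cmod (?B x y)) \<le> (norm x * norm y) * (4 * c)"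
      by (intro mult_left_mono) auto
    moreover have "(norm x * norm y) * (a * b * cmod (?B x y)) = (a * norm x) * (b * norm y) * cmod (?B x y)"
      by simp
    then have "(norm x * norm y) * (a * b * cmod (?B x y)) = cmod (?B x y)"
      by (simp only: ab(3,4) mult_1)
    ultimately have "cmod (?B x y) \<le> (norm x * norm y) * (4 * c)" by linarith
    then show ?thesis by (simp add: mult_ac)
  qed
  have ex: "\<exists>A. bounded_clinear A \<and> (\<forall>x y. cinner (A x) y = ?B x y) \<and> (\<forall>x. norm (A x) \<le> 4 * c * norm x)"
    by (rule sesquilinear_form_operator) (use add_left scale_left add_right scale_right bound c in auto)
  then have "bounded_clinear (povm_integral M p f) \<and> (\<forall>x y. cinner (povm_integral M p f x) y = ?B x y)"
    unfolding povm_integral_def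
    by (intro someI_ex[of "\<lambda>A. bounded_clinear A \<and> (\<forall>x y. cinner (A x) y = ?B x y)"]) blast
  then show "bounded_clinear (povm_integral M p f)" and e: "cinner (povm_integral M p f x) y = ?B x y" for x y
    by auto
  show "norm (povm_integral M p f x) \<le> 4 * c * norm x"
    by (rule norm_le_by_cinner) (use e bound c in auto)
qed

lemma povm_diff:
  assumes "A \<in> sets M" shows "p (space M - A) x = p (space M) x - p A x"
proof (rule cinner_ext)
  fix y
  have "(\<lambda>n. cinner (p (binaryset A (space M - A) n) x) y) sums (cinner (p A x) y + cinner (p (space M - A) x) y)"
    by (rule binaryset_sums) (simp add: povm_empty)
  moreover have "(\<lambda>n. cinner (p (binaryset A (space M - A) n) x) y) sums
      cinner (p (\<Union>n. binaryset A (space M - A) n) x) y"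
    by (rule povm_sums) (use assms in \<open>auto simp: disjoint_family_on_def binaryset_def range_binaryset_eq\<close>)
  moreover have "(\<Union>n. binaryset A (space M - A) n) = space M"
    using sets.sets_into_space[OF assms] by (auto simp: UN_binaryset_eq)
  ultimately have "cinner (p A x) y + cinner (p (space M - A) x) y = cinner (p (space M) x) y"
    using sums_unique2 by simp
  then show "cinner (p (space M - A) x) y = cinner (p (space M) x - p A x) y"
    by (simp add: cinner.diff_left algebra_simps)
qed

text \<open>A functional monotone class theorem.  Only weak limits are taken, so that it applies in
  nonseparable Hilbert spaces.\<close>

lemma povm_integral_family_induct:
  fixes \<rho> :: "'s measure" and C :: "('s \<Rightarrow> 'a) \<Rightarrow> bool"
  assumes \<phi>: "\<phi> \<in> borel_measurable (M \<Otimes>\<^sub>M \<rho>)"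
    and bdd: "\<And>s. s \<in> space \<rho> \<Longrightarrow> \<exists>c. ess_bounded_by M p (\<lambda>w. \<phi> (w, s)) c"
    and add: "\<And>v w. C v \<Longrightarrow> C w \<Longrightarrow> C (\<lambda>s. v s + w s)"
    and scale: "\<And>a v. C v \<Longrightarrow> C (\<lambda>s. a *\<^sub>C v s)"
    and lim: "\<And>v v'. (\<And>n. C (v n)) \<Longrightarrow>
        (\<And>s y. s \<in> space \<rho> \<Longrightarrow> (\<lambda>n. cinner (v n s) y) \<longlonglongrightarrow> cinner (v' s) y) \<Longrightarrow> C v'"
    and rect: "\<And>A B. A \<in> sets M \<Longrightarrow> B \<in> sets \<rho> \<Longrightarrow> C (\<lambda>s. if s \<in> B then p A x else 0)"
  shows "C (\<lambda>s. povm_integral M p (\<lambda>w. \<phi> (w, s)) x)"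
proof -
  \<comment> \<open>A constant sequence in \<open>lim\<close> shows that C ignores values outside
    the space of \<rho>.\<close>
  have cong: "C v'" if "C v" "\<And>s. s \<in> space \<rho> \<Longrightarrow> v s = v' s" for v v'
    by (rule lim[of "\<lambda>_. v"]) (use that in auto)
  have zero: "C (\<lambda>s. 0)"
    using scale[OF rect[of "{}" "{}"], of 0] by simp
  have sum: "C (\<lambda>s. \<Sum>i\<in>I. v i s)" if "finite I" "\<And>i. i \<in> I \<Longrightarrow> C (v i)" for I :: "'i set" and v
    using that by (induction I) (auto intro: zero add)
  \<comment> \<open>The case of indicator functions is a Dynkin argument over measurable rectangles:
    complements use \<open>povm_diff\<close>, disjoint unions the closure of C under weak
    limits.\<close>
  have sets: "C (\<lambda>s. p ((\<lambda>w. (w, s)) -` A) x)" if A: "A \<in> sets (M \<Otimes>\<^sub>M \<rho>)" for A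
  proof -
    let ?G = "{a \<times> b |a b. a \<in> sets M \<and> b \<in> sets \<rho>}"
    let ?\<Omega> = "space M \<times> space \<rho>"
    have sections: "(\<lambda>w. (w, s)) -` X \<in> sets M" if "X \<in> sigma_sets ?\<Omega> ?G" for X s
      using that by (intro sets_Pair2) (simp add: sets_pair_measure)
    have "A \<in> sigma_sets ?\<Omega> ?G" using A by (simp add: sets_pair_measure)
    with Int_stable_pair_measure_generator pair_measure_closed show ?thesis
    proof (induction A rule: sigma_sets_induct_disjoint)
      case (basic A)
      then obtain a b where ab: "A = a \<times> b" "a \<in> sets M" "b \<in> sets \<rho>" by auto
      show ?case by (rule cong[OF rect[OF ab(2,3)]]) (auto simp: ab(1) povm_empty vimage_def)
    next
      case empty
      show ?case by (rule cong[OF zero]) (simp add: povm_empty)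
    next
      case (compl A)
      have "C (\<lambda>s. (if s \<in> space \<rho> then p (space M) x else 0) + (-1) *\<^sub>C p ((\<lambda>w. (w, s)) -` A) x)"
        by (intro add rect scale compl) auto
      then show ?case
      proof (rule cong)
        fix s assume s: "s \<in> space \<rho>"
        have "(\<lambda>w. (w, s)) -` (?\<Omega> - A) = space M - (\<lambda>w. (w, s)) -` A" using s by auto
        then show "(if s \<in> space \<rho> then p (space M) x else 0) + (-1) *\<^sub>C p ((\<lambda>w. (w, s)) -` A) x
          = p ((\<lambda>w. (w, s)) -` (?\<Omega> - A)) x"
          using s by (simp add: povm_diff[OF sections[OF compl(1)]])
      qed
    next
      case (union A)
      show ?case
      proof (rule lim)
        show "C (\<lambda>s. \<Sum>i<n. p ((\<lambda>w. (w, s)) -` A i) x)" for n by (intro sum union) auto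
        fix s y assume "s \<in> space \<rho>"
        have "(\<lambda>i. cinner (p ((\<lambda>w. (w, s)) -` A i) x) y) sums cinner (p (\<Union>i. (\<lambda>w. (w, s)) -` A i) x) y"
          by (rule povm_sums) (use union(1,2) sections in \<open>auto simp: disjoint_family_on_def\<close>)
        then show "(\<lambda>n. cinner (\<Sum>i<n. p ((\<lambda>w. (w, s)) -` A i) x) y) \<longlonglongrightarrow> cinner (p ((\<lambda>w. (w, s)) -` (\<Union>i. A i)) x) y"
          by (simp add: sums_def cinner.sum_left vimage_UN)
      qed
    qed
  qed
  \<comment> \<open>Simple functions of both variables approximate \<phi>. For fixed s their
    sections converge with a dominating function, so the corresponding operators converge
    weakly.\<close>
  obtain F where F: "\<And>i. simple_function (M \<Otimes>\<^sub>M \<rho>) (F i)" "\<And>z. z \<in> space (M \<Otimes>\<^sub>M \<rho>) \<Longrightarrow> (\<lambda>i. F i z) \<longlonglongrightarrow> \<phi> z"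
      "\<And>i z. z \<in> space (M \<Otimes>\<^sub>M \<rho>) \<Longrightarrow> cmod (F i z) \<le> 2 * cmod (\<phi> z)"
    by (rule complex_simple_approximation[OF \<phi>]) blast
  let ?S = "\<lambda>i v. F i -` {v} \<inter> space (M \<Otimes>\<^sub>M \<rho>)"
  have ms: "?S i v \<in> sets (M \<Otimes>\<^sub>M \<rho>)" for i v
    using simple_functionD(2)[OF F(1), of i "{v}"] by simp
  show ?thesis
  proof (rule lim)
    show "C (\<lambda>s. \<Sum>v\<in>F i ` space (M \<Otimes>\<^sub>M \<rho>). v *\<^sub>C p ((\<lambda>w. (w, s)) -` ?S i v) x)" for i
      using F(1)[of i] by (intro sum scale sets ms) (simp add: simple_function_def)
    fix s y assume s: "s \<in> space \<rho>"
    obtain c where c: "ess_bounded_by M p (\<lambda>w. \<phi> (w, s)) c" using bdd[OF s] by blast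
    have "(\<lambda>i. povm_form M p (\<lambda>w. F i (w, s)) x y) \<longlonglongrightarrow> povm_form M p (\<lambda>w. \<phi> (w, s)) x y"
    proof (rule povm_form_tendsto[OF c])
      show "(\<lambda>w. F i (w, s)) \<in> borel_measurable M" for i
        using measurable_Pair1[OF borel_measurable_simple_function[OF F(1)] s] .
    qed (use F(2,3) s in \<open>auto simp: space_pair_measure\<close>)
    moreover have "povm_form M p (\<lambda>w. F i (w, s)) x y
      = cinner (\<Sum>v\<in>F i ` space (M \<Otimes>\<^sub>M \<rho>). v *\<^sub>C p ((\<lambda>w. (w, s)) -` ?S i v) x) y" for i
    proof -
      have eq: "(\<lambda>w. F i (w, s)) -` {v} \<inter> space M = (\<lambda>w. (w, s)) -` ?S i v" for v
        using s by (auto simp: space_pair_measure)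
      show ?thesis
        unfolding eq[symmetric]
      proof (rule povm_form_simple)
        show "finite (F i ` space (M \<Otimes>\<^sub>M \<rho>))" using F(1)[of i] by (simp add: simple_function_def)
        show "(\<lambda>w. F i (w, s)) -` {v} \<inter> space M \<in> sets M" for v
          unfolding eq by (rule sets_Pair2[OF ms])
      qed (use s in \<open>auto simp: space_pair_measure\<close>)
    qed
    ultimately show "(\<lambda>i. cinner (\<Sum>v\<in>F i ` space (M \<Otimes>\<^sub>M \<rho>). v *\<^sub>C p ((\<lambda>w. (w, s)) -` ?S i v) x) y)
        \<longlonglongrightarrow> cinner (povm_integral M p (\<lambda>w. \<phi> (w, s)) x) y"
      by (simp add: cinner_povm_integral[OF c])
  qed
qed

end


subsection \<open>Measurable families of operators\<close>

text \<open>The values of \<open>v\<close> lie in the closed linear span of a countable set, stated through the bipolar.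
  In a nonseparable space this does not follow from weak measurability.\<close>

definition countably_spanned :: "'s measure \<Rightarrow> ('s \<Rightarrow> 'a::chilbert) \<Rightarrow> bool" where
  "countably_spanned \<rho> v \<longleftrightarrow> (\<exists>D. countable D \<and>
     (\<forall>s\<in>space \<rho>. \<forall>y. (\<forall>d\<in>D. cinner d y = 0) \<longrightarrow> cinner (v s) y = 0))"

text \<open>Weak measurability is not stable under composition; the last clause is a form of it that is.\<close>

definition op_family :: "'s measure \<Rightarrow> ('s \<Rightarrow> 'a::chilbert \<Rightarrow> 'a) \<Rightarrow> bool" where
  "op_family \<rho> a \<longleftrightarrow> (\<forall>s\<in>space \<rho>. bounded_clinear (a s)) \<and> (\<forall>x. countably_spanned \<rho> (\<lambda>s. a s x)) \<and>
     (\<forall>T :: 's \<Rightarrow> 'a \<Rightarrow> 'a. (\<forall>s\<in>space \<rho>. bounded_clinear (T s)) \<and> (\<forall>x y. (\<lambda>s. cinner (T s x) y) \<in> borel_measurable \<rho>) \<longrightarrow>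
       (\<forall>x y. (\<lambda>s. cinner (T s (a s x)) y) \<in> borel_measurable \<rho>))"

lemma
  fixes \<rho> :: "'s measure" and a :: "'s \<Rightarrow> 'a::chilbert \<Rightarrow> 'a"
  shows op_family_clinear: "op_family \<rho> a \<Longrightarrow> s \<in> space \<rho> \<Longrightarrow> bounded_clinear (a s)"
  and op_family_spanned: "op_family \<rho> a \<Longrightarrow> countably_spanned \<rho> (\<lambda>s. a s x)"
  by (auto simp: op_family_def)

lemma op_family_measurable_compose:
  fixes T :: "'s \<Rightarrow> 'a::chilbert \<Rightarrow> 'a"
  assumes "op_family \<rho> a" "\<And>s. s \<in> space \<rho> \<Longrightarrow> bounded_clinear (T s)"
    "\<And>x y. (\<lambda>s. cinner (T s x) y) \<in> borel_measurable \<rho>"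
  shows "(\<lambda>s. cinner (T s (a s x)) y) \<in> borel_measurable \<rho>"
  using assms unfolding op_family_def by blast

lemma op_family_measurable:
  "op_family \<rho> a \<Longrightarrow> (\<lambda>s. cinner (a s x) y) \<in> borel_measurable \<rho>"
  using op_family_measurable_compose[of \<rho> a "\<lambda>s x. x"] by simp

text \<open>In the bipolar formulation \<open>T s\<close> moves to the test vector as its adjoint.
  It therefore suffices to collect spanning sets of the families \<open>T s d\<close> for the
  countably many d that span v.\<close>

lemma countably_spanned_apply:
  fixes T :: "'s \<Rightarrow> 'a::chilbert \<Rightarrow> 'a"
  assumes v: "countably_spanned \<rho> v" and T: "\<And>s. s \<in> space \<rho> \<Longrightarrow> bounded_clinear (T s)"
    and sp: "\<And>x. countably_spanned \<rho> (\<lambda>s. T s x)"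
  shows "countably_spanned \<rho> (\<lambda>s. T s (v s))"
proof -
  obtain D where D: "countable D"
    "\<And>s y. s \<in> space \<rho> \<Longrightarrow> \<forall>d\<in>D. cinner d y = 0 \<Longrightarrow> cinner (v s) y = 0"
    using v unfolding countably_spanned_def by blast
  have "\<forall>d. \<exists>E. countable E \<and> (\<forall>s\<in>space \<rho>. \<forall>y. (\<forall>e\<in>E. cinner e y = 0) \<longrightarrow> cinner (T s d) y = 0)"
    using sp unfolding countably_spanned_def by blast
  then obtain E where E: "\<And>d. countable (E d)"
    "\<And>d s y. s \<in> space \<rho> \<Longrightarrow> \<forall>e\<in>E d. cinner e y = 0 \<Longrightarrow> cinner (T s d) y = 0" by metis
  show ?thesis
    unfolding countably_spanned_def
  proof (intro exI[of _ "\<Union>d\<in>D. E d"] conjI ballI allI impI)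
    show "countable (\<Union>d\<in>D. E d)" using D(1) E(1) by auto
    fix s y assume s: "s \<in> space \<rho>" and y: "\<forall>e\<in>\<Union>d\<in>D. E d. cinner e y = 0"
    have "cinner d (cadj (T s) y) = 0" if "d \<in> D" for d
      using E(2)[OF s, of d y] y that by (auto simp: cinner_cadj_right[OF T[OF s]])
    then show "cinner (T s (v s)) y = 0"
      using D(2)[OF s, of "cadj (T s) y"] by (simp add: cinner_cadj_right[OF T[OF s]])
  qed
qed

lemma op_family_const:
  assumes "bounded_clinear A" shows "op_family \<rho> (\<lambda>s. A)"
proof -
  have "countably_spanned \<rho> (\<lambda>s. A x)" for x
    unfolding countably_spanned_def by (rule exI[of _ "{A x}"]) simp
  then show ?thesis using assms unfolding op_family_def by blast
qed

text \<open>The measurability clause ranges over all weakly measurable T, so the clause for b can be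
  applied with the test family T s (a s x), whose own weak measurability is the clause for
  a.\<close>

lemma op_family_compose:
  assumes a: "op_family \<rho> a" and b: "op_family \<rho> b"
  shows "op_family \<rho> (\<lambda>s x. a s (b s x))"
  unfolding op_family_def
proof (intro conjI ballI allI impI, goal_cases)
  case (1 s)
  show ?case by (rule bounded_clinear_compose[OF op_family_clinear[OF a 1] op_family_clinear[OF b 1]])
next
  case (2 x)
  show ?case
    by (rule countably_spanned_apply[OF op_family_spanned[OF b] op_family_clinear[OF a] op_family_spanned[OF a]])
next
  case (3 T x y)
  then have T: "\<And>s. s \<in> space \<rho> \<Longrightarrow> bounded_clinear (T s)"
    and m: "\<And>x y. (\<lambda>s. cinner (T s x) y) \<in> borel_measurable \<rho>" by blast+
  show ?case
  proof (rule op_family_measurable_compose[OF b])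
    show "bounded_clinear (\<lambda>x. T s (a s x))" if "s \<in> space \<rho>" for s
      by (rule bounded_clinear_compose[OF T[OF that] op_family_clinear[OF a that]])
    show "(\<lambda>s. cinner (T s (a s x)) y) \<in> borel_measurable \<rho>" for x y
      by (rule op_family_measurable_compose[OF a T m])
  qed
qed

text \<open>Span and measurability are both instances of the monotone class theorem. For
  measurability the class consists of the v whose inner product with \<open>cadj (T s) y\<close> is
  measurable in s: the adjoint turns composition with T into a condition that survives weak limits
  and that reduces on rectangles to the measurability of the coefficients of T.\<close>

lemma op_family_povm_integral:
  fixes \<rho> :: "'s measure" and p :: "'w set \<Rightarrow> 'a::chilbert \<Rightarrow> 'a"
  assumes p: "povm M p" and \<phi>: "\<phi> \<in> borel_measurable (M \<Otimes>\<^sub>M \<rho>)"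
    and bdd: "\<And>s. s \<in> space \<rho> \<Longrightarrow> \<exists>c. ess_bounded_by M p (\<lambda>w. \<phi> (w, s)) c"
  shows "op_family \<rho> (\<lambda>s. povm_integral M p (\<lambda>w. \<phi> (w, s)))"
  unfolding op_family_def
proof (intro conjI ballI allI impI, goal_cases)
  case (1 s)
  then show ?case using bdd[OF 1] bounded_clinear_povm_integral[OF p] by blast
next
  case (2 x)
  show ?case
  proof (rule povm_integral_family_induct[OF p \<phi> bdd, where C = "countably_spanned \<rho>"])
    fix v w :: "'s \<Rightarrow> 'a" assume "countably_spanned \<rho> v" "countably_spanned \<rho> w"
    then obtain D E where "countable D" "\<forall>s\<in>space \<rho>. \<forall>y. (\<forall>d\<in>D. cinner d y = 0) \<longrightarrow> cinner (v s) y = 0"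
      "countable E" "\<forall>s\<in>space \<rho>. \<forall>y. (\<forall>d\<in>E. cinner d y = 0) \<longrightarrow> cinner (w s) y = 0"
      unfolding countably_spanned_def by blast
    then show "countably_spanned \<rho> (\<lambda>s. v s + w s)"
      unfolding countably_spanned_def by (intro exI[of _ "D \<union> E"]) (auto simp: cinner_add_left)
  next
    fix a and v :: "'s \<Rightarrow> 'a" assume "countably_spanned \<rho> v"
    then show "countably_spanned \<rho> (\<lambda>s. a *\<^sub>C v s)"
      unfolding countably_spanned_def by (auto simp: cinner_scaleC_left)
  next
    fix v and v' :: "'s \<Rightarrow> 'a" assume "\<And>n::nat. countably_spanned \<rho> (v n)"
      and lim: "\<And>s y. s \<in> space \<rho> \<Longrightarrow> (\<lambda>n. cinner (v n s) y) \<longlonglongrightarrow> cinner (v' s) y"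
    then have "\<forall>n. \<exists>D. countable D \<and> (\<forall>s\<in>space \<rho>. \<forall>y. (\<forall>d\<in>D. cinner d y = 0) \<longrightarrow> cinner (v n s) y = 0)"
      unfolding countably_spanned_def by blast
    then obtain D where D: "\<And>n. countable (D n)"
      "\<And>n s y. s\<in>space \<rho> \<Longrightarrow> (\<forall>d\<in>D n. cinner d y = 0) \<Longrightarrow> cinner (v n s) y = 0" by metis
    show "countably_spanned \<rho> v'"
      unfolding countably_spanned_def
    proof (intro exI[of _ "\<Union>n. D n"] conjI ballI allI impI)
      fix s y assume s: "s \<in> space \<rho>" and y: "\<forall>d\<in>\<Union>n. D n. cinner d y = 0"
      then have "cinner (v n s) y = 0" for n by (intro D(2)) auto
      then show "cinner (v' s) y = 0" using lim[OF s, of y] by (simp add: LIMSEQ_const_iff)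
    qed (use D(1) in auto)
  next
    fix A B
    show "countably_spanned \<rho> (\<lambda>s. if s \<in> B then p A x else 0)"
      unfolding countably_spanned_def by (intro exI[of _ "{p A x}"]) auto
  qed
next
  case (3 T x y)
  then have T: "\<And>s. s \<in> space \<rho> \<Longrightarrow> bounded_clinear (T s)"
    and m: "\<And>x y. (\<lambda>s. cinner (T s x) y) \<in> borel_measurable \<rho>" by blast+
  note adj = cinner_cadj_right[OF T]
  have "(\<lambda>s. cinner (povm_integral M p (\<lambda>w. \<phi> (w, s)) x) (cadj (T s) y)) \<in> borel_measurable \<rho>"
  proof (rule povm_integral_family_induct[OF p \<phi> bdd,
        where C = "\<lambda>v. (\<lambda>s. cinner (v s) (cadj (T s) y)) \<in> borel_measurable \<rho>"])
    fix v and v' :: "'s \<Rightarrow> 'a" assume "\<And>n::nat. (\<lambda>s. cinner (v n s) (cadj (T s) y)) \<in> borel_measurable \<rho>"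
      and lim: "\<And>s y. s \<in> space \<rho> \<Longrightarrow> (\<lambda>n. cinner (v n s) y) \<longlonglongrightarrow> cinner (v' s) y"
    then show "(\<lambda>s. cinner (v' s) (cadj (T s) y)) \<in> borel_measurable \<rho>"
      by (rule borel_measurable_LIMSEQ_metric) (auto intro: lim)
  next
    fix A B assume A: "A \<in> sets M" and [measurable]: "B \<in> sets \<rho>"
    have [measurable]: "(\<lambda>s. cinner (T s (p A x)) y) \<in> borel_measurable \<rho>" by (rule m)
    have "(\<lambda>s. if s \<in> B then cinner (T s (p A x)) y else 0) \<in> borel_measurable \<rho>" by measurable
    then show "(\<lambda>s. cinner (if s \<in> B then p A x else 0) (cadj (T s) y)) \<in> borel_measurable \<rho>"
      by (rule measurable_cong[THEN iffD1, rotated]) (auto simp: adj bounded_clinear_zero[OF T])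
  qed (auto simp: cinner_add_left cinner_scaleC_left)
  then show ?case
    by (rule measurable_cong[THEN iffD1, rotated]) (auto simp: adj)
qed

section \<open>Weak integrals of operator families and their traces\<close>

definition has_weak_integral :: "'s measure \<Rightarrow> ('s \<Rightarrow> 'a::chilbert \<Rightarrow> 'a) \<Rightarrow> ('a \<Rightarrow> 'a) \<Rightarrow> bool" where
  "has_weak_integral \<rho> F A \<longleftrightarrow> bounded_clinear A \<and>
     (\<forall>x y. has_bochner_integral \<rho> (\<lambda>s. cinner (F s x) y) (cinner (A x) y))"

text \<open>The norm of \<open>F s\<close> need not be measurable in s, so integrability is imposed
  through a dominating function. The integrated coefficients then form a bounded sesquilinear
  form.\<close>

lemma has_weak_integral_exists:
  fixes F :: "'s \<Rightarrow> 'a::chilbert \<Rightarrow> 'a"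
  assumes F: "\<And>s. s \<in> space \<rho> \<Longrightarrow> bounded_clinear (F s)"
    and m: "\<And>x y. (\<lambda>s. cinner (F s x) y) \<in> borel_measurable \<rho>"
    and g: "integrable \<rho> g" and le: "AE s in \<rho>. \<forall>x. norm (F s x) \<le> g s * norm x"
  shows "\<exists>A. has_weak_integral \<rho> F A"
proof -
  define B where "B x y = (\<integral>s. cinner (F s x) y \<partial>\<rho>)" for x y
  have le': "AE s in \<rho>. cmod (cinner (F s x) y) \<le> \<bar>g s\<bar> * norm x * norm y" for x y
    using le
  proof eventually_elim
    case (elim s)
    have "cmod (cinner (F s x) y) \<le> norm (F s x) * norm y" by (rule cmod_cinner_le)
    also have "\<dots> \<le> (\<bar>g s\<bar> * norm x) * norm y"
      using elim[rule_format, of x] mult_right_mono[OF abs_ge_self[of "g s"] norm_ge_zero[of x]]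
      by (intro mult_right_mono) auto
    finally show ?case .
  qed
  have gi: "integrable \<rho> (\<lambda>s. \<bar>g s\<bar> * norm x * norm y)" for x y :: 'a
    using g by auto
  have int: "integrable \<rho> (\<lambda>s. cinner (F s x) y)" for x y
    by (rule Bochner_Integration.integrable_bound[OF gi[of x y] m]) (use le'[of x y] in auto)
  have "\<exists>A. bounded_clinear A \<and> (\<forall>x y. cinner (A x) y = B x y) \<and> (\<forall>x. norm (A x) \<le> (\<integral>s. \<bar>g s\<bar> \<partial>\<rho>) * norm x)"
  proof (rule sesquilinear_form_operator)
    fix x x' y y' and a :: complex
    have "B (x + x') y = (\<integral>s. cinner (F s x) y + cinner (F s x') y \<partial>\<rho>)"
      unfolding B_def by (intro Bochner_Integration.integral_cong) (auto simp: bounded_clinear_add[OF F] cinner_add_left)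
    then show "B (x + x') y = B x y + B x' y" by (simp add: B_def int)
    have "B (a *\<^sub>C x) y = (\<integral>s. a * cinner (F s x) y \<partial>\<rho>)"
      unfolding B_def by (intro Bochner_Integration.integral_cong) (auto simp: bounded_clinear_scaleC[OF F] cinner_scaleC_left)
    then show "B (a *\<^sub>C x) y = a * B x y" by (simp add: B_def)
    show "B x (y + y') = B x y + B x y'" by (simp add: B_def cinner_add_right int)
    show "B x (a *\<^sub>C y) = cnj a * B x y" by (simp add: B_def cinner_scaleC_right)
    have "cmod (B x y) \<le> (\<integral>s. cmod (cinner (F s x) y) \<partial>\<rho>)" unfolding B_def by simp
    also have "\<dots> \<le> (\<integral>s. \<bar>g s\<bar> * norm x * norm y \<partial>\<rho>)"
      by (rule integral_mono_AE) (use int gi le' in auto)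
    finally show "cmod (B x y) \<le> (\<integral>s. \<bar>g s\<bar> \<partial>\<rho>) * norm x * norm y" by (simp add: mult.assoc)
  qed simp
  then obtain A where "bounded_clinear A" "\<And>x y. cinner (A x) y = B x y" by blast
  then have "has_weak_integral \<rho> F A"
    unfolding has_weak_integral_def by (auto simp: B_def has_bochner_integral_iff int)
  then show ?thesis by blast
qed

section \<open>Rules for weak integrals\<close>

lemma has_weak_integral_unique:
  "has_weak_integral \<rho> F A \<Longrightarrow> has_weak_integral \<rho> F A' \<Longrightarrow> A = A'"
  unfolding has_weak_integral_def
  by (intro ext cinner_ext) (blast intro: has_bochner_integral_eq)

lemma has_weak_integral_cong:
  assumes "\<And>s x. s \<in> space \<rho> \<Longrightarrow> F s x = F' s x"
  shows "has_weak_integral \<rho> F A \<longleftrightarrow> has_weak_integral \<rho> F' A"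
proof -
  have "has_bochner_integral \<rho> (\<lambda>s. cinner (F s x) y) c \<longleftrightarrow> has_bochner_integral \<rho> (\<lambda>s. cinner (F' s x) y) c" for x y c
    by (rule has_bochner_integral_cong) (use assms in auto)
  then show ?thesis by (simp add: has_weak_integral_def)
qed

lemma has_weak_integral_compose:
  assumes F: "has_weak_integral \<rho> F A" and B: "bounded_clinear B"
  shows "has_weak_integral \<rho> (\<lambda>s x. F s (B x)) (\<lambda>x. A (B x))"
  using F bounded_clinear_compose[OF _ B] by (auto simp: has_weak_integral_def)

lemma has_weak_integral_add:
  assumes "has_weak_integral \<rho> F A" "has_weak_integral \<rho> F' A'"
  shows "has_weak_integral \<rho> (\<lambda>s x. F s x + F' s x) (\<lambda>x. A x + A' x)"
  using assms unfolding has_weak_integral_def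
  by (auto simp: cinner_add_left intro!: bounded_clinear_plus has_bochner_integral_add)

lemma has_weak_integral_scale:
  assumes "has_weak_integral \<rho> F A"
  shows "has_weak_integral \<rho> (\<lambda>s x. a *\<^sub>C F s x) (\<lambda>x. a *\<^sub>C A x)"
  using assms unfolding has_weak_integral_def
  by (auto simp: cinner_scaleC_left intro!: bounded_clinear_scale has_bochner_integral_mult_right)

lemma has_weak_integral_left_compose:
  assumes F: "has_weak_integral \<rho> F A" and B: "bounded_clinear B"
  shows "has_weak_integral \<rho> (\<lambda>s x. B (F s x)) (\<lambda>x. B (A x))"
  using F bounded_clinear_compose[OF B] by (auto simp: has_weak_integral_def cinner_cadj_right[OF B, symmetric])

text \<open>Against vectors orthogonal to V the integrand vanishes, so the bipolar criterion
  applies.\<close>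

lemma has_weak_integral_in:
  assumes A: "has_weak_integral \<rho> F A" and V: "closed V" "csubspace V"
    and F: "\<And>s. s \<in> space \<rho> \<Longrightarrow> F s x \<in> V"
  shows "A x \<in> V"
  unfolding in_closed_subspace_iff[OF V]
proof (intro allI impI)
  fix y assume y: "\<forall>v\<in>V. cinner y v = 0"
  have "cinner (A x) y = (\<integral>s. cinner (F s x) y \<partial>\<rho>)"
    using A by (simp add: has_weak_integral_def has_bochner_integral_iff)
  also have "\<dots> = (\<integral>s. 0 \<partial>\<rho>)"
  proof (rule Bochner_Integration.integral_cong[OF refl])
    fix s assume "s \<in> space \<rho>"
    then have "cinner y (F s x) = 0" using y F by blast
    then show "cinner (F s x) y = 0" by (metis cinner_commute complex_cnj_zero)
  qed
  finally show "cinner (A x) y = 0" by simp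
qed

text \<open>The bounds l and m are chosen anew for each s and need not be measurable; only their
  product is dominated. This form serves both for the multiple operator integral and for the
  operator D of the ultraweak part.\<close>

lemma weak_integral_compose_exists:
  assumes L: "op_family \<rho> L" and M: "op_family \<rho> M" and T: "bounded_clinear T" and g: "integrable \<rho> g"
    and le: "AE s in \<rho>. \<exists>l m. 0 \<le> l \<and> 0 \<le> m \<and> (\<forall>x. norm (L s x) \<le> l * norm x) \<and>
               (\<forall>x. norm (M s x) \<le> m * norm x) \<and> l * m \<le> g s"
  shows "\<exists>A. has_weak_integral \<rho> (\<lambda>s x. L s (T (M s x))) A"
proof -
  obtain K where K: "0 < K" "\<And>x. norm (T x) \<le> K * norm x" using bounded_clinear_bound[OF T] by blast
  have fam: "op_family \<rho> (\<lambda>s x. L s (T (M s x)))"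
    by (rule op_family_compose[OF L op_family_compose[OF op_family_const[OF T] M]])
  show ?thesis
  proof (rule has_weak_integral_exists[where g = "\<lambda>s. K * g s"])
    show "AE s in \<rho>. \<forall>x. norm (L s (T (M s x))) \<le> K * g s * norm x"
      using le
    proof eventually_elim
      case (elim s)
      then obtain l m where lm: "0 \<le> l" "0 \<le> m" "\<And>x. norm (L s x) \<le> l * norm x"
        "\<And>x. norm (M s x) \<le> m * norm x" "l * m \<le> g s" by blast
      show ?case
      proof
        fix x
        have "norm (L s (T (M s x))) \<le> l * (K * (m * norm x))"
          by (intro order_trans[OF lm(3)] order_trans[OF K(2)] mult_left_mono lm(1,4)) (use K in auto)
        also have "\<dots> = (K * (l * m)) * norm x" by simp
        also have "\<dots> \<le> (K * g s) * norm x"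
          using K lm(5) by (intro mult_right_mono mult_left_mono) auto
        finally show "norm (L s (T (M s x))) \<le> K * g s * norm x" .
      qed
    qed
    show "integrable \<rho> (\<lambda>s. K * g s)" using g by auto
  qed (use op_family_clinear[OF fam] op_family_measurable[OF fam] in auto)
qed

text \<open>A trace bound concerns finitely many vectors at a time, so modulus and sum move under
  the integral without any limit and without measurability of the trace norm.\<close>

lemma weak_integral_trace_bound:
  fixes G :: "'s \<Rightarrow> 'a::chilbert \<Rightarrow> 'a"
  assumes A: "has_weak_integral \<rho> G A" and h: "integrable \<rho> h" and le: "AE s in \<rho>. trace_bound (G s) (h s)"
  shows "trace_bound A (\<integral>s. h s \<partial>\<rho>)"
  unfolding trace_bound_def
proof (intro allI impI, elim conjE)
  fix C :: "'a \<Rightarrow> 'a" and F :: "'a set"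
  assume C: "bounded_clinear C" "\<forall>x. norm (C x) \<le> norm x" and F: "finite F" "orthonormal F"
  have int: "integrable \<rho> (\<lambda>s. cinner (G s x) y)" and val: "cinner (A x) y = (\<integral>s. cinner (G s x) y \<partial>\<rho>)" for x y
    using A by (auto simp: has_weak_integral_def has_bochner_integral_iff)
  have "(\<Sum>e\<in>F. cmod (cinner (A e) (C e))) \<le> (\<Sum>e\<in>F. \<integral>s. cmod (cinner (G s e) (C e)) \<partial>\<rho>)"
    unfolding val by (intro sum_mono) simp
  also have "\<dots> = (\<integral>s. (\<Sum>e\<in>F. cmod (cinner (G s e) (C e))) \<partial>\<rho>)"
    using int by (simp add: Bochner_Integration.integral_sum)
  also have "\<dots> \<le> (\<integral>s. h s \<partial>\<rho>)"
    by (rule integral_mono_AE) (use int h le C F in \<open>auto simp: trace_bound_def\<close>)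
  finally show "(\<Sum>e\<in>F. cmod (cinner (A e) (C e))) \<le> (\<integral>s. h s \<partial>\<rho>)" .
qed

text \<open>The ideal property of the trace norm: the vectors representing the composite have norms
  at most m and l times those of \<open>u n\<close> and \<open>v n\<close>.\<close>

lemma trace_bound_compose:
  fixes L M \<beta> :: "'a::chilbert \<Rightarrow> 'a"
  assumes \<beta>: "nuclear_rep u v \<beta>" and L: "bounded_clinear L" and M: "bounded_clinear M"
    and l: "0 \<le> l" "\<And>x. norm (L x) \<le> l * norm x" and m: "0 \<le> m" "\<And>x. norm (M x) \<le> m * norm x"
  shows "trace_bound (\<lambda>x. L (\<beta> (M x))) (l * m * (\<Sum>n. norm (u n) * norm (v n)))"
proof -
  have s: "summable (\<lambda>n. norm (u n) * norm (v n))" using \<beta> by (simp add: nuclear_rep_def)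
  note nr = nuclear_rep_compose[OF \<beta> L M]
  have "(\<Sum>n. norm (cadj M (u n)) * norm (L (v n))) \<le> (\<Sum>n. (l * m) * (norm (u n) * norm (v n)))"
  proof (rule suminf_le)
    show "norm (cadj M (u n)) * norm (L (v n)) \<le> (l * m) * (norm (u n) * norm (v n))" for n
      using mult_mono[OF norm_cadj_le[OF M m(2) m(1), of "u n"] l(2)[of "v n"]] m(1) by (simp add: mult_ac)
  qed (use nr s in \<open>auto simp: nuclear_rep_def\<close>)
  also have "\<dots> = l * m * (\<Sum>n. norm (u n) * norm (v n))" by (rule suminf_mult[OF s])
  finally show ?thesis
    using nuclear_rep_trace_bound[OF nr] unfolding trace_bound_def by (meson order_trans)
qed

text \<open>g bounds the sums of moduli, hence all partial sums at once; q inherits measurability as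
  their pointwise limit.\<close>

lemma has_bochner_integral_series:
  fixes f :: "nat \<Rightarrow> 's \<Rightarrow> complex"
  assumes f: "\<And>n. has_bochner_integral \<rho> (f n) (I n)"
    and lim: "\<And>s. s \<in> space \<rho> \<Longrightarrow> (\<lambda>n. f n s) sums q s"
    and g: "integrable \<rho> g" and le: "AE s in \<rho>. \<forall>N. (\<Sum>n<N. cmod (f n s)) \<le> g s"
  shows "I sums (\<integral>s. q s \<partial>\<rho>)"
proof -
  have fi: "integrable \<rho> (f n)" "I n = integral\<^sup>L \<rho> (f n)" for n
    using f by (auto simp: has_bochner_integral_iff)
  have fm [measurable]: "f n \<in> borel_measurable \<rho>" for n using fi(1) by auto
  have "(\<lambda>N. \<integral>s. (\<Sum>n<N. f n s) \<partial>\<rho>) \<longlonglongrightarrow> (\<integral>s. q s \<partial>\<rho>)"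
  proof (rule integral_dominated_convergence[OF _ _ g])
    show "q \<in> borel_measurable \<rho>"
      by (rule borel_measurable_LIMSEQ_metric[where f = "\<lambda>N s. \<Sum>n<N. f n s"]) (use lim in \<open>auto simp: sums_def\<close>)
    show "AE s in \<rho>. norm (\<Sum>n<N. f n s) \<le> g s" for N
      using le
    proof eventually_elim
      case (elim s)
      from order_trans[OF norm_sum elim[rule_format]] show ?case .
    qed
  qed (use lim in \<open>auto simp: sums_def\<close>)
  then show ?thesis using fi by (simp add: sums_def Bochner_Integration.integral_sum)
qed

lemma weak_integral_compose_trace_bound:
  fixes L M :: "'s \<Rightarrow> 'a::chilbert \<Rightarrow> 'a"
  assumes L: "\<And>s. s \<in> space \<rho> \<Longrightarrow> bounded_clinear (L s)" and M: "\<And>s. s \<in> space \<rho> \<Longrightarrow> bounded_clinear (M s)"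
    and \<beta>: "nuclear_rep u v \<beta>" and g: "integrable \<rho> g"
    and le: "AE s in \<rho>. \<exists>l m. 0 \<le> l \<and> 0 \<le> m \<and> (\<forall>x. norm (L s x) \<le> l * norm x) \<and>
               (\<forall>x. norm (M s x) \<le> m * norm x) \<and> l * m \<le> g s"
    and A: "has_weak_integral \<rho> (\<lambda>s x. L s (\<beta> (M s x))) A"
  shows "AE s in \<rho>. trace_bound (\<lambda>x. L s (\<beta> (M s x))) (g s * (\<Sum>n. norm (u n) * norm (v n)))"
    and "trace_bound A (\<integral>s. g s * (\<Sum>n. norm (u n) * norm (v n)) \<partial>\<rho>)"
proof -
  let ?K = "\<Sum>n. norm (u n) * norm (v n)"
  have su: "summable (\<lambda>n. norm (u n) * norm (v n))" using \<beta> by (simp add: nuclear_rep_def)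
  have K0: "0 \<le> ?K" by (rule suminf_nonneg[OF su]) simp
  have AEs: "AE s in \<rho>. s \<in> space \<rho>" by simp
  show tb: "AE s in \<rho>. trace_bound (\<lambda>x. L s (\<beta> (M s x))) (g s * ?K)"
    using le AEs
  proof eventually_elim
    case (elim s)
    then obtain l m where lm: "0 \<le> l" "0 \<le> m" "\<And>x. norm (L s x) \<le> l * norm x"
      "\<And>x. norm (M s x) \<le> m * norm x" "l * m \<le> g s" by blast
    have "trace_bound (\<lambda>x. L s (\<beta> (M s x))) (l * m * ?K)"
      by (rule trace_bound_compose[OF \<beta> L M]) (use elim lm in auto)
    moreover have "l * m * ?K \<le> g s * ?K" by (rule mult_right_mono[OF lm(5) K0])
    ultimately show ?case unfolding trace_bound_def by (meson order_trans)
  qed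
  have gK: "integrable \<rho> (\<lambda>s. g s * ?K)" using g by auto
  show "trace_bound A (\<integral>s. g s * ?K \<partial>\<rho>)" by (rule weak_integral_trace_bound[OF A gK tb])
qed

text \<open>Over a basis of a nonseparable space the interchange of sum and integral needs the countable span of
  \<open>L s (v n)\<close>: only countably many basis vectors contribute, uniformly in \<open>s\<close>.\<close>

lemma weak_integral_trace_rotate:
  fixes L M :: "'s \<Rightarrow> 'a::chilbert \<Rightarrow> 'a"
  assumes L: "op_family \<rho> L" and M: "op_family \<rho> M" and \<beta>: "nuclear_rep u v \<beta>"
    and V: "closed V" "csubspace V" and E: "onb V E" and LV: "\<And>s x. s \<in> space \<rho> \<Longrightarrow> L s x \<in> V"
    and g: "integrable \<rho> g"
    and le: "AE s in \<rho>. \<exists>l m. 0 \<le> l \<and> 0 \<le> m \<and> (\<forall>x. norm (L s x) \<le> l * norm x) \<and>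
               (\<forall>x. norm (M s x) \<le> m * norm x) \<and> l * m \<le> g s"
    and A: "has_weak_integral \<rho> (\<lambda>s x. M s (L s x)) A"
    and A': "has_weak_integral \<rho> (\<lambda>s x. L s (\<beta> (M s x))) A'"
  shows "((\<lambda>e. cinner (A' e) e) has_sum (\<Sum>n. cinner (A (v n)) (u n))) E"
proof -
  define K where "K = (\<Sum>n. norm (u n) * norm (v n))"
  have su: "summable (\<lambda>n. norm (u n) * norm (v n))" using \<beta> by (simp add: nuclear_rep_def)
  have K0: "0 \<le> K" unfolding K_def by (rule suminf_nonneg[OF su]) simp
  have on: "orthonormal E" using E by (simp add: onb_def)
  define G where "G s x = L s (\<beta> (M s x))" for s x
  have gK: "integrable \<rho> (\<lambda>s. g s * K)" using g by auto
  note cL = op_family_clinear[OF L] and cM = op_family_clinear[OF M]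
  have GA': "has_weak_integral \<rho> G A'" using A' by (simp add: G_def[abs_def])
  have AEs: "AE s in \<rho>. s \<in> space \<rho>" by simp
  have tb: "AE s in \<rho>. trace_bound (G s) (g s * K)"
    and tbA: "trace_bound A' (\<integral>s. g s * K \<partial>\<rho>)"
    using weak_integral_compose_trace_bound[OF cL cM \<beta> g le A'] by (simp_all add: K_def G_def[abs_def])
  \<comment> \<open>The trace of the integrand at s, here through the nuclear series;
    \<open>qs\<close> recovers it from the basis. Both sides of the claim turn out to be the
    integral of q.\<close>
  define q where "q s = (\<Sum>n. cinner (M s (L s (v n))) (u n))" for s
  have nr: "nuclear_rep (\<lambda>n. cadj (M s) (u n)) (\<lambda>n. L s (v n)) (G s)" if "s \<in> space \<rho>" for s
    unfolding G_def[abs_def] by (rule nuclear_rep_compose[OF \<beta> cL[OF that] cM[OF that]])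
  have qs: "((\<lambda>e. cinner (G s e) e) has_sum q s) E" if s: "s \<in> space \<rho>" for s
    using nuclear_rep_trace[OF nr[OF s] V E LV[OF s]] by (simp add: cinner_cadj_right[OF cM[OF s]] q_def)
  have "\<forall>n. \<exists>D. countable D \<and> (\<forall>s\<in>space \<rho>. \<forall>y. (\<forall>d\<in>D. cinner d y = 0) \<longrightarrow> cinner (L s (v n)) y = 0)"
    using op_family_spanned[OF L] unfolding countably_spanned_def by blast
  then obtain D where D: "\<And>n. countable (D n)"
    "\<And>n s y. s \<in> space \<rho> \<Longrightarrow> \<forall>d\<in>D n. cinner d y = 0 \<Longrightarrow> cinner (L s (v n)) y = 0" by metis
  \<comment> \<open>The countably many basis vectors not orthogonal to all the spanning sets. Every
    other basis vector is orthogonal to \<open>L s (v n)\<close>, hence to the range of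
    \<open>G s\<close>, for all s at once.\<close>
  define E0 where "E0 = (\<Union>n. \<Union>d\<in>D n. {e\<in>E. cinner d e \<noteq> 0})"
  have E0: "countable E0" "E0 \<subseteq> E"
    unfolding E0_def using D(1) countable_nonorthogonal[OF on] by auto
  have G0: "cinner (G s x) e = 0" if s: "s \<in> space \<rho>" and e: "e \<in> E" "e \<notin> E0" for s x e
  proof -
    have "cinner (L s (v n)) e = 0" for n using D(2)[OF s, of n e] e by (auto simp: E0_def)
    moreover have "(\<lambda>n. cinner (cinner x (cadj (M s) (u n)) *\<^sub>C L s (v n)) e) sums cinner (G s x) e"
      using nr[OF s] by (intro bounded_linear.sums[OF cinner.bounded_linear_left]) (simp add: nuclear_rep_def)
    ultimately have "(\<lambda>n. 0) sums cinner (G s x) e" by (simp add: cinner_scaleC_left)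
    then show ?thesis using sums_unique2 sums_zero by blast
  qed
  have A'0: "cinner (A' e) e = 0" if "e \<in> E" "e \<notin> E0" for e
  proof -
    have "has_bochner_integral \<rho> (\<lambda>s. cinner (G s e) e) (cinner (A' e) e)"
      using GA' by (simp add: has_weak_integral_def)
    then have "cinner (A' e) e = (\<integral>s. cinner (G s e) e \<partial>\<rho>)" by (simp add: has_bochner_integral_iff)
    also have "\<dots> = (\<integral>s. 0 \<partial>\<rho>)" by (rule Bochner_Integration.integral_cong) (use G0 that in auto)
    finally show ?thesis by simp
  qed
  note to_E0 = has_sum_cong_neutral[THEN iffD1, rotated -1]
  define w where "w = enum0 E0"
  \<comment> \<open>The trace bound with the identity as contraction shows that the diagonal sum of
    \<open>A'\<close> exists before it is evaluated.\<close>
  have "(\<lambda>e. cmod (cinner (A' e) e)) summable_on E"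
  proof (rule nonneg_bdd_above_summable_on)
    have "sum (\<lambda>e. cmod (cinner (A' e) e)) F \<le> (\<integral>s. g s * K \<partial>\<rho>)"
      if "F \<subseteq> E" "finite F" for F
      using tbA[unfolded trace_bound_def, rule_format, of "\<lambda>x. x" F] orthonormal_subset[OF on that(1)] that(2) by simp
    then show "bdd_above (sum (\<lambda>e. cmod (cinner (A' e) e)) ` {F. F \<subseteq> E \<and> finite F})"
      unfolding bdd_above_def by blast
  qed simp
  from Infinite_Sum.abs_summable_summable[OF this]
  obtain t where t: "((\<lambda>e. cinner (A' e) e) has_sum t) E"
    unfolding summable_on_def ..
  then have "((\<lambda>e. cinner (A' e) e) has_sum t) E0"
    by (rule to_E0) (use E0 A'0 in auto)
  then have t_sums: "(\<lambda>n. cinner (A' (w n)) (w n)) sums t"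
    unfolding w_def by (intro has_sum_imp_sums has_sum_enum0 E0) auto
  \<comment> \<open>Interchange of the integral with the sum over the countable part of the basis,
    dominated by the pointwise trace bounds.\<close>
  have "(\<lambda>n. cinner (A' (w n)) (w n)) sums (\<integral>s. q s \<partial>\<rho>)"
  proof (rule has_bochner_integral_series[where f = "\<lambda>n s. cinner (G s (w n)) (w n)", OF _ _ gK])
    show "has_bochner_integral \<rho> (\<lambda>s. cinner (G s (w n)) (w n)) (cinner (A' (w n)) (w n))" for n
      using GA' by (simp add: has_weak_integral_def)
    show "(\<lambda>n. cinner (G s (w n)) (w n)) sums q s" if s: "s \<in> space \<rho>" for s
    proof -
      have "((\<lambda>e. cinner (G s e) e) has_sum q s) E0"
        using qs[OF s] by (rule to_E0) (use E0 G0[OF s] in auto)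
      then show ?thesis unfolding w_def by (intro has_sum_imp_sums has_sum_enum0 E0) auto
    qed
    show "AE s in \<rho>. \<forall>N. (\<Sum>n<N. cmod (cinner (G s (w n)) (w n))) \<le> g s * K"
      using tb AEs
    proof eventually_elim
      case (elim s)
      have b: "sum (\<lambda>e. cmod (cinner (G s e) e)) F \<le> g s * K" if "F \<subseteq> E0" "finite F" for F
        using elim(1)[unfolded trace_bound_def, rule_format, of "\<lambda>x. x" F]
          orthonormal_subset[OF on] that E0(2) by auto
      then have sm: "(\<lambda>e. cmod (cinner (G s e) e)) summable_on E0"
        by (intro nonneg_bdd_above_summable_on) (auto simp: bdd_above_def)
      have "((\<lambda>e. cmod (cinner (G s e) e)) has_sum infsum (\<lambda>e. cmod (cinner (G s e) e)) E0) E0"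
        using sm by (rule has_sum_infsum)
      then have "(\<lambda>n. cmod (cinner (G s (w n)) (w n))) sums infsum (\<lambda>e. cmod (cinner (G s e) e)) E0"
        unfolding w_def by (intro has_sum_imp_sums has_sum_enum0 E0) auto
      moreover have "infsum (\<lambda>e. cmod (cinner (G s e) e)) E0 \<le> g s * K"
        by (rule infsum_le_finite_sums[OF sm]) (use b in auto)
      ultimately show ?case
        by (metis (no_types, lifting) norm_ge_zero order_trans sum_le_suminf sums_summable sums_unique finite_lessThan)
    qed
  qed
  then have tq: "t = (\<integral>s. q s \<partial>\<rho>)" using t_sums sums_unique2 by blast
  \<comment> \<open>Interchange of the integral with the nuclear series, dominated through l * m * K
    <= g s * K.\<close>
  have "(\<lambda>n. cinner (A (v n)) (u n)) sums (\<integral>s. q s \<partial>\<rho>)"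
  proof (rule has_bochner_integral_series[where f = "\<lambda>n s. cinner (M s (L s (v n))) (u n)", OF _ _ gK])
    show "has_bochner_integral \<rho> (\<lambda>s. cinner (M s (L s (v n))) (u n)) (cinner (A (v n)) (u n))" for n
      using A by (simp add: has_weak_integral_def)
    have sm: "(\<Sum>n<N. cmod (cinner (M s (L s (v n))) (u n))) \<le> l * m * K"
      and smb: "summable (\<lambda>n. cmod (cinner (M s (L s (v n))) (u n)))"
      if lm: "0 \<le> l" "0 \<le> m" "\<And>x. norm (L s x) \<le> l * norm x" "\<And>x. norm (M s x) \<le> m * norm x" for l m s N
    proof -
      have b: "cmod (cinner (M s (L s (v n))) (u n)) \<le> l * m * (norm (u n) * norm (v n))" for n
      proof -
        have "cmod (cinner (M s (L s (v n))) (u n)) \<le> norm (M s (L s (v n))) * norm (u n)" by (rule cmod_cinner_le)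
        also have "\<dots> \<le> (m * (l * norm (v n))) * norm (u n)"
          by (intro mult_right_mono order_trans[OF lm(4)] mult_left_mono lm) auto
        finally show ?thesis by (simp add: mult_ac)
      qed
      show "summable (\<lambda>n. cmod (cinner (M s (L s (v n))) (u n)))"
        by (rule summable_comparison_test'[OF summable_mult[OF su, of "l * m"], of 0]) (use b in auto)
      have "(\<Sum>n<N. cmod (cinner (M s (L s (v n))) (u n))) \<le> (\<Sum>n<N. l * m * (norm (u n) * norm (v n)))"
        by (rule sum_mono[OF b])
      also have "\<dots> \<le> l * m * K"
        unfolding K_def sum_distrib_left[symmetric]
        by (intro mult_left_mono sum_le_suminf su) (use lm in auto)
      finally show "(\<Sum>n<N. cmod (cinner (M s (L s (v n))) (u n))) \<le> l * m * K" .
    qed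
    show "(\<lambda>n. cinner (M s (L s (v n))) (u n)) sums q s" if s: "s \<in> space \<rho>" for s
    proof -
      obtain l m where lm: "0 < l" "\<And>x. norm (L s x) \<le> l * norm x" "0 < m" "\<And>x. norm (M s x) \<le> m * norm x"
        using bounded_clinear_bound[OF cL[OF s]] bounded_clinear_bound[OF cM[OF s]] by metis
      have "summable (\<lambda>n. cmod (cinner (M s (L s (v n))) (u n)))"
        by (rule smb[of l m]) (use lm in auto)
      from summable_sums[OF summable_norm_cancel[OF this]] show ?thesis by (simp add: q_def)
    qed
    show "AE s in \<rho>. \<forall>N. (\<Sum>n<N. cmod (cinner (M s (L s (v n))) (u n))) \<le> g s * K"
      using le
    proof eventually_elim
      case (elim s)
      then obtain l m where lm: "0 \<le> l" "0 \<le> m" "\<And>x. norm (L s x) \<le> l * norm x"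
        "\<And>x. norm (M s x) \<le> m * norm x" "l * m \<le> g s" by blast
      show ?case
        using sm[OF lm(1-4)] mult_right_mono[OF lm(5) K0] by (meson order_trans)
    qed
  qed
  then have "t = (\<Sum>n. cinner (A (v n)) (u n))" unfolding tq by (rule sums_unique)
  with t show "((\<lambda>e. cinner (A' e) e) has_sum (\<Sum>n. cinner (A (v n)) (u n))) E" by simp
qed

section \<open>The Hilbert space of square summable families\<close>

definition square_summable :: "('a \<Rightarrow> complex) \<Rightarrow> bool" where
  "square_summable f \<longleftrightarrow> (\<lambda>a. (cmod (f a))\<^sup>2) summable_on UNIV"

lemma square_summable_bound:
  assumes "\<And>F. finite F \<Longrightarrow> (\<Sum>a\<in>F. (cmod (f a))\<^sup>2) \<le> B" shows "square_summable f"
  unfolding square_summable_def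
  by (rule nonneg_bdd_above_summable_on) (use assms in \<open>auto simp: bdd_above_def\<close>)

lemma square_summable_scale: "square_summable f \<Longrightarrow> square_summable (\<lambda>a. c * f a)"
  unfolding square_summable_def norm_mult power_mult_distrib by (rule summable_on_cmult_right)

lemma square_summable_add:
  assumes "square_summable f" "square_summable g" shows "square_summable (\<lambda>a. f a + g a)"
  unfolding square_summable_def
proof (rule summable_on_comparison_test)
  show "(\<lambda>a. 2 * (cmod (f a))\<^sup>2 + 2 * (cmod (g a))\<^sup>2) summable_on UNIV"
    using assms unfolding square_summable_def by (intro summable_on_add summable_on_cmult_right)
  show "(cmod (f a + g a))\<^sup>2 \<le> 2 * (cmod (f a))\<^sup>2 + 2 * (cmod (g a))\<^sup>2" for a
  proof -
    have "(cmod (f a + g a))\<^sup>2 \<le> (cmod (f a) + cmod (g a))\<^sup>2"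
      by (intro power_mono norm_triangle_ineq) simp
    also have "\<dots> \<le> 2 * (cmod (f a))\<^sup>2 + 2 * (cmod (g a))\<^sup>2"
      using sum_squares_bound[of "cmod (f a)" "cmod (g a)"] by (simp add: power2_sum)
    finally show ?thesis .
  qed
qed simp

lemma square_summable_minus:
  assumes "square_summable f" "square_summable g" shows "square_summable (\<lambda>a. f a - g a)"
  using square_summable_add[OF assms(1) square_summable_scale[OF assms(2), of "-1"]] by simp

lemma square_summable_product:
  assumes "square_summable f" "square_summable g" shows "(\<lambda>a. f a * cnj (g a)) summable_on UNIV"
proof -
  have "(\<lambda>a. cmod (f a * cnj (g a))) summable_on UNIV"
  proof (rule summable_on_comparison_test)
    show "(\<lambda>a. (cmod (f a))\<^sup>2 + (cmod (g a))\<^sup>2) summable_on UNIV"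
      using assms unfolding square_summable_def by (intro summable_on_add)
    show "cmod (f a * cnj (g a)) \<le> (cmod (f a))\<^sup>2 + (cmod (g a))\<^sup>2" for a
      using sum_squares_bound[of "cmod (f a)" "cmod (g a)"] mult_nonneg_nonneg[OF norm_ge_zero[of "f a"] norm_ge_zero[of "g a"]]
      unfolding norm_mult complex_mod_cnj by linarith
  qed simp
  then show ?thesis by (rule Infinite_Sum.abs_summable_summable)
qed

typedef 'a ell2 = "{f :: 'a \<Rightarrow> complex. square_summable f}"
  by (rule exI[of _ "\<lambda>_. 0"]) (simp add: square_summable_def)

setup_lifting type_definition_ell2

instantiation ell2 :: (type) real_vector
begin

lift_definition zero_ell2 :: "'a ell2" is "\<lambda>_. 0" by (simp add: square_summable_def)
lift_definition plus_ell2 :: "'a ell2 \<Rightarrow> 'a ell2 \<Rightarrow> 'a ell2" is "\<lambda>f g a. f a + g a" by (rule square_summable_add)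
lift_definition minus_ell2 :: "'a ell2 \<Rightarrow> 'a ell2 \<Rightarrow> 'a ell2" is "\<lambda>f g a. f a - g a" by (rule square_summable_minus)
lift_definition uminus_ell2 :: "'a ell2 \<Rightarrow> 'a ell2" is "\<lambda>f a. - f a" by (simp add: square_summable_def)
lift_definition scaleR_ell2 :: "real \<Rightarrow> 'a ell2 \<Rightarrow> 'a ell2" is "\<lambda>r f a. complex_of_real r * f a"
  by (rule square_summable_scale)

instance
  by (standard; transfer; simp add: fun_eq_iff algebra_simps)

end

lift_definition ell2_scale :: "complex \<Rightarrow> 'a ell2 \<Rightarrow> 'a ell2" is "\<lambda>c f a. c * f a"
  by (rule square_summable_scale)

lift_definition ell2_cinner :: "'a ell2 \<Rightarrow> 'a ell2 \<Rightarrow> complex" is "\<lambda>f g. \<Sum>\<^sub>\<infinity>a. f a * cnj (g a)" .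

lemma ell2_cinner_add_left: "ell2_cinner (x + y) z = ell2_cinner x z + ell2_cinner y z"
  by transfer (simp add: ring_distribs infsum_add square_summable_product)

lemma ell2_cinner_scale_left: "ell2_cinner (ell2_scale c x) y = c * ell2_cinner x y"
  by transfer (simp add: mult.assoc infsum_cmult_right square_summable_product)

lemma ell2_cinner_commute: "ell2_cinner x y = cnj (ell2_cinner y x)"
  by transfer (simp add: mult.commute flip: infsum_cnj)

lemma ell2_cinner_self: "ell2_cinner x x = complex_of_real (\<Sum>\<^sub>\<infinity>a. (cmod (Rep_ell2 x a))\<^sup>2)"
proof transfer
  fix f :: "'a \<Rightarrow> complex" assume f: "square_summable f"
  have "((\<lambda>a. (cmod (f a))\<^sup>2) has_sum (\<Sum>\<^sub>\<infinity>a. (cmod (f a))\<^sup>2)) UNIV"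
    using f by (simp add: square_summable_def)
  then have "((\<lambda>a. complex_of_real ((cmod (f a))\<^sup>2)) has_sum complex_of_real (\<Sum>\<^sub>\<infinity>a. (cmod (f a))\<^sup>2)) UNIV"
    by (rule has_sum_of_real)
  then have "((\<lambda>a. f a * cnj (f a)) has_sum complex_of_real (\<Sum>\<^sub>\<infinity>a. (cmod (f a))\<^sup>2)) UNIV"
    by (simp only: complex_norm_square)
  then show "(\<Sum>\<^sub>\<infinity>a. f a * cnj (f a)) = complex_of_real (\<Sum>\<^sub>\<infinity>a. (cmod (f a))\<^sup>2)" by (rule infsumI)
qed

lemma square_summable_Rep: "(\<lambda>a. (cmod (Rep_ell2 x a))\<^sup>2) summable_on UNIV"
  using Rep_ell2[of x] by (simp add: square_summable_def)

instantiation ell2 :: (type) real_inner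
begin

definition inner_ell2 :: "'a ell2 \<Rightarrow> 'a ell2 \<Rightarrow> real" where "inner_ell2 x y = Re (ell2_cinner x y)"
definition norm_ell2 :: "'a ell2 \<Rightarrow> real" where "norm_ell2 x = sqrt (inner x x)"
definition dist_ell2 :: "'a ell2 \<Rightarrow> 'a ell2 \<Rightarrow> real" where "dist_ell2 x y = norm (x - y)"
definition sgn_ell2 :: "'a ell2 \<Rightarrow> 'a ell2" where "sgn_ell2 x = x /\<^sub>R norm x"
definition uniformity_ell2 :: "('a ell2 \<times> 'a ell2) filter" where
  "uniformity_ell2 = (INF e\<in>{0<..}. principal {(x, y). dist x y < e})"
definition open_ell2 :: "'a ell2 set \<Rightarrow> bool" where
  "open_ell2 U \<longleftrightarrow> (\<forall>x\<in>U. \<forall>\<^sub>F (x', y) in uniformity. x' = x \<longrightarrow> y \<in> U)"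

instance
proof
  fix x y z :: "'a ell2" and r :: real
  show "inner x y = inner y x"
    unfolding inner_ell2_def by (subst ell2_cinner_commute) simp
  show "inner (x + y) z = inner x z + inner y z" by (simp add: inner_ell2_def ell2_cinner_add_left)
  have "r *\<^sub>R x = ell2_scale (complex_of_real r) x" by transfer simp
  then show "inner (r *\<^sub>R x) y = r * inner x y" by (simp add: inner_ell2_def ell2_cinner_scale_left)
  have self: "inner x x = (\<Sum>\<^sub>\<infinity>a. (cmod (Rep_ell2 x a))\<^sup>2)" by (simp add: inner_ell2_def ell2_cinner_self)
  show "0 \<le> inner x x" unfolding self by (rule infsum_nonneg) simp
  show "inner x x = 0 \<longleftrightarrow> x = 0"
  proof
    assume "inner x x = 0"
    then have "(cmod (Rep_ell2 x a))\<^sup>2 = 0" for a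
      using nonneg_infsum_le_0D[OF _ square_summable_Rep[of x], of a] by (simp add: self)
    then have "Rep_ell2 x = (\<lambda>_. 0)" by auto
    then show "x = 0" by transfer
  next
    assume "x = 0"
    then show "inner x x = 0" unfolding self by (simp add: zero_ell2.rep_eq)
  qed
qed (rule dist_ell2_def sgn_ell2_def uniformity_ell2_def open_ell2_def norm_ell2_def)+

end

lemma norm_ell2_square: "(norm x)\<^sup>2 = (\<Sum>\<^sub>\<infinity>a. (cmod (Rep_ell2 x a))\<^sup>2)"
proof -
  have "(norm x)\<^sup>2 = Re (ell2_cinner x x)" by (simp only: power2_norm_eq_inner inner_ell2_def)
  then show ?thesis by (simp add: ell2_cinner_self)
qed

lemma sum_le_norm_ell2: "finite F \<Longrightarrow> (\<Sum>a\<in>F. (cmod (Rep_ell2 x a))\<^sup>2) \<le> (norm x)\<^sup>2"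
  unfolding norm_ell2_square
  by (rule finite_sum_le_infsum[OF square_summable_Rep]) auto

lemma norm_ell2_le:
  assumes "\<And>F. finite F \<Longrightarrow> (\<Sum>a\<in>F. (cmod (Rep_ell2 x a))\<^sup>2) \<le> B\<^sup>2" "0 \<le> B" shows "norm x \<le> B"
proof -
  have "(norm x)\<^sup>2 \<le> B\<^sup>2"
    unfolding norm_ell2_square by (rule infsum_le_finite_sums[OF square_summable_Rep]) (use assms in auto)
  then show ?thesis using assms(2) by (rule power2_le_imp_le)
qed

instance ell2 :: (type) banach
proof
  fix X :: "nat \<Rightarrow> 'a ell2" assume X: "Cauchy X"
  let ?r = "\<lambda>n. Rep_ell2 (X n)"
  have coord: "cmod (?r m a - ?r n a) \<le> norm (X m - X n)" for m n a
    using sum_le_norm_ell2[of "{a}" "X m - X n"] by (simp add: minus_ell2.rep_eq)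
  have "Cauchy (\<lambda>n. ?r n a)" for a
    unfolding Cauchy_iff
  proof (intro allI impI)
    fix e :: real assume "0 < e"
    then obtain N where "\<And>m n. N \<le> m \<Longrightarrow> N \<le> n \<Longrightarrow> norm (X m - X n) < e"
      using X unfolding Cauchy_iff by blast
    then show "\<exists>M. \<forall>m\<ge>M. \<forall>n\<ge>M. norm (?r m a - ?r n a) < e"
      using coord le_less_trans by (intro exI[of _ N]) blast
  qed
  then have "\<forall>a. \<exists>l. (\<lambda>n. ?r n a) \<longlonglongrightarrow> l"
    using Cauchy_convergent convergent_def by blast
  then obtain f where f: "\<And>a. (\<lambda>n. ?r n a) \<longlonglongrightarrow> f a" by metis
  \<comment> \<open>On a finite index set the coordinatewise limit may be taken in the Cauchy
    estimate; uniformity over these sets turns the result into a norm estimate.\<close>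
  have tail: "\<exists>N. \<forall>n\<ge>N. \<forall>F. finite F \<longrightarrow> (\<Sum>a\<in>F. (cmod (?r n a - f a))\<^sup>2) \<le> e\<^sup>2" if "0 < e" for e
  proof -
    obtain N where N: "\<And>m n. N \<le> m \<Longrightarrow> N \<le> n \<Longrightarrow> norm (X m - X n) < e"
      using X \<open>0 < e\<close> unfolding Cauchy_iff by blast
    have "(\<Sum>a\<in>F. (cmod (?r n a - f a))\<^sup>2) \<le> e\<^sup>2" if "N \<le> n" "finite F" for n F
    proof (rule LIMSEQ_le_const2)
      show "(\<lambda>m. \<Sum>a\<in>F. (cmod (?r n a - ?r m a))\<^sup>2) \<longlonglongrightarrow> (\<Sum>a\<in>F. (cmod (?r n a - f a))\<^sup>2)"
        by (intro tendsto_intros f)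
      show "\<exists>M. \<forall>m\<ge>M. (\<Sum>a\<in>F. (cmod (?r n a - ?r m a))\<^sup>2) \<le> e\<^sup>2"
      proof (intro exI[of _ N] allI impI)
        fix m assume "N \<le> m"
        have "(\<Sum>a\<in>F. (cmod (?r n a - ?r m a))\<^sup>2) \<le> (norm (X n - X m))\<^sup>2"
          using sum_le_norm_ell2[OF \<open>finite F\<close>, of "X n - X m"] by (simp add: minus_ell2.rep_eq)
        also have "\<dots> \<le> e\<^sup>2" using N[OF \<open>N \<le> n\<close> \<open>N \<le> m\<close>] by (intro power_mono) auto
        finally show "(\<Sum>a\<in>F. (cmod (?r n a - ?r m a))\<^sup>2) \<le> e\<^sup>2" .
      qed
    qed
    then show ?thesis by blast
  qed
  obtain N where "\<And>F. finite F \<Longrightarrow> (\<Sum>a\<in>F. (cmod (?r N a - f a))\<^sup>2) \<le> 1" using tail[of 1] by auto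
  then have "square_summable (\<lambda>a. ?r N a - f a)" by (rule square_summable_bound)
  \<comment> \<open>The limit f is square summable as the difference of a member of the sequence and
    a square summable remainder.\<close>
  from square_summable_minus[OF _ this] have "square_summable (\<lambda>a. ?r N a - (?r N a - f a))"
    using Rep_ell2[of "X N"] by blast
  then have f_sq: "square_summable f" by simp
  define l where "l = Abs_ell2 f"
  have l: "Rep_ell2 l = f" using f_sq by (simp add: l_def Abs_ell2_inverse)
  have "X \<longlonglongrightarrow> l"
    unfolding LIMSEQ_iff
  proof (intro allI impI)
    fix e :: real assume "0 < e"
    then obtain N where N: "\<And>n F. N \<le> n \<Longrightarrow> finite F \<Longrightarrow> (\<Sum>a\<in>F. (cmod (?r n a - f a))\<^sup>2) \<le> (e/2)\<^sup>2"
      using tail[of "e/2"] by auto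
    have "norm (X n - l) < e" if "N \<le> n" for n
    proof -
      have "norm (X n - l) \<le> e/2"
        by (rule norm_ell2_le) (use N[OF that] \<open>0 < e\<close> in \<open>auto simp: minus_ell2.rep_eq l\<close>)
      then show ?thesis using \<open>0 < e\<close> by linarith
    qed
    then show "\<exists>no. \<forall>n\<ge>no. norm (X n - l) < e" by blast
  qed
  then show "convergent X" by (auto simp: convergent_def)
qed

instantiation ell2 :: (type) chilbert
begin

definition scaleC_ell2 :: "complex \<Rightarrow> 'a ell2 \<Rightarrow> 'a ell2" where "scaleC_ell2 = ell2_scale"
definition cinner_ell2 :: "'a ell2 \<Rightarrow> 'a ell2 \<Rightarrow> complex" where "cinner_ell2 = ell2_cinner"

instance
proof
  fix a b :: complex and r :: real and x y z :: "'a ell2"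
  show "a *\<^sub>C (x + y) = a *\<^sub>C x + a *\<^sub>C y" "(a + b) *\<^sub>C x = a *\<^sub>C x + b *\<^sub>C x" "a *\<^sub>C b *\<^sub>C x = (a * b) *\<^sub>C x"
    "complex_of_real r *\<^sub>C x = r *\<^sub>R x"
    unfolding scaleC_ell2_def by (transfer; simp add: algebra_simps)+
  show "cinner (x + y) z = cinner x z + cinner y z" unfolding cinner_ell2_def by (rule ell2_cinner_add_left)
  show "cinner (a *\<^sub>C x) y = a * cinner x y"
    unfolding cinner_ell2_def scaleC_ell2_def by (rule ell2_cinner_scale_left)
  show "cinner x y = cnj (cinner y x)" unfolding cinner_ell2_def by (rule ell2_cinner_commute)
  show "Re (cinner x y) = inner x y" by (simp add: cinner_ell2_def inner_ell2_def)
qed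

end

section \<open>Orthonormal bases of Hilbert spaces with a carrier\<close>

definition fourier_sum :: "'a hilb \<Rightarrow> 'a set \<Rightarrow> 'a \<Rightarrow> 'a" where
  "fourier_sum H F x = (\<Oplus>\<^bsub>H\<^esub>e\<in>F. hinner H x e \<odot>\<^bsub>H\<^esub> e)"

definition orthonormal_set :: "'a hilb \<Rightarrow> 'a set \<Rightarrow> bool" where
  "orthonormal_set H E \<longleftrightarrow> E \<subseteq> carrier H \<and> (\<forall>e\<in>E. \<forall>f\<in>E. hinner H e f = (if e = f then 1 else 0))"

context hilbert_space
begin

interpretation module complex_ring H by (rule complex_module)

lemma complex_ring_simps [simp]:
  "carrier complex_ring = UNIV" "x \<oplus>\<^bsub>complex_ring\<^esub> y = x + y" "x \<otimes>\<^bsub>complex_ring\<^esub> y = x * y"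
  "\<one>\<^bsub>complex_ring\<^esub> = 1" "\<zero>\<^bsub>complex_ring\<^esub> = 0"
  by (simp_all add: complex_ring_def)

lemma carrier_add: "x \<in> carrier H \<Longrightarrow> y \<in> carrier H \<Longrightarrow> x \<oplus> y \<in> carrier H"
  and carrier_diff: "x \<in> carrier H \<Longrightarrow> y \<in> carrier H \<Longrightarrow> x \<ominus> y \<in> carrier H"
  and carrier_zero: "\<zero> \<in> carrier H"
  and carrier_smult: "x \<in> carrier H \<Longrightarrow> a \<odot> x \<in> carrier H"
  by (simp_all add: smult_closed)

lemma hinner_zero_left [simp]: "y \<in> carrier H \<Longrightarrow> hinner H \<zero> y = 0"
  using hinner_add_left[of \<zero> \<zero> y] by simp

lemma hinner_diff_left:
  assumes "x \<in> carrier H" "y \<in> carrier H" "z \<in> carrier H"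
  shows "hinner H (x \<ominus> y) z = hinner H x z - hinner H y z"
proof -
  have "hinner H (\<ominus> y) z + hinner H y z = 0"
    using hinner_add_left[of "\<ominus> y" y z] assms by (simp add: M.l_neg)
  then show ?thesis
    using hinner_add_left[of x "\<ominus> y" z] assms by (simp add: M.minus_eq) (metis add_eq_0_iff2 diff_conv_add_uminus)
qed

lemma hinner_add_right:
  "x \<in> carrier H \<Longrightarrow> y \<in> carrier H \<Longrightarrow> z \<in> carrier H \<Longrightarrow> hinner H z (x \<oplus> y) = hinner H z x + hinner H z y"
  by (metis carrier_add complex_cnj_add hinner_add_left hinner_commute)

lemma hinner_smult_right:
  "x \<in> carrier H \<Longrightarrow> y \<in> carrier H \<Longrightarrow> hinner H x (a \<odot> y) = cnj a * hinner H x y"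
  by (metis carrier_smult complex_cnj_mult hinner_commute hinner_smult_left)

lemma hinner_diff_right:
  "x \<in> carrier H \<Longrightarrow> y \<in> carrier H \<Longrightarrow> z \<in> carrier H \<Longrightarrow> hinner H z (x \<ominus> y) = hinner H z x - hinner H z y"
  by (metis carrier_diff complex_cnj_diff hinner_diff_left hinner_commute)

lemma hinner_self: "x \<in> carrier H \<Longrightarrow> hinner H x x = complex_of_real ((hnorm H x)\<^sup>2)"
  using arg_cong[OF hinner_commute[of x x], of Im] hinner_nonneg[of x]
  by (simp add: hnorm_def complex_eq_iff)

lemma hinner_ext:
  assumes "x \<in> carrier H" "y \<in> carrier H" "\<And>z. z \<in> carrier H \<Longrightarrow> hinner H x z = hinner H y z"
  shows "x = y"
proof -
  have "hinner H (x \<ominus> y) (x \<ominus> y) = 0" using assms by (simp add: hinner_diff_left carrier_diff)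
  then have "x \<ominus> y = \<zero>" using assms by (intro hinner_eq_zero carrier_diff) auto
  moreover have "x = (x \<ominus> y) \<oplus> y" using assms by (simp add: M.minus_eq M.a_assoc M.l_neg)
  ultimately show ?thesis using assms by (metis M.l_zero)
qed

lemma finsum_carrier: "(\<And>v. v \<in> F \<Longrightarrow> f v \<in> carrier H) \<Longrightarrow> (\<Oplus>v\<in>F. f v) \<in> carrier H"
  by (rule M.finsum_closed) auto

lemma hinner_finsum_left:
  assumes "finite F" "\<And>v. v \<in> F \<Longrightarrow> f v \<in> carrier H" "z \<in> carrier H"
  shows "hinner H (\<Oplus>v\<in>F. f v) z = (\<Sum>v\<in>F. hinner H (f v) z)"
  using assms(1,2)
proof (induction F)
  case (insert v F)
  then have "(\<Oplus>w\<in>insert v F. f w) = f v \<oplus> (\<Oplus>w\<in>F. f w)" by (intro M.finsum_insert) auto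
  then show ?case using insert assms(3) by (simp add: hinner_add_left finsum_carrier)
qed (simp add: assms(3))

lemma hnorm_nonneg: "0 \<le> hnorm H x" if "x \<in> carrier H"
  using hinner_nonneg[OF that] by (simp add: hnorm_def)

lemma hnorm_diff_commute: "x \<in> carrier H \<Longrightarrow> y \<in> carrier H \<Longrightarrow> hnorm H (x \<ominus> y) = hnorm H (y \<ominus> x)"
  unfolding hnorm_def
  by (simp add: hinner_diff_left hinner_diff_right carrier_diff)

section \<open>Fourier sums in the carrier\<close>

lemma fourier_sum_carrier: "F \<subseteq> carrier H \<Longrightarrow> fourier_sum H F x \<in> carrier H"
  unfolding fourier_sum_def by (rule finsum_carrier) (auto intro: carrier_smult)

context
  fixes E assumes E: "orthonormal_set H E"
begin

lemma orthonormal_setD: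
  shows "e \<in> E \<Longrightarrow> e \<in> carrier H" "e \<in> E \<Longrightarrow> f \<in> E \<Longrightarrow> hinner H e f = (if e = f then 1 else 0)"
  using E unfolding orthonormal_set_def by blast+

lemma hinner_fourier_sum:
  assumes F: "finite F" "F \<subseteq> E" and "x \<in> carrier H"
  shows "z \<in> carrier H \<Longrightarrow> hinner H (fourier_sum H F x) z = (\<Sum>e\<in>F. hinner H x e * hinner H e z)"
    and "e \<in> E \<Longrightarrow> hinner H (fourier_sum H F x) e = (if e \<in> F then hinner H x e else 0)"
proof -
  have FH: "F \<subseteq> carrier H" using F orthonormal_setD(1) by blast
  show 1: "hinner H (fourier_sum H F x) z = (\<Sum>e\<in>F. hinner H x e * hinner H e z)" if z: "z \<in> carrier H" for z
  proof -
    have "hinner H (fourier_sum H F x) z = (\<Sum>e\<in>F. hinner H (hinner H x e \<odot> e) z)"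
      unfolding fourier_sum_def by (rule hinner_finsum_left) (use F FH z carrier_smult in auto)
    also have "\<dots> = (\<Sum>e\<in>F. hinner H x e * hinner H e z)"
      by (intro sum.cong refl hinner_smult_left) (use FH z in auto)
    finally show ?thesis .
  qed
  show "hinner H (fourier_sum H F x) e = (if e \<in> F then hinner H x e else 0)" if e: "e \<in> E"
  proof -
    have "hinner H (fourier_sum H F x) e = (\<Sum>f\<in>F. hinner H x f * hinner H f e)"
      by (rule 1) (rule orthonormal_setD(1)[OF e])
    also have "\<dots> = (\<Sum>f\<in>F. if f = e then hinner H x e else 0)"
      by (intro sum.cong refl) (use orthonormal_setD(2) e F in auto)
    finally show ?thesis using F by simp
  qed
qed

text \<open>The remainder is orthogonal to the vectors of F, which is Pythagoras. Bessel's
  inequality is needed inside the carrier because the embedding into \<open>ell2\<close> is built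
  from it.\<close>

lemma hnorm_diff_fourier_sum:
  assumes F: "finite F" "F \<subseteq> E" and x: "x \<in> carrier H"
  shows "(hnorm H (x \<ominus> fourier_sum H F x))\<^sup>2 = (hnorm H x)\<^sup>2 - (\<Sum>e\<in>F. (cmod (hinner H x e))\<^sup>2)"
proof -
  have FH: "F \<subseteq> carrier H" using F orthonormal_setD(1) by blast
  let ?s = "fourier_sum H F x"
  have s: "?s \<in> carrier H" by (rule fourier_sum_carrier[OF FH])
  define y where "y = x \<ominus> ?s"
  have y: "y \<in> carrier H" unfolding y_def using x s by (rule carrier_diff)
  have ey: "hinner H e y = 0" if "e \<in> F" for e
  proof -
    have e: "e \<in> E" "e \<in> carrier H" using that F FH by auto
    have "hinner H y e = 0"
      using that e by (simp add: y_def hinner_diff_left x s hinner_fourier_sum(2)[OF F x])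
    then show ?thesis using hinner_commute[OF e(2) y] by simp
  qed
  have "hinner H y y = hinner H x y - hinner H ?s y"
    unfolding y_def by (rule hinner_diff_left) (use x s carrier_diff in auto)
  also have "hinner H ?s y = 0" using y ey by (simp add: hinner_fourier_sum(1)[OF F x])
  also have "hinner H x y = hinner H x x - cnj (hinner H ?s x)"
    unfolding y_def using x s hinner_commute[OF x s] by (simp add: hinner_diff_right)
  also have "hinner H ?s x = (\<Sum>e\<in>F. hinner H x e * cnj (hinner H x e))"
    unfolding hinner_fourier_sum(1)[OF F x x]
    by (intro sum.cong refl arg_cong2[where f = "(*)"] hinner_commute) (use FH x in auto)
  finally have "hinner H y y = hinner H x x - complex_of_real (\<Sum>e\<in>F. (cmod (hinner H x e))\<^sup>2)"
    by (simp add: complex_norm_square[symmetric])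
  then have "complex_of_real ((hnorm H y)\<^sup>2) = complex_of_real ((hnorm H x)\<^sup>2 - (\<Sum>e\<in>F. (cmod (hinner H x e))\<^sup>2))"
    by (simp add: hinner_self x y)
  then show ?thesis unfolding y_def of_real_eq_iff .
qed

lemma hilbert_bessel:
  assumes F: "finite F" "F \<subseteq> E" and x: "x \<in> carrier H"
  shows "(\<Sum>e\<in>F. (cmod (hinner H x e))\<^sup>2) \<le> (hnorm H x)\<^sup>2"
  using hnorm_diff_fourier_sum[OF assms] zero_le_power2[of "hnorm H (x \<ominus> fourier_sum H F x)"] by linarith

lemma hnorm_fourier_sum_diff:
  assumes G: "finite G" "G \<subseteq> E" "F \<subseteq> G" and x: "x \<in> carrier H"
  shows "(hnorm H (fourier_sum H G x \<ominus> fourier_sum H F x))\<^sup>2 = (\<Sum>e\<in>G - F. (cmod (hinner H x e))\<^sup>2)"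
proof -
  have F: "finite F" "F \<subseteq> E" using G finite_subset by auto
  have GH: "G \<subseteq> carrier H" and FH: "F \<subseteq> carrier H" using G F orthonormal_setD(1) by blast+
  let ?s = "fourier_sum H F x" and ?t = "fourier_sum H G x"
  have s: "?s \<in> carrier H" "?t \<in> carrier H" by (rule fourier_sum_carrier[OF FH] fourier_sum_carrier[OF GH])+
  define z where "z = ?t \<ominus> ?s"
  have z: "z \<in> carrier H" unfolding z_def using s by (intro carrier_diff)
  have ez: "hinner H e z = (if e \<in> F then 0 else cnj (hinner H x e))" if "e \<in> G" for e
  proof -
    have e: "e \<in> E" "e \<in> carrier H" using that G GH by auto
    have "hinner H z e = (if e \<in> F then 0 else hinner H x e)"
      using that e
      by (simp add: z_def hinner_diff_left s hinner_fourier_sum(2)[OF F x] hinner_fourier_sum(2)[OF G(1,2) x])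
    then show ?thesis using hinner_commute[OF e(2) z] by simp
  qed
  have "hinner H z z = hinner H ?t z - hinner H ?s z"
    unfolding z_def by (rule hinner_diff_left) (use s carrier_diff in auto)
  also have "hinner H ?s z = 0"
    using z ez G(3) by (auto simp: hinner_fourier_sum(1)[OF F x] intro!: sum.neutral)
  also have "hinner H ?t z = (\<Sum>e\<in>G. if e \<in> F then 0 else hinner H x e * cnj (hinner H x e))"
    using z ez by (auto simp: hinner_fourier_sum(1)[OF G(1,2) x] intro!: sum.cong)
  also have "\<dots> = (\<Sum>e\<in>G - F. hinner H x e * cnj (hinner H x e))"
    by (rule sum.mono_neutral_cong_right) (use G(1) in auto)
  finally have "complex_of_real ((hnorm H z)\<^sup>2) = complex_of_real (\<Sum>e\<in>G - F. (cmod (hinner H x e))\<^sup>2)"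
    by (simp add: hinner_self z complex_norm_square[symmetric])
  then show ?thesis unfolding z_def of_real_eq_iff .
qed

text \<open>Let \<alpha> be the supremum of the finite sums of squared coefficients. Increasing
  finite sets with sums tending to \<alpha> give Cauchy Fourier sums with a limit l. Each e in E is
  orthogonal to x - l: as long as e is not in \<open>G n\<close>, its squared coefficient is at most
  the gap to \<alpha>, since adding e cannot exceed \<alpha>. Maximality then gives x = l.\<close>

lemma fourier_sum_approx:
  assumes max: "\<And>y. y \<in> carrier H \<Longrightarrow> (\<And>e. e \<in> E \<Longrightarrow> hinner H y e = 0) \<Longrightarrow> y = \<zero>"
    and x: "x \<in> carrier H" and r: "0 < r"
  shows "\<exists>F. finite F \<and> F \<subseteq> E \<and> hnorm H (x \<ominus> fourier_sum H F x) < r"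
proof -
  define S where "S F = (\<Sum>e\<in>F. (cmod (hinner H x e))\<^sup>2)" for F
  define I where "I = S ` {F. finite F \<and> F \<subseteq> E}"
  define \<alpha> where "\<alpha> = Sup I"
  have Sbdd: "bdd_above I"
    using hilbert_bessel[OF _ _ x] by (auto simp: I_def S_def bdd_above_def)
  have Ine: "I \<noteq> {}" by (auto simp: I_def)
  have S\<alpha>: "S F \<le> \<alpha>" if "finite F" "F \<subseteq> E" for F
    unfolding \<alpha>_def by (rule cSup_upper[OF _ Sbdd]) (use that in \<open>auto simp: I_def\<close>)
  have Smono: "S F \<le> S G" if "finite G" "F \<subseteq> G" for F G
    unfolding S_def by (rule sum_mono2) (use that in auto)
  have "\<exists>F. finite F \<and> F \<subseteq> E \<and> \<alpha> - 1 / real (Suc n) < S F" for n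
  proof -
    obtain i where "i \<in> I" "\<alpha> - 1 / real (Suc n) < i"
      using less_cSupD[OF Ine, of "\<alpha> - 1 / real (Suc n)"] by (auto simp: \<alpha>_def[symmetric])
    then show ?thesis by (auto simp: I_def)
  qed
  then obtain F where F: "\<And>n. finite (F n)" "\<And>n. F n \<subseteq> E" "\<And>n. \<alpha> - 1 / real (Suc n) < S (F n)" by metis
  \<comment> \<open>Unions make the sets increasing, so that differences of Fourier sums are
    controlled by sums over \<open>G m - G n\<close>.\<close>
  define G where "G n = (\<Union>i\<le>n. F i)" for n
  have G: "finite (G n)" "G n \<subseteq> E" for n using F by (auto simp: G_def)
  have Gmono: "G m \<subseteq> G n" if "m \<le> n" for m n using that by (force simp: G_def)
  have SG: "\<alpha> - 1 / real (Suc n) < S (G n)" for n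
  proof -
    have "S (F n) \<le> S (G n)" by (rule Smono[OF G(1)]) (auto simp: G_def)
    then show ?thesis using F(3)[of n] by linarith
  qed
  let ?s = "\<lambda>n. fourier_sum H (G n) x"
  have GH: "G n \<subseteq> carrier H" for n using G(2) orthonormal_setD(1) by blast
  have s: "?s n \<in> carrier H" for n by (rule fourier_sum_carrier[OF GH])
  have d: "(hnorm H (?s m \<ominus> ?s n))\<^sup>2 \<le> 1 / real (Suc n)" if "n \<le> m" for m n
  proof -
    have "(hnorm H (?s m \<ominus> ?s n))\<^sup>2 = S (G m - G n)"
      unfolding S_def by (rule hnorm_fourier_sum_diff[OF G Gmono[OF that] x])
    also have "\<dots> = S (G m) - S (G n)"
      unfolding S_def by (rule sum_diff[OF G(1) Gmono[OF that]])
    also have "\<dots> \<le> 1 / real (Suc n)" using S\<alpha>[OF G, of m] SG[of n] by simp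
    finally show ?thesis .
  qed
  have lim0: "(\<lambda>n. 1 / real (Suc n)) \<longlonglongrightarrow> 0" using LIMSEQ_inverse_real_of_nat by (simp add: inverse_eq_divide)
  have "\<exists>l\<in>carrier H. (\<lambda>n. hnorm H (?s n \<ominus> l)) \<longlonglongrightarrow> 0"
  proof (rule complete)
    show "range ?s \<subseteq> carrier H" using s by auto
    show "\<forall>e>0. \<exists>N. \<forall>m\<ge>N. \<forall>n\<ge>N. hnorm H (?s m \<ominus> ?s n) < e"
    proof (intro allI impI)
      fix e :: real assume "0 < e"
      then obtain N where N: "\<And>n. N \<le> n \<Longrightarrow> 1 / real (Suc n) < e\<^sup>2"
        using LIMSEQ_D[OF lim0, of "e\<^sup>2"] by auto
      have less: "hnorm H (?s m \<ominus> ?s n) < e" if "n \<le> m" "N \<le> n" for m n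
      proof -
        have "(hnorm H (?s m \<ominus> ?s n))\<^sup>2 < e\<^sup>2" using d[OF that(1)] N[OF that(2)] by linarith
        then show ?thesis using \<open>0 < e\<close> by (simp add: power2_less_imp_less)
      qed
      show "\<exists>N. \<forall>m\<ge>N. \<forall>n\<ge>N. hnorm H (?s m \<ominus> ?s n) < e"
        using less hnorm_diff_commute[OF s s] by (intro exI[of _ N]) (metis nat_le_linear)
    qed
  qed
  then obtain l where l: "l \<in> carrier H" "(\<lambda>n. hnorm H (?s n \<ominus> l)) \<longlonglongrightarrow> 0" by blast
  have "hinner H (x \<ominus> l) e = 0" if e: "e \<in> E" for e
  proof -
    have eH: "e \<in> carrier H" by (rule orthonormal_setD(1)[OF e])
    have "cmod (hinner H (x \<ominus> l) e) \<le> sqrt (1 / real (Suc n)) + hnorm H (?s n \<ominus> l)" for n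
    proof -
      have "hinner H (x \<ominus> l) e = (hinner H x e - hinner H (?s n) e) + hinner H (?s n \<ominus> l) e"
        by (simp add: hinner_diff_left x s l(1) eH)
      then have "cmod (hinner H (x \<ominus> l) e)
          \<le> cmod (hinner H x e - hinner H (?s n) e) + cmod (hinner H (?s n \<ominus> l) e)"
        using norm_triangle_ineq by metis
      moreover have "cmod (hinner H (?s n \<ominus> l) e) \<le> hnorm H (?s n \<ominus> l)"
      proof (rule power2_le_imp_le)
        show "(cmod (hinner H (?s n \<ominus> l) e))\<^sup>2 \<le> (hnorm H (?s n \<ominus> l))\<^sup>2"
          using hilbert_bessel[of "{e}" "?s n \<ominus> l"] e carrier_diff[OF s l(1)] by simp
      qed (rule hnorm_nonneg[OF carrier_diff[OF s l(1)]])
      moreover have "cmod (hinner H x e - hinner H (?s n) e) \<le> sqrt (1 / real (Suc n))"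
      proof (cases "e \<in> G n")
        case True
        then show ?thesis using e by (simp add: hinner_fourier_sum(2)[OF G x])
      next
        case False
        have "(cmod (hinner H x e))\<^sup>2 + S (G n) = S (insert e (G n))"
          using False G(1) by (simp add: S_def)
        also have "\<dots> \<le> \<alpha>" by (rule S\<alpha>) (use G e in auto)
        finally have "(cmod (hinner H x e))\<^sup>2 \<le> 1 / real (Suc n)" using SG[of n] by linarith
        then have "cmod (hinner H x e) \<le> sqrt (1 / real (Suc n))" by (rule real_le_rsqrt)
        then show ?thesis using False e by (simp add: hinner_fourier_sum(2)[OF G x])
      qed
      ultimately show ?thesis by linarith
    qed
    moreover have "(\<lambda>n. sqrt (1 / real (Suc n)) + hnorm H (?s n \<ominus> l)) \<longlonglongrightarrow> sqrt 0 + 0"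
      by (intro tendsto_add tendsto_real_sqrt lim0 l(2))
    ultimately have "cmod (hinner H (x \<ominus> l) e) \<le> 0"
      using LIMSEQ_le_const[of _ "sqrt 0 + 0" "cmod (hinner H (x \<ominus> l) e)"] by auto
    then show ?thesis by simp
  qed
  then have "x \<ominus> l = \<zero>" by (intro max carrier_diff x l(1))
  moreover have "x = (x \<ominus> l) \<oplus> l" using x l(1) by (simp add: M.minus_eq M.a_assoc M.l_neg)
  ultimately have "x = l" using l(1) by (metis M.l_zero)
  then obtain n where "hnorm H (?s n \<ominus> x) < r"
    using LIMSEQ_D[OF l(2) r] hnorm_nonneg[OF carrier_diff[OF s l(1)]] by auto
  then show ?thesis using hnorm_diff_commute[OF s x] G by metis
qed

end

text \<open>Zorn's lemma gives a maximal orthonormal set: a nonzero vector orthogonal to it could be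
  normalized and added.\<close>

lemma exists_fourier_basis:
  "\<exists>E. orthonormal_set H E \<and>
     (\<forall>x\<in>carrier H. \<forall>r>0. \<exists>F. finite F \<and> F \<subseteq> E \<and> hnorm H (x \<ominus> fourier_sum H F x) < r)"
proof -
  have "\<exists>M\<in>{E. orthonormal_set H E}. \<forall>X\<in>{E. orthonormal_set H E}. M \<subseteq> X \<longrightarrow> X = M"
  proof (rule subset_Zorn')
    fix C assume C: "subset.chain {E. orthonormal_set H E} C"
    have "hinner H e f = (if e = f then 1 else 0)" if ef: "e \<in> \<Union>C" "f \<in> \<Union>C" for e f
    proof -
      obtain X Y where "X \<in> C" "e \<in> X" "Y \<in> C" "f \<in> Y" using ef by blast
      moreover have "X \<subseteq> Y \<or> Y \<subseteq> X" using C calculation by (auto simp: subset_chain_def)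
      ultimately obtain Z where "Z \<in> C" "e \<in> Z" "f \<in> Z" by blast
      then show ?thesis using C unfolding subset_chain_def orthonormal_set_def by blast
    qed
    moreover have "\<Union>C \<subseteq> carrier H" using C unfolding subset_chain_def orthonormal_set_def by blast
    ultimately show "\<Union>C \<in> {E. orthonormal_set H E}" unfolding orthonormal_set_def by blast
  qed
  then obtain E where E: "orthonormal_set H E" and max: "\<And>X. orthonormal_set H X \<Longrightarrow> E \<subseteq> X \<Longrightarrow> X = E" by blast
  have "y = \<zero>" if y: "y \<in> carrier H" and orth: "\<And>e. e \<in> E \<Longrightarrow> hinner H y e = 0" for y
  proof (rule ccontr)
    assume "y \<noteq> \<zero>"
    then have ny: "hnorm H y \<noteq> 0" using hinner_eq_zero[OF y] hinner_self[OF y] by auto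
    define e where "e = complex_of_real (1 / hnorm H y) \<odot> y"
    have e: "e \<in> carrier H" by (simp add: e_def carrier_smult y)
    have "hinner H e e = complex_of_real (1 / hnorm H y) * (cnj (complex_of_real (1 / hnorm H y)) * hinner H y y)"
      by (simp only: e_def hinner_smult_left hinner_smult_right y carrier_smult mult_ac)
    then have ee: "hinner H e e = 1" using ny by (simp add: hinner_self y power2_eq_square)
    have ef: "hinner H e f = 0" "hinner H f e = 0" if "f \<in> E" for f
    proof -
      have f: "f \<in> carrier H" using E that by (auto simp: orthonormal_set_def)
      show "hinner H e f = 0" using orth[OF that] f y by (simp add: e_def hinner_smult_left)
      then show "hinner H f e = 0" using hinner_commute[OF f e] by simp
    qed
    have "orthonormal_set H (insert e E)"
      using E e ee ef unfolding orthonormal_set_def by auto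
    then have "e \<in> E" using max[of "insert e E"] by blast
    then show False using ef(1)[of e] ee by simp
  qed
  then show ?thesis using fourier_sum_approx[OF E] E by blast
qed

lemma exists_orthonormal_basis: "\<exists>E. orthonormal_basis H E"
proof -
  obtain E where E: "orthonormal_set H E"
    "\<And>x r. x \<in> carrier H \<Longrightarrow> 0 < r \<Longrightarrow> \<exists>F. finite F \<and> F \<subseteq> E \<and> hnorm H (x \<ominus> fourier_sum H F x) < r"
    using exists_fourier_basis by metis
  have "orthonormal_basis H E"
    unfolding orthonormal_basis_def total_in_def
  proof (intro conjI ballI allI impI)
    fix x and r :: real assume "x \<in> carrier H" "0 < r"
    from E(2)[OF this] show "\<exists>F c. finite F \<and> F \<subseteq> E \<and> hnorm H (x \<ominus> (\<Oplus>v\<in>F. c v \<odot> v)) < r"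
      unfolding fourier_sum_def by blast
  qed (use E(1) in \<open>auto simp: orthonormal_set_def\<close>)
  then show ?thesis ..
qed

end

section \<open>Embedding into square summable families\<close>

text \<open>The coordinates with respect to an orthonormal basis map every Hilbert space over the element
  type \<open>'a\<close> onto a closed subspace of \<open>'a ell2\<close>.  An operator is transferred by letting it vanish on the
  orthogonal complement.\<close>

definition hemb :: "'a hilb \<Rightarrow> 'a \<Rightarrow> 'a ell2" where
  "hemb H x = (let E = SOME E. orthonormal_set H E \<and>
       (\<forall>x\<in>carrier H. \<forall>r>0. \<exists>F. finite F \<and> F \<subseteq> E \<and> hnorm H (x \<ominus>\<^bsub>H\<^esub> fourier_sum H F x) < r)
     in Abs_ell2 (\<lambda>e. if e \<in> E then hinner H x e else 0))"

definition hspace :: "'a hilb \<Rightarrow> 'a ell2 set" where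
  "hspace H = hemb H ` carrier H"

text \<open>The adjoint of the isometry \<open>hemb H\<close>, see \<open>cinner_hemb_left\<close>;
  projecting first makes it total.\<close>

definition hinv :: "'a hilb \<Rightarrow> 'a ell2 \<Rightarrow> 'a" where
  "hinv H z = inv_into (carrier H) (hemb H) (cproj (hspace H) z)"

definition hlift :: "'a hilb \<Rightarrow> 'a hilb \<Rightarrow> ('a \<Rightarrow> 'a) \<Rightarrow> 'a ell2 \<Rightarrow> 'a ell2" where
  "hlift H K A z = hemb K (A (hinv H z))"

text \<open>Compression of B to the carriers. It undoes \<open>hlift\<close> from the other side
  only for B that maps \<open>hspace H\<close> into \<open>hspace K\<close> and vanishes on the
  complement of \<open>hspace H\<close>.\<close>

definition hdrop :: "'a hilb \<Rightarrow> 'a hilb \<Rightarrow> ('a ell2 \<Rightarrow> 'a ell2) \<Rightarrow> 'a \<Rightarrow> 'a" where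
  "hdrop H K B = (\<lambda>x\<in>carrier H. hinv K (B (hemb H x)))"

context hilbert_space
begin

text \<open>Bessel makes the coordinates square summable, with norm at most that of x. Approximation
  by Fourier sums gives the reverse inequality up to any r > 0.\<close>

lemma
  shows hemb_add: "x \<in> carrier H \<Longrightarrow> y \<in> carrier H \<Longrightarrow> hemb H (x \<oplus> y) = hemb H x + hemb H y"
    and hemb_smult: "x \<in> carrier H \<Longrightarrow> hemb H (a \<odot> x) = a *\<^sub>C hemb H x"
    and norm_hemb: "x \<in> carrier H \<Longrightarrow> norm (hemb H x) = hnorm H x"
proof -
  define E where "E = (SOME E. orthonormal_set H E \<and>
     (\<forall>x\<in>carrier H. \<forall>r>0. \<exists>F. finite F \<and> F \<subseteq> E \<and> hnorm H (x \<ominus> fourier_sum H F x) < r))"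
  have "orthonormal_set H E \<and>
     (\<forall>x\<in>carrier H. \<forall>r>0. \<exists>F. finite F \<and> F \<subseteq> E \<and> hnorm H (x \<ominus> fourier_sum H F x) < r)"
    unfolding E_def by (rule someI_ex[OF exists_fourier_basis])
  then have E: "orthonormal_set H E" and approx: "\<And>x r. x \<in> carrier H \<Longrightarrow> 0 < r \<Longrightarrow>
      \<exists>F. finite F \<and> F \<subseteq> E \<and> hnorm H (x \<ominus> fourier_sum H F x) < r" by auto
  have EH: "e \<in> carrier H" if "e \<in> E" for e using E that by (auto simp: orthonormal_set_def)
  define c where "c x e = (if e \<in> E then hinner H x e else 0)" for x e
  have hc: "hemb H x = Abs_ell2 (c x)" for x
    by (simp add: hemb_def E_def[symmetric] c_def[abs_def])
  have sub: "(\<Sum>e\<in>F. (cmod (c x e))\<^sup>2) = (\<Sum>e\<in>F \<inter> E. (cmod (hinner H x e))\<^sup>2)" if "finite F" for F x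
    using that by (intro sum.mono_neutral_cong_right) (auto simp: c_def)
  have cb: "(\<Sum>e\<in>F. (cmod (c x e))\<^sup>2) \<le> (hnorm H x)\<^sup>2" if "finite F" "x \<in> carrier H" for F x
    unfolding sub[OF that(1)] by (rule hilbert_bessel[OF E]) (use that in auto)
  have rep: "Rep_ell2 (hemb H x) = c x" if "x \<in> carrier H" for x
    unfolding hc using square_summable_bound[OF cb[OF _ that]] by (simp add: Abs_ell2_inverse)
  show "hemb H (x \<oplus> y) = hemb H x + hemb H y" if xy: "x \<in> carrier H" "y \<in> carrier H" for x y
  proof -
    have "c (x \<oplus> y) = (\<lambda>e. c x e + c y e)" using xy EH by (auto simp: c_def hinner_add_left)
    then show ?thesis
      using xy by (simp add: Rep_ell2_inject[symmetric] rep plus_ell2.rep_eq carrier_add)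
  qed
  show "hemb H (a \<odot> x) = a *\<^sub>C hemb H x" if x: "x \<in> carrier H" for x a
  proof -
    have "c (a \<odot> x) = (\<lambda>e. a * c x e)" using x EH by (auto simp: c_def hinner_smult_left)
    then show ?thesis
      using x by (simp add: Rep_ell2_inject[symmetric] rep scaleC_ell2_def ell2_scale.rep_eq carrier_smult)
  qed
  show "norm (hemb H x) = hnorm H x" if x: "x \<in> carrier H" for x
  proof (rule antisym)
    show "norm (hemb H x) \<le> hnorm H x"
      by (rule norm_ell2_le) (use cb x hnorm_nonneg in \<open>auto simp: rep\<close>)
    have "(hnorm H x)\<^sup>2 \<le> (norm (hemb H x))\<^sup>2 + r" if r: "0 < r" for r
    proof -
      obtain F where F: "finite F" "F \<subseteq> E" "hnorm H (x \<ominus> fourier_sum H F x) < sqrt r"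
        using approx[OF x, of "sqrt r"] r by auto
      have FH: "F \<subseteq> carrier H" using F(2) EH by auto
      have "(hnorm H (x \<ominus> fourier_sum H F x))\<^sup>2 \<le> (sqrt r)\<^sup>2"
        using F(3) hnorm_nonneg[OF carrier_diff[OF x fourier_sum_carrier[OF FH]]] by (intro power_mono) auto
      then have "(hnorm H x)\<^sup>2 - (\<Sum>e\<in>F. (cmod (hinner H x e))\<^sup>2) \<le> r"
        using r by (simp add: hnorm_diff_fourier_sum[OF E F(1,2) x])
      moreover have "(\<Sum>e\<in>F. (cmod (hinner H x e))\<^sup>2) = (\<Sum>e\<in>F. (cmod (c x e))\<^sup>2)"
        using F(2) by (intro sum.cong) (auto simp: c_def)
      moreover have "\<dots> \<le> (norm (hemb H x))\<^sup>2"
        using sum_le_norm_ell2[OF F(1), of "hemb H x"] by (simp add: rep[OF x])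
      ultimately show ?thesis by linarith
    qed
    then have "(hnorm H x)\<^sup>2 \<le> (norm (hemb H x))\<^sup>2" by (rule field_le_epsilon)
    then show "hnorm H x \<le> norm (hemb H x)" by (rule power2_le_imp_le) simp
  qed
qed

text \<open>The norm determines the inner product: real parts by expanding the norm of a sum,
  imaginary parts by replacing y with i y.\<close>

lemma cinner_hemb:
  assumes "x \<in> carrier H" "y \<in> carrier H" shows "cinner (hemb H x) (hemb H y) = hinner H x y"
proof -
  have Re: "Re (cinner (hemb H x) (hemb H y)) = Re (hinner H x y)" if x: "x \<in> carrier H" and y: "y \<in> carrier H" for x y
  proof -
    have nn: "(norm (hemb H z))\<^sup>2 = Re (hinner H z z)" if "z \<in> carrier H" for z
      using that by (simp add: norm_hemb hinner_self)
    have "(norm (hemb H x + hemb H y))\<^sup>2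
      = Re (hinner H x x) + Re (hinner H y y) + Re (hinner H x y) + Re (hinner H y x)"
      using nn[OF carrier_add[OF x y]] by (simp add: hemb_add hinner_add_left hinner_add_right carrier_add x y)
    moreover have "(norm (hemb H x + hemb H y))\<^sup>2
      = (norm (hemb H x))\<^sup>2 + (norm (hemb H y))\<^sup>2 + 2 * Re (cinner (hemb H x) (hemb H y))"
      by (simp add: power2_norm_eq_inner inner_add_left inner_add_right inner_commute Re_cinner)
    ultimately show ?thesis using hinner_commute[OF y x] by (simp add: nn x y)
  qed
  have "Re (cinner (hemb H x) (hemb H (\<i> \<odot> y))) = Re (hinner H x (\<i> \<odot> y))"
    by (rule Re) (use assms carrier_smult in auto)
  then have "Im (cinner (hemb H x) (hemb H y)) = Im (hinner H x y)"
    using assms by (simp add: hemb_smult cinner_scaleC_right hinner_smult_right)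
  then show ?thesis using Re[OF assms] by (simp add: complex_eq_iff)
qed

lemma hemb_diff: "x \<in> carrier H \<Longrightarrow> y \<in> carrier H \<Longrightarrow> norm (hemb H x - hemb H y) = hnorm H (x \<ominus> y)"
proof -
  assume xy: "x \<in> carrier H" "y \<in> carrier H"
  have "complex_of_real ((norm (hemb H x - hemb H y))\<^sup>2) = complex_of_real ((hnorm H (x \<ominus> y))\<^sup>2)"
    using xy
    by (simp only: cinner_self[symmetric] hinner_self[symmetric] carrier_diff)
      (simp add: cinner.diff_left cinner.diff_right hinner_diff_left hinner_diff_right carrier_diff cinner_hemb)
  then have "(norm (hemb H x - hemb H y))\<^sup>2 = (hnorm H (x \<ominus> y))\<^sup>2" by (simp only: of_real_eq_iff)
  then show ?thesis using hnorm_nonneg[OF carrier_diff[OF xy]] by (simp add: power2_eq_iff_nonneg)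
qed

lemma inj_hemb: "inj_on (hemb H) (carrier H)"
proof (rule inj_onI)
  fix x y assume xy: "x \<in> carrier H" "y \<in> carrier H" "hemb H x = hemb H y"
  show "x = y" by (rule hinner_ext[OF xy(1,2)]) (use xy in \<open>metis cinner_hemb\<close>)
qed

lemma csubspace_hspace: "csubspace (hspace H)"
  unfolding csubspace_def hspace_def
proof (intro conjI ballI allI)
  have "hemb H (0 \<odot> \<zero>) = 0" by (simp add: hemb_smult carrier_zero)
  then show "0 \<in> hemb H ` carrier H" using carrier_zero carrier_smult by (metis imageI)
qed (auto simp: hemb_add[symmetric] hemb_smult[symmetric] carrier_add carrier_smult)

text \<open>The isometry transports completeness: a convergent sequence of images comes from a
  Cauchy sequence in the carrier.\<close>

lemma closed_hspace: "closed (hspace H)"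
  unfolding closed_sequential_limits
proof (intro allI impI, elim conjE)
  fix z l assume z: "\<forall>n. z n \<in> hspace H" and lim: "z \<longlonglongrightarrow> l"
  then have "\<forall>n. \<exists>x\<in>carrier H. z n = hemb H x" by (auto simp: hspace_def)
  then obtain s where s: "\<And>n. s n \<in> carrier H" "\<And>n. z n = hemb H (s n)" by metis
  have "\<exists>l\<in>carrier H. (\<lambda>n. hnorm H (s n \<ominus> l)) \<longlonglongrightarrow> 0"
  proof (rule complete)
    have "Cauchy z" using lim by (rule LIMSEQ_imp_Cauchy)
    then show "\<forall>e>0. \<exists>N. \<forall>m\<ge>N. \<forall>n\<ge>N. hnorm H (s m \<ominus> s n) < e"
      unfolding Cauchy_iff s(2) by (simp add: hemb_diff s(1))
  qed (use s in auto)
  then obtain x where x: "x \<in> carrier H" "(\<lambda>n. hnorm H (s n \<ominus> x)) \<longlonglongrightarrow> 0" by blast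
  then have "(\<lambda>n. norm (z n - hemb H x)) \<longlonglongrightarrow> 0" by (simp add: s hemb_diff)
  then have "z \<longlonglongrightarrow> hemb H x" by (simp add: tendsto_norm_zero_iff LIM_zero_iff)
  then have "l = hemb H x" using lim LIMSEQ_unique by blast
  then show "l \<in> hspace H" using x(1) by (simp add: hspace_def)
qed

lemmas hspace = closed_hspace csubspace_hspace

lemma hemb_in [simp]: "x \<in> carrier H \<Longrightarrow> hemb H x \<in> hspace H"
  by (simp add: hspace_def)

lemma hinv_carrier [simp]: "hinv H z \<in> carrier H"
  and hemb_hinv: "hemb H (hinv H z) = cproj (hspace H) z"
  using cproj_in[OF hspace, of z] unfolding hinv_def hspace_def
  by (auto intro: inv_into_into f_inv_into_f)

lemma hinv_hemb [simp]: "x \<in> carrier H \<Longrightarrow> hinv H (hemb H x) = x"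
  by (simp add: hinv_def cproj_ident[OF hspace] inv_into_f_f[OF inj_hemb])

lemma cinner_hemb_left: "x \<in> carrier H \<Longrightarrow> cinner (hemb H x) z = hinner H x (hinv H z)"
  by (metis cinner_hemb hinv_carrier hemb_hinv cinner_cproj_right[OF hspace] hemb_in)

lemma hinv_add: "hinv H (x + y) = hinv H x \<oplus> hinv H y"
  by (rule inj_onD[OF inj_hemb])
     (simp_all add: hemb_hinv hemb_add carrier_add bounded_clinear_add[OF bounded_clinear_cproj[OF hspace]])

lemma hinv_smult: "hinv H (a *\<^sub>C x) = a \<odot> hinv H x"
  by (rule inj_onD[OF inj_hemb])
     (simp_all add: hemb_hinv hemb_smult carrier_smult bounded_clinear_scaleC[OF bounded_clinear_cproj[OF hspace]])

lemma hinv_zero_iff: "hinv H z = \<zero> \<longleftrightarrow> (\<forall>v\<in>hspace H. cinner z v = 0)"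
proof
  assume "hinv H z = \<zero>"
  then have "cproj (hspace H) z = hemb H \<zero>" by (simp add: hemb_hinv[symmetric])
  moreover have "hemb H \<zero> = 0"
    using norm_hemb[OF carrier_zero] by (simp add: hnorm_def carrier_zero)
  ultimately show "\<forall>v\<in>hspace H. cinner z v = 0" using cinner_cproj_left[OF hspace, of _ z] by auto
next
  assume "\<forall>v\<in>hspace H. cinner z v = 0"
  then have "cproj (hspace H) z = 0" by (intro cproj_zero[OF hspace]) auto
  moreover have "hemb H \<zero> = 0"
    using norm_hemb[OF carrier_zero] by (simp add: hnorm_def carrier_zero)
  ultimately show "hinv H z = \<zero>"
    by (intro inj_onD[OF inj_hemb]) (auto simp: hemb_hinv carrier_zero)
qed

end


subsection \<open>Transfer of operators\<close>

context
  fixes H K :: "'a hilb"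
  assumes H: "hilbert_space H" and K: "hilbert_space K"
begin

interpretation H: hilbert_space H by (rule H)
interpretation K: hilbert_space K by (rule K)

lemma bounded_ops_carrier: "A \<in> bounded_ops H K \<Longrightarrow> x \<in> carrier H \<Longrightarrow> A x \<in> carrier K"
  by (auto simp: bounded_ops_def PiE_def)

lemma bounded_ops_ext:
  "A \<in> bounded_ops H K \<Longrightarrow> A' \<in> bounded_ops H K \<Longrightarrow> (\<And>x. x \<in> carrier H \<Longrightarrow> A x = A' x) \<Longrightarrow> A = A'"
  by (rule extensionalityI[of _ "carrier H"]) (auto simp: bounded_ops_def PiE_def)

lemma bounded_clinear_hlift:
  assumes A: "A \<in> bounded_ops H K" shows "bounded_clinear (hlift H K A)"
proof -
  obtain C where C: "\<And>x. x \<in> carrier H \<Longrightarrow> hnorm K (A x) \<le> C * hnorm H x"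
    and add: "\<And>x y. x \<in> carrier H \<Longrightarrow> y \<in> carrier H \<Longrightarrow> A (x \<oplus>\<^bsub>H\<^esub> y) = A x \<oplus>\<^bsub>K\<^esub> A y"
    and sc: "\<And>a x. x \<in> carrier H \<Longrightarrow> A (a \<odot>\<^bsub>H\<^esub> x) = a \<odot>\<^bsub>K\<^esub> A x"
    using A unfolding bounded_ops_def by blast
  note AK = bounded_ops_carrier[OF A]
  show ?thesis
  proof (rule bounded_clinear_intro[of _ "\<bar>C\<bar>"])
    show "hlift H K A (x + y) = hlift H K A x + hlift H K A y" for x y
      by (simp add: hlift_def H.hinv_add add K.hemb_add AK)
    show "hlift H K A (a *\<^sub>C x) = a *\<^sub>C hlift H K A x" for a x
      by (simp add: hlift_def H.hinv_smult sc K.hemb_smult AK)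
    show "norm (hlift H K A z) \<le> \<bar>C\<bar> * norm z" for z
    proof -
      have "norm (hlift H K A z) \<le> C * norm (cproj (hspace H) z)"
        using C[of "hinv H z"] by (simp add: hlift_def K.norm_hemb AK H.norm_hemb[symmetric] H.hemb_hinv)
      also have "\<dots> \<le> \<bar>C\<bar> * norm (cproj (hspace H) z)" by (simp add: mult_right_mono)
      also have "\<dots> \<le> \<bar>C\<bar> * norm z" by (intro mult_left_mono norm_cproj_le H.hspace) simp
      finally show ?thesis .
    qed
  qed
qed

lemma hlift_in: "A \<in> bounded_ops H K \<Longrightarrow> hlift H K A z \<in> hspace K"
  by (simp add: hlift_def bounded_ops_carrier)

lemma hlift_hemb: "x \<in> carrier H \<Longrightarrow> hlift H K A (hemb H x) = hemb K (A x)"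
  by (simp add: hlift_def)

lemma hlift_cproj: "hlift H K A (cproj (hspace H) z) = hlift H K A z"
  by (simp add: hlift_def H.hemb_hinv[symmetric])

lemma hlift_orthogonal: "A \<in> bounded_ops H K \<Longrightarrow> (\<And>v. v \<in> hspace H \<Longrightarrow> cinner z v = 0) \<Longrightarrow> hlift H K A z = 0"
  using hlift_cproj[of A z] by (simp add: cproj_zero[OF H.hspace] bounded_clinear_zero[OF bounded_clinear_hlift])

lemma cinner_hlift:
  "A \<in> bounded_ops H K \<Longrightarrow> cinner (hlift H K A x) y = hinner K (A (hinv H x)) (hinv K y)"
  by (simp add: hlift_def K.cinner_hemb_left bounded_ops_carrier)

text \<open>Equations between operators, in particular the uniqueness parts of definite
  descriptions, are checked after transfer by means of this.\<close>

lemma hlift_inject: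
  assumes "A \<in> bounded_ops H K" "A' \<in> bounded_ops H K" "hlift H K A = hlift H K A'" shows "A = A'"
proof (rule bounded_ops_ext[OF assms(1,2)])
  fix x assume x: "x \<in> carrier H"
  then have "hemb K (A x) = hemb K (A' x)" by (metis assms(3) hlift_hemb)
  then show "A x = A' x"
    using x assms(1,2) by (intro inj_onD[OF K.inj_hemb]) (auto intro: bounded_ops_carrier)
qed

text \<open>The projection remains in the second claim because \<open>hlift\<close> always vanishes
  on the complement of \<open>hspace H\<close>, while B may not.\<close>

lemma
  assumes B: "bounded_clinear B" and BK: "\<And>x. x \<in> hspace H \<Longrightarrow> B x \<in> hspace K"
  shows hdrop_in: "hdrop H K B \<in> bounded_ops H K"
    and hlift_hdrop: "hlift H K (hdrop H K B) z = B (cproj (hspace H) z)"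
proof -
  obtain C where C: "\<And>x. norm (B x) \<le> C * norm x" using bounded_clinear_bound[OF B] by metis
  have e: "hemb K (hinv K (B (hemb H x))) = B (hemb H x)" if "x \<in> carrier H" for x
    using that by (simp add: K.hemb_hinv cproj_ident[OF K.hspace] BK)
  have "hnorm K (hinv K (B (hemb H x))) \<le> C * hnorm H x" if "x \<in> carrier H" for x
    using C[of "hemb H x"] that by (simp add: K.norm_hemb[symmetric] e H.norm_hemb)
  then show hd: "hdrop H K B \<in> bounded_ops H K"
    unfolding bounded_ops_def hdrop_def
    by (auto simp: H.hemb_add H.hemb_smult bounded_clinear_add[OF B] bounded_clinear_scaleC[OF B]
        K.hinv_add K.hinv_smult H.carrier_add H.carrier_smult)
  show "hlift H K (hdrop H K B) z = B (cproj (hspace H) z)"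
    using e[OF H.hinv_carrier, of z] by (simp add: hlift_def hdrop_def H.hemb_hinv)
qed

end

lemma
  assumes H: "hilbert_space H" and K: "hilbert_space K" and L: "hilbert_space L"
    and A: "A \<in> bounded_ops H K" and B: "B \<in> bounded_ops K L"
  shows compose_in_bounded_ops: "compose (carrier H) B A \<in> bounded_ops H L"
    and hlift_compose: "hlift H L (compose (carrier H) B A) z = hlift K L B (hlift H K A z)"
proof -
  note AK = bounded_ops_carrier[OF H K A] and BL = bounded_ops_carrier[OF K L B]
  interpret H: hilbert_space H by (rule H)
  interpret K: hilbert_space K by (rule K)
  interpret L: hilbert_space L by (rule L)
  have "compose (carrier H) B A = hdrop H L (\<lambda>z. hlift K L B (hlift H K A z))"
    unfolding compose_def hdrop_def
    by (rule restrict_ext) (simp add: hlift_hemb[OF H K] hlift_hemb[OF K L] AK BL)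
  also have "\<dots> \<in> bounded_ops H L"
    by (rule hdrop_in[OF H L bounded_clinear_compose[OF bounded_clinear_hlift[OF K L B] bounded_clinear_hlift[OF H K A]]
          hlift_in[OF K L B]])
  finally show "compose (carrier H) B A \<in> bounded_ops H L" .
  show "hlift H L (compose (carrier H) B A) z = hlift K L B (hlift H K A z)"
    by (simp add: hlift_def compose_def AK)
qed

subsection \<open>Adjoints, absolute values and traces\<close>

context
  fixes H K :: "'a hilb"
  assumes H: "hilbert_space H" and K: "hilbert_space K"
begin

interpretation H: hilbert_space H by (rule H)
interpretation K: hilbert_space K by (rule K)

text \<open>Dropping the adjoint of the lifted operator solves the definite description. It can be
  taken back to the carriers because the lifted operator vanishes on the complement of
  \<open>hspace H\<close> and maps into \<open>hspace K\<close>.\<close>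

lemma
  assumes A: "A \<in> bounded_ops H K"
  shows op_adjoint_in: "op_adjoint H K A \<in> bounded_ops K H"
    and hinner_op_adjoint: "x \<in> carrier H \<Longrightarrow> y \<in> carrier K \<Longrightarrow> hinner K (A x) y = hinner H x (op_adjoint H K A y)"
    and hlift_op_adjoint: "hlift K H (op_adjoint H K A) = cadj (hlift H K A)"
proof -
  let ?T = "hlift H K A"
  define B where "B = hdrop K H (cadj ?T)"
  note bT = bounded_clinear_hlift[OF H K A]
  have adj_in: "cadj ?T y \<in> hspace H" for y
    unfolding in_closed_subspace_iff[OF H.hspace]
    by (auto simp: cinner_cadj_left[OF bT] hlift_orthogonal[OF H K A])
  have B: "B \<in> bounded_ops K H"
    unfolding B_def by (rule hdrop_in[OF K H bounded_clinear_cadj[OF bT] adj_in])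
  have Badj: "hinner K (A x) y = hinner H x (B y)" if x: "x \<in> carrier H" and y: "y \<in> carrier K" for x y
  proof -
    have "hinner K (A x) y = cinner (?T (hemb H x)) (hemb K y)"
      using x y by (simp add: hlift_hemb[OF H K] K.cinner_hemb bounded_ops_carrier[OF H K A])
    also have "\<dots> = cinner (hemb H x) (cadj ?T (hemb K y))" by (simp add: cinner_cadj_right[OF bT])
    also have "\<dots> = hinner H x (hinv H (cadj ?T (hemb K y)))" by (rule H.cinner_hemb_left[OF x])
    finally show ?thesis using y by (simp add: B_def hdrop_def)
  qed
  have eq: "op_adjoint H K A = B"
    unfolding op_adjoint_def
  proof (rule the_equality)
    fix B' assume B': "B' \<in> bounded_ops K H \<and>
      (\<forall>x\<in>carrier H. \<forall>y\<in>carrier K. hinner K (A x) y = hinner H x (B' y))"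
    show "B' = B"
    proof (rule bounded_ops_ext[OF K H _ B])
      fix y assume y: "y \<in> carrier K"
      show "B' y = B y"
      proof (rule H.hinner_ext)
        show c: "B' y \<in> carrier H" "B y \<in> carrier H"
          using B' B y by (auto intro: bounded_ops_carrier[OF K H])
        show "hinner H (B' y) z = hinner H (B y) z" if z: "z \<in> carrier H" for z
          using B' Badj[OF z y] y z H.hinner_commute[OF c(1) z] H.hinner_commute[OF c(2) z] by metis
      qed
    qed (use B' in blast)
  qed (use B Badj in blast)
  show "op_adjoint H K A \<in> bounded_ops K H"
    and "x \<in> carrier H \<Longrightarrow> y \<in> carrier K \<Longrightarrow> hinner K (A x) y = hinner H x (op_adjoint H K A y)"
    unfolding eq by (rule B, rule Badj)
  show "hlift K H (op_adjoint H K A) = cadj ?T"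
  proof
    fix z
    have "cadj ?T (z - cproj (hspace K) z) = 0"
    proof (rule cinner_ext)
      fix x
      have "cinner (z - cproj (hspace K) z) (?T x) = 0" by (rule cproj_orth[OF K.hspace hlift_in[OF H K A]])
      then show "cinner (cadj ?T (z - cproj (hspace K) z)) x = cinner 0 x" by (simp add: cinner_cadj_left[OF bT])
    qed
    then show "hlift K H (op_adjoint H K A) z = cadj ?T z"
      unfolding eq B_def hlift_hdrop[OF K H bounded_clinear_cadj[OF bT] adj_in]
      by (simp add: bounded_clinear_diff[OF bounded_clinear_cadj[OF bT]])
  qed
qed

text \<open>The lifted absolute value vanishes wherever the lifted operator does, since their norms
  agree; self-adjointness then puts its range into \<open>hspace H\<close>. Uniqueness is that of
  positive roots.\<close>

lemma
  assumes A: "A \<in> bounded_ops H K"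
  shows op_abs_in: "op_abs H K A \<in> bounded_ops H H"
    and hlift_op_abs: "hlift H H (op_abs H K A) = cabs (hlift H K A)"
proof -
  let ?T = "hlift H K A" and ?R = "cabs (hlift H K A)"
  note bT = bounded_clinear_hlift[OF H K A]
  note R = positive_cabs[OF bT]
  have bR: "bounded_clinear ?R" using R by (simp add: positive_clinear_def)
  have R0: "?R z = 0" if "\<And>v. v \<in> hspace H \<Longrightarrow> cinner z v = 0" for z
    using norm_cabs[OF bT, of z] hlift_orthogonal[OF H K A that] by simp
  have R_in: "?R x \<in> hspace H" for x
    unfolding in_closed_subspace_iff[OF H.hspace]
    by (auto simp: positive_clinear_selfadjoint[OF R] R0)
  define Q where "Q = hdrop H H ?R"
  have Q: "Q \<in> bounded_ops H H" unfolding Q_def by (rule hdrop_in[OF H H bR R_in])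
  have Qlift: "hlift H H Q = ?R"
  proof
    fix z
    have "?R (z - cproj (hspace H) z) = 0" by (rule R0) (rule cproj_orth[OF H.hspace])
    then show "hlift H H Q z = ?R z"
      unfolding Q_def hlift_hdrop[OF H H bR R_in] by (simp add: bounded_clinear_diff[OF bR])
  qed
  have adjA: "compose (carrier H) (op_adjoint H K A) A \<in> bounded_ops H H"
    by (rule compose_in_bounded_ops[OF H K H A op_adjoint_in[OF A]])
  have adjA_lift: "hlift H H (compose (carrier H) (op_adjoint H K A) A) z = cadj ?T (?T z)" for z
    by (simp add: hlift_compose[OF H K H A op_adjoint_in[OF A]] hlift_op_adjoint[OF A])
  have "op_abs H K A = Q"
    unfolding op_abs_def
  proof (rule the_equality)
    have "hinner H (Q x) x = cinner (?R (hemb H x)) (hemb H x)" if "x \<in> carrier H" for x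
      using that cinner_hlift[OF H H Q, of "hemb H x" "hemb H x"] by (simp add: Qlift)
    then have "positive_op H Q" using R Q by (simp add: positive_op_def positive_clinear_def)
    moreover have "compose (carrier H) Q Q = compose (carrier H) (op_adjoint H K A) A"
      by (rule hlift_inject[OF H H compose_in_bounded_ops[OF H H H Q Q] adjA])
         (simp add: fun_eq_iff hlift_compose[OF H H H Q Q] adjA_lift Qlift cabs_square[OF bT])
    ultimately show "positive_op H Q \<and> compose (carrier H) Q Q = compose (carrier H) (op_adjoint H K A) A" ..
  next
    fix Q' assume Q': "positive_op H Q' \<and> compose (carrier H) Q' Q' = compose (carrier H) (op_adjoint H K A) A"
    then have Q'b: "Q' \<in> bounded_ops H H" by (simp add: positive_op_def)
    have "hlift H H Q' = ?R"
    proof (rule cabs_unique[OF bT])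
      show "positive_clinear (hlift H H Q')"
        using Q' bounded_clinear_hlift[OF H H Q'b]
        by (simp add: positive_clinear_def positive_op_def cinner_hlift[OF H H Q'b])
      show "hlift H H Q' (hlift H H Q' z) = cadj ?T (?T z)" for z
        using Q' by (simp add: hlift_compose[OF H H H Q'b Q'b, symmetric] adjA_lift)
    qed
    then show "Q' = Q" using hlift_inject[OF H H Q'b Q] Qlift by simp
  qed
  then show "op_abs H K A \<in> bounded_ops H H" "hlift H H (op_abs H K A) = ?R"
    using Q Qlift by auto
qed

text \<open>Density of the span gives maximality: if x is orthogonal to E, its squared norm is the
  inner product of x - s with x for every combination s of elements of E, and x - s can be made
  small.\<close>

lemma onb_hemb_image:
  assumes E: "orthonormal_basis H E" shows "onb (hspace H) (hemb H ` E)"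
proof -
  have EH: "E \<subseteq> carrier H" and ef: "\<And>e f. e \<in> E \<Longrightarrow> f \<in> E \<Longrightarrow> hinner H e f = (if e = f then 1 else 0)"
    and approx: "\<And>x r. x \<in> carrier H \<Longrightarrow> 0 < r \<Longrightarrow>
      \<exists>F c. finite F \<and> F \<subseteq> E \<and> hnorm H (x \<ominus>\<^bsub>H\<^esub> (\<Oplus>\<^bsub>H\<^esub>v\<in>F. c v \<odot>\<^bsub>H\<^esub> v)) < r"
    using E by (auto simp: orthonormal_basis_def total_in_def)
  have "hemb H x = 0" if x: "x \<in> carrier H" and orth: "\<And>e. e \<in> E \<Longrightarrow> hinner H x e = 0" for x
  proof -
    have "(hnorm H x)\<^sup>2 \<le> 0 + r" if r: "0 < r" for r
    proof -
      \<comment> \<open>The tolerance is scaled so that its product with the norm of x stays below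
        r; the summand 1 avoids a division by zero.\<close>
      have "0 < r / (hnorm H x + 1)" using r H.hnorm_nonneg[OF x] by simp
      from approx[OF x this] obtain F c where F: "finite F" "F \<subseteq> E"
        "hnorm H (x \<ominus>\<^bsub>H\<^esub> (\<Oplus>\<^bsub>H\<^esub>v\<in>F. c v \<odot>\<^bsub>H\<^esub> v)) < r / (hnorm H x + 1)" by blast
      let ?s = "\<Oplus>\<^bsub>H\<^esub>v\<in>F. c v \<odot>\<^bsub>H\<^esub> v"
      have FH: "v \<in> carrier H" if "v \<in> F" for v using that F(2) EH by auto
      have sH: "?s \<in> carrier H" by (rule H.finsum_carrier) (use FH H.carrier_smult in auto)
      have "hinner H v x = 0" if "v \<in> F" for v
        using orth[of v] that F(2) H.hinner_commute[OF FH[OF that] x] by auto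
      then have "hinner H ?s x = 0"
        using F(1) FH x by (simp add: H.hinner_finsum_left H.carrier_smult H.hinner_smult_left)
      then have "hinner H (x \<ominus>\<^bsub>H\<^esub> ?s) x = complex_of_real ((hnorm H x)\<^sup>2)"
        using x sH by (simp add: H.hinner_diff_left H.hinner_self)
      then have "(hnorm H x)\<^sup>2 = cmod (cinner (hemb H (x \<ominus>\<^bsub>H\<^esub> ?s)) (hemb H x))"
        using x sH by (simp add: H.cinner_hemb H.carrier_diff norm_power)
      also have "\<dots> \<le> hnorm H (x \<ominus>\<^bsub>H\<^esub> ?s) * hnorm H x"
        using cmod_cinner_le[of "hemb H (x \<ominus>\<^bsub>H\<^esub> ?s)" "hemb H x"] x sH by (simp add: H.norm_hemb H.carrier_diff)
      also have "\<dots> \<le> r / (hnorm H x + 1) * (hnorm H x + 1)"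
        using F(3) H.hnorm_nonneg[OF x] H.hnorm_nonneg[OF H.carrier_diff[OF x sH]] by (intro mult_mono) auto
      also have "\<dots> = r" using H.hnorm_nonneg[OF x] by simp
      finally show ?thesis by simp
    qed
    then have "(hnorm H x)\<^sup>2 \<le> 0" by (rule field_le_epsilon)
    then show ?thesis using H.norm_hemb[OF x] by simp
  qed
  moreover have "orthonormal (hemb H ` E)"
    unfolding orthonormal_def using EH ef
    by (auto simp: H.cinner_hemb subset_iff inj_on_eq_iff[OF H.inj_hemb])
  ultimately show ?thesis
    unfolding onb_def hspace_def using EH by (auto simp: H.cinner_hemb subset_iff)
qed

lemma trace_class_imp_nuclear_rep:
  assumes A: "A \<in> trace_class H K" shows "\<exists>u v. nuclear_rep u v (hlift H K A)"
proof -
  have Ab: "A \<in> bounded_ops H K" using A by (simp add: trace_class_def)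
  obtain E where E: "orthonormal_basis H E" and s: "(\<lambda>e. Re (hinner H (op_abs H K A e) e)) summable_on E"
    using A by (auto simp: trace_class_def)
  have EH: "E \<subseteq> carrier H" using E by (auto simp: orthonormal_basis_def total_in_def)
  have inj: "inj_on (hemb H) E" using H.inj_hemb EH by (rule inj_on_subset)
  have "(\<lambda>e. Re (cinner (cabs (hlift H K A) e) e)) summable_on hemb H ` E"
    unfolding summable_on_reindex[OF inj] o_def
  proof (rule summable_on_cong[THEN iffD1, OF _ s])
    fix e assume "e \<in> E"
    then have e: "e \<in> carrier H" using EH by auto
    show "Re (hinner H (op_abs H K A e) e) = Re (cinner (cabs (hlift H K A) (hemb H e)) (hemb H e))"
      using cinner_hlift[OF H H op_abs_in[OF Ab], of "hemb H e" "hemb H e"] e by (simp add: hlift_op_abs[OF Ab])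
  qed
  from summable_imp_nuclear_rep[OF bounded_clinear_hlift[OF H K Ab] H.hspace onb_hemb_image[OF E]
      hlift_orthogonal[OF H K Ab] this] show ?thesis by blast
qed

lemma trace_classI:
  assumes A: "A \<in> bounded_ops H K" and tb: "trace_bound (hlift H K A) M" shows "A \<in> trace_class H K"
proof -
  obtain E where E: "orthonormal_basis H E" using H.exists_orthonormal_basis by blast
  have EH: "E \<subseteq> carrier H" using E by (auto simp: orthonormal_basis_def total_in_def)
  have inj: "inj_on (hemb H) E" using H.inj_hemb EH by (rule inj_on_subset)
  have "orthonormal (hemb H ` E)" using onb_hemb_image[OF E] by (simp add: onb_def)
  from trace_bound_imp_summable[OF bounded_clinear_hlift[OF H K A] tb this]
  have s: "(\<lambda>e. Re (cinner (cabs (hlift H K A) (hemb H e)) (hemb H e))) summable_on E"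
    by (simp add: summable_on_reindex[OF inj] o_def)
  have "(\<lambda>e. Re (hinner H (op_abs H K A e) e)) summable_on E"
  proof (rule summable_on_cong[THEN iffD1, OF _ s])
    fix e assume "e \<in> E"
    then have e: "e \<in> carrier H" using EH by auto
    show "Re (cinner (cabs (hlift H K A) (hemb H e)) (hemb H e)) = Re (hinner H (op_abs H K A e) e)"
      using cinner_hlift[OF H H op_abs_in[OF A], of "hemb H e" "hemb H e"] e by (simp add: hlift_op_abs[OF A])
  qed
  then show ?thesis unfolding trace_class_def using A E by blast
qed

text \<open>\<open>op_trace\<close> sums over an unspecified basis, so the value is required for
  every orthonormal basis of \<open>hspace H\<close>.\<close>

lemma op_trace_eqI:
  assumes A: "A \<in> bounded_ops H H"
    and t: "\<And>E. onb (hspace H) E \<Longrightarrow> ((\<lambda>e. cinner (hlift H H A e) e) has_sum t) E"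
  shows "op_trace H A = t"
proof -
  define E where "E = (SOME E. orthonormal_basis H E)"
  have E: "orthonormal_basis H E" unfolding E_def by (rule someI_ex[OF H.exists_orthonormal_basis])
  have EH: "E \<subseteq> carrier H" using E by (auto simp: orthonormal_basis_def total_in_def)
  have inj: "inj_on (hemb H) E" using H.inj_hemb EH by (rule inj_on_subset)
  have s: "((\<lambda>e. cinner (hlift H H A (hemb H e)) (hemb H e)) has_sum t) E"
    using t[OF onb_hemb_image[OF E]] by (simp add: has_sum_reindex[OF inj] o_def)
  have "((\<lambda>e. hinner H (A e) e) has_sum t) E"
  proof (rule has_sum_cong[THEN iffD1, OF _ s])
    fix e assume "e \<in> E"
    then have e: "e \<in> carrier H" using EH by auto
    then show "cinner (hlift H H A (hemb H e)) (hemb H e) = hinner H (A e) e"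
      using cinner_hlift[OF H H A, of "hemb H e" "hemb H e"] by simp
  qed
  then show ?thesis unfolding op_trace_def E_def[symmetric] by (rule infsumI)
qed

end


subsection \<open>Projection valued measures\<close>

text \<open>For every admissible decomposition the integral is the limit of the sums of v times
  \<nu> of the level set of v, taken over simple approximations of f. These sums depend on \<nu>
  alone, so the definite description has exactly one solution.\<close>

lemma complex_measure_integral_eqI:
  fixes f :: "'w \<Rightarrow> complex"
  assumes \<mu>: "\<And>n. n < 4 \<Longrightarrow> finite_measure (\<mu> n) \<and> sets (\<mu> n) = sets M \<and> integrable (\<mu> n) f"
    and \<nu>: "\<And>G. G \<in> sets M \<Longrightarrow> \<nu> G = (\<Sum>n<4. \<i> ^ n * complex_of_real (measure (\<mu> n) G))"
  shows "complex_measure_integral M \<nu> f = (\<Sum>n<4. \<i> ^ n * (\<integral>w. f w \<partial>\<mu> n))"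
  unfolding complex_measure_integral_def
proof (rule the_equality)
  show "\<exists>\<mu>' :: nat \<Rightarrow> 'w measure. (\<forall>n<4. finite_measure (\<mu>' n) \<and> sets (\<mu>' n) = sets M \<and> integrable (\<mu>' n) f) \<and>
      (\<forall>G\<in>sets M. \<nu> G = (\<Sum>n<4. \<i> ^ n * complex_of_real (measure (\<mu>' n) G))) \<and>
      (\<Sum>n<4. \<i> ^ n * (\<integral>w. f w \<partial>\<mu> n)) = (\<Sum>n<4. \<i> ^ n * (\<integral>w. f w \<partial>\<mu>' n))"
    using \<mu> \<nu> by blast
  fix I assume "\<exists>\<mu>' :: nat \<Rightarrow> 'w measure. (\<forall>n<4. finite_measure (\<mu>' n) \<and> sets (\<mu>' n) = sets M \<and> integrable (\<mu>' n) f) \<and>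
      (\<forall>G\<in>sets M. \<nu> G = (\<Sum>n<4. \<i> ^ n * complex_of_real (measure (\<mu>' n) G))) \<and>
      I = (\<Sum>n<4. \<i> ^ n * (\<integral>w. f w \<partial>\<mu>' n))"
  then obtain \<mu>' :: "nat \<Rightarrow> 'w measure"
    where \<mu>': "\<And>n. n < 4 \<Longrightarrow> finite_measure (\<mu>' n) \<and> sets (\<mu>' n) = sets M \<and> integrable (\<mu>' n) f"
    and \<nu>': "\<And>G. G \<in> sets M \<Longrightarrow> \<nu> G = (\<Sum>n<4. \<i> ^ n * complex_of_real (measure (\<mu>' n) G))"
    and I: "I = (\<Sum>n<4. \<i> ^ n * (\<integral>w. f w \<partial>\<mu>' n))" by blast
  have "f \<in> borel_measurable (\<mu> 0)" using \<mu>[of 0] by auto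
  then have fm: "f \<in> borel_measurable M" using \<mu>[of 0] measurable_cong_sets[of "\<mu> 0" M] by auto
  obtain F where F: "\<And>i. simple_function M (F i)" "\<And>w. w \<in> space M \<Longrightarrow> (\<lambda>i. F i w) \<longlonglongrightarrow> f w"
      "\<And>i w. w \<in> space M \<Longrightarrow> cmod (F i w) \<le> 2 * cmod (f w)"
    by (rule complex_simple_approximation[OF fm]) blast
  have ms: "F i -` {v} \<inter> space M \<in> sets M" for i v
    using simple_functionD(2)[OF F(1), of i "{v}"] by simp
  have lim: "(\<lambda>i. \<Sum>v\<in>F i ` space M. v * \<nu> (F i -` {v} \<inter> space M)) \<longlonglongrightarrow> (\<Sum>n<4. \<i> ^ n * (\<integral>w. f w \<partial>\<kappa> n))"
    if \<kappa>: "\<And>n. n < 4 \<Longrightarrow> finite_measure (\<kappa> n) \<and> sets (\<kappa> n) = sets M \<and> integrable (\<kappa> n) f"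
    and \<nu>\<kappa>: "\<And>G. G \<in> sets M \<Longrightarrow> \<nu> G = (\<Sum>n<4. \<i> ^ n * complex_of_real (measure (\<kappa> n) G))"
    for \<kappa> :: "nat \<Rightarrow> 'w measure"
  proof -
    have sp: "space (\<kappa> n) = space M" if "n < 4" for n using \<kappa>[OF that] sets_eq_imp_space_eq by blast
    have "(\<lambda>i. \<integral>w. F i w \<partial>\<kappa> n) \<longlonglongrightarrow> (\<integral>w. f w \<partial>\<kappa> n)" if n: "n < 4" for n
    proof (rule integral_dominated_convergence[where w = "\<lambda>w. 2 * cmod (f w)"])
      show "F i \<in> borel_measurable (\<kappa> n)" for i
        using borel_measurable_simple_function[OF F(1)] measurable_cong_sets[of "\<kappa> n" M] \<kappa>[OF n] by auto
      show "f \<in> borel_measurable (\<kappa> n)" "integrable (\<kappa> n) (\<lambda>w. 2 * cmod (f w))" using \<kappa>[OF n] by auto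
      show "AE w in \<kappa> n. (\<lambda>i. F i w) \<longlonglongrightarrow> f w" "AE w in \<kappa> n. norm (F i w) \<le> 2 * cmod (f w)" for i
        using F(2,3) sp[OF n] by auto
    qed
    then have "(\<lambda>i. \<Sum>n<4. \<i> ^ n * (\<integral>w. F i w \<partial>\<kappa> n)) \<longlonglongrightarrow> (\<Sum>n<4. \<i> ^ n * (\<integral>w. f w \<partial>\<kappa> n))"
      by (intro tendsto_sum tendsto_mult_left) auto
    moreover have "(\<Sum>n<4. \<i> ^ n * (\<integral>w. F i w \<partial>\<kappa> n)) = (\<Sum>v\<in>F i ` space M. v * \<nu> (F i -` {v} \<inter> space M))" for i
    proof -
      have "(\<integral>w. F i w \<partial>\<kappa> n)
         = (\<Sum>v\<in>F i ` space M. v * complex_of_real (measure (\<kappa> n) (F i -` {v} \<inter> space M)))" if n: "n < 4" for n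
        using integral_finite_range[of "\<kappa> n" "F i ` space M" "F i"] \<kappa>[OF n] sp[OF n] ms F(1)[of i]
        by (simp add: simple_function_def)
      then have "(\<Sum>n<4. \<i> ^ n * (\<integral>w. F i w \<partial>\<kappa> n))
        = (\<Sum>n<4. \<Sum>v\<in>F i ` space M. v * (\<i> ^ n * complex_of_real (measure (\<kappa> n) (F i -` {v} \<inter> space M))))"
        by (intro sum.cong refl) (simp add: sum_distrib_left mult.left_commute)
      also have "\<dots> = (\<Sum>v\<in>F i ` space M. \<Sum>n<4. v * (\<i> ^ n * complex_of_real (measure (\<kappa> n) (F i -` {v} \<inter> space M))))"
        by (rule sum.swap)
      also have "\<dots> = (\<Sum>v\<in>F i ` space M. v * \<nu> (F i -` {v} \<inter> space M))"
        by (intro sum.cong refl) (simp add: \<nu>\<kappa>[OF ms] sum_distrib_left)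
      finally show ?thesis .
    qed
    ultimately show ?thesis by simp
  qed
  show "I = (\<Sum>n<4. \<i> ^ n * (\<integral>w. f w \<partial>\<mu> n))"
    unfolding I by (rule LIMSEQ_unique[OF lim lim]) (use \<mu> \<nu> \<mu>' \<nu>' in auto)
qed

context
  fixes M :: "'w measure" and K :: "'a hilb" and Q :: "'w set \<Rightarrow> 'a \<Rightarrow> 'a"
  assumes pvm: "pvm_space M K Q"
begin

lemma pvm_hilbert: "hilbert_space K"
  using pvm by (simp add: pvm_space_def)

interpretation K: hilbert_space K by (rule pvm_hilbert)

lemma pvm_in: "G \<in> sets M \<Longrightarrow> Q G \<in> bounded_ops K K"
  using pvm by (simp add: pvm_space_def)

text \<open>For a self-adjoint idempotent the quadratic form is the squared norm of the image, hence
  positive; the total mass becomes the projection onto \<open>hspace K\<close>.\<close>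

lemma povm_hlift: "povm M (\<lambda>G. hlift K K (Q G))"
  unfolding povm_def
proof (intro conjI ballI allI impI)
  fix G assume G: "G \<in> sets M"
  note QG = pvm_in[OF G]
  have "hinner K (Q G x) x = complex_of_real ((hnorm K (Q G x))\<^sup>2)" if x: "x \<in> carrier K" for x
  proof -
    note Qx = bounded_ops_carrier[OF pvm_hilbert pvm_hilbert QG x]
    have "op_adjoint K K (Q G) = Q G" and id: "compose (carrier K) (Q G) (Q G) = Q G"
      using pvm G by (simp_all add: pvm_space_def)
    then have "hinner K (Q G (Q G x)) x = hinner K (Q G x) (Q G x)"
      using hinner_op_adjoint[OF pvm_hilbert pvm_hilbert QG Qx x] by simp
    moreover have "Q G (Q G x) = Q G x" using fun_cong[OF id, of x] x by (simp add: compose_def)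
    ultimately show ?thesis using K.hinner_self[OF Qx] by simp
  qed
  then show "positive_clinear (hlift K K (Q G))"
    using bounded_clinear_hlift[OF pvm_hilbert pvm_hilbert QG]
    by (simp add: positive_clinear_def cinner_hlift[OF pvm_hilbert pvm_hilbert QG])
next
  fix z
  have "Q (space M) = op_id K" using pvm by (simp add: pvm_space_def)
  then show "norm (hlift K K (Q (space M)) z) \<le> norm z"
    by (simp add: hlift_def op_id_def K.hemb_hinv norm_cproj_le[OF K.hspace])
next
  fix G :: "nat \<Rightarrow> 'w set" and x y
  assume G: "range G \<subseteq> sets M \<and> disjoint_family G"
  then have "(\<Union>n. G n) \<in> sets M" "G n \<in> sets M" for n by auto
  then show "(\<lambda>n. cinner (hlift K K (Q (G n)) x) y) sums cinner (hlift K K (Q (\<Union>n. G n)) x) y"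
    using pvm G by (simp add: cinner_hlift[OF pvm_hilbert pvm_hilbert] pvm_in pvm_space_def)
qed

lemma hlift_op_zero: "hlift K K (op_zero K K) z = 0"
proof -
  have "hemb K \<zero>\<^bsub>K\<^esub> = 0"
    using K.norm_hemb[OF K.carrier_zero] by (simp add: hnorm_def K.carrier_zero)
  then show ?thesis by (simp add: hlift_def op_zero_def)
qed

lemma ess_bounded_byI:
  assumes "f \<in> borel_measurable M" "0 \<le> c" "Q {w\<in>space M. c < cmod (f w)} = op_zero K K"
  shows "ess_bounded_by M (\<lambda>G. hlift K K (Q G)) f c"
  using assms by (simp add: ess_bounded_by_def hlift_op_zero)

text \<open>Where f exceeds the bound of g, it differs from g. The diagonal measures are monotone,
  so the form of the projection on that set vanishes, and a positive operator with vanishing form is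
  0.\<close>

lemma Linf_ess_bounded:
  assumes f: "f \<in> Linf M K Q" shows "\<exists>c\<ge>0. Q {w\<in>space M. c < cmod (f w)} = op_zero K K"
proof -
  let ?p = "\<lambda>G. hlift K K (Q G)"
  obtain g where g: "g \<in> borel_measurable M" "bounded (g ` space M)" "Q {w\<in>space M. f w \<noteq> g w} = op_zero K K"
    and fm: "f \<in> borel_measurable M"
    using f by (auto simp: Linf_def)
  obtain c where c: "\<And>w. w \<in> space M \<Longrightarrow> cmod (g w) \<le> c" using g(2) by (auto simp: bounded_iff)
  \<comment> \<open>On an empty space the bound c may be negative, hence the absolute value.\<close>
  let ?N = "{w\<in>space M. f w \<noteq> g w}" and ?B = "{w\<in>space M. \<bar>c\<bar> < cmod (f w)}"
  have [measurable]: "f \<in> borel_measurable M" "g \<in> borel_measurable M" using fm g by auto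
  have N: "?N \<in> sets M" and B: "?B \<in> sets M" by measurable
  have sub: "?B \<subseteq> ?N" using c by fastforce
  have "Q ?B = op_zero K K"
  proof (rule hlift_inject[OF pvm_hilbert pvm_hilbert pvm_in[OF B]])
    show "op_zero K K \<in> bounded_ops K K" using pvm_in[OF N] g(3) by simp
    show "hlift K K (Q ?B) = hlift K K (op_zero K K)"
    proof
      fix z
      have "emeasure (povm_measure M ?p z) ?B \<le> emeasure (povm_measure M ?p z) ?N"
        by (rule emeasure_mono[OF sub]) (simp add: N povm_hlift)
      also have "\<dots> = 0" using N g(3) by (simp add: emeasure_povm_measure[OF povm_hlift] hlift_op_zero)
      finally have "Re (cinner (hlift K K (Q ?B) z) z) \<le> 0"
        using B by (simp add: emeasure_povm_measure[OF povm_hlift] ennreal_eq_0_iff)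
      moreover note pos = povm_positive[OF povm_hlift B]
      ultimately have "Re (cinner (hlift K K (Q ?B) z) z) = 0"
        by (metis positive_clinear_def antisym)
      then show "hlift K K (Q ?B) z = hlift K K (op_zero K K) z"
        using positive_clinear_eq_zero[OF pos] by (simp add: hlift_op_zero)
    qed
  qed
  then show ?thesis by (intro exI[of _ "\<bar>c\<bar>"]) simp
qed

text \<open>Polarization is one admissible decomposition of the complex measure, so
  \<open>povm_form\<close> is the defining integral. The form thus depends on x and y only through
  \<open>hinv K x\<close> and \<open>hinv K y\<close>, which confines the operator to
  \<open>hspace K\<close>.\<close>

lemma
  assumes f: "f \<in> Linf M K Q"
  shows pvm_integral_in: "pvm_integral M K Q f \<in> bounded_ops K K"
    and hlift_pvm_integral: "hlift K K (pvm_integral M K Q f) = povm_integral M (\<lambda>G. hlift K K (Q G)) f"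
proof -
  let ?p = "\<lambda>G. hlift K K (Q G)"
  obtain c where c: "0 \<le> c" "Q {w\<in>space M. c < cmod (f w)} = op_zero K K" using Linf_ess_bounded[OF f] by blast
  have fm: "f \<in> borel_measurable M" using f by (simp add: Linf_def)
  note eb = ess_bounded_byI[OF fm c]
  let ?A = "povm_integral M ?p f"
  note bA = bounded_clinear_povm_integral[OF povm_hlift eb] and cA = cinner_povm_integral[OF povm_hlift eb]
  have cmi: "complex_measure_integral M (\<lambda>G. hinner K (Q G (hinv K x)) (hinv K y)) f = povm_form M ?p f x y" for x y
    unfolding povm_form_def
  proof (rule complex_measure_integral_eqI)
    show "finite_measure (povm_measure M ?p z) \<and> sets (povm_measure M ?p z) = sets M \<and> integrable (povm_measure M ?p z) f" for z
      using finite_povm_measure[OF povm_hlift] ess_bounded_by_integrable[OF povm_hlift eb]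
        sets_povm_measure[OF povm_hlift] by blast
    show "hinner K (Q G (hinv K x)) (hinv K y) = (\<Sum>n<4. \<i> ^ n *
        complex_of_real (measure (povm_measure M ?p ((1/2) *\<^sub>C (x + \<i> ^ n *\<^sub>C y))) G))" if G: "G \<in> sets M" for G
      using polarization[OF povm_clinear[OF povm_hlift G], of x y]
      by (simp add: measure_povm_measure[OF povm_hlift G] cinner_hlift[OF pvm_hilbert pvm_hilbert pvm_in[OF G]])
  qed
  have A_in: "?A x \<in> hspace K" for x
    unfolding in_closed_subspace_iff[OF K.hspace]
  proof (intro allI impI)
    fix y assume "\<forall>v\<in>hspace K. cinner y v = 0"
    then have "hinv K y = \<zero>\<^bsub>K\<^esub>" by (simp add: K.hinv_zero_iff)
    moreover have "hinv K 0 = \<zero>\<^bsub>K\<^esub>" by (simp add: K.hinv_zero_iff)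
    ultimately have "povm_form M ?p f x y = povm_form M ?p f x 0" using cmi[of x y] cmi[of x 0] by simp
    then show "cinner (?A x) y = 0" by (simp add: cA[symmetric])
  qed
  have A_proj: "?A (cproj (hspace K) z) = ?A z" for z
  proof (rule cinner_ext)
    fix y
    have "hinv K (cproj (hspace K) z) = hinv K z" by (simp add: K.hemb_hinv[symmetric])
    then show "cinner (?A (cproj (hspace K) z)) y = cinner (?A z) y"
      using cmi[of "cproj (hspace K) z" y] cmi[of z y] by (simp add: cA)
  qed
  define B where "B = hdrop K K ?A"
  have B: "B \<in> bounded_ops K K" unfolding B_def by (rule hdrop_in[OF pvm_hilbert pvm_hilbert bA A_in])
  have Bl: "hlift K K B = ?A"
    unfolding B_def by (rule ext) (simp add: hlift_hdrop[OF pvm_hilbert pvm_hilbert bA A_in] A_proj)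
  have Bf: "hinner K (B x) y = complex_measure_integral M (\<lambda>G. hinner K (Q G x) y) f"
    if "x \<in> carrier K" "y \<in> carrier K" for x y
    using that cinner_hlift[OF pvm_hilbert pvm_hilbert B, of "hemb K x" "hemb K y"] cmi[of "hemb K x" "hemb K y"]
    by (simp add: Bl cA)
  have "pvm_integral M K Q f = B"
    unfolding pvm_integral_def
  proof (rule the_equality)
    fix B' assume B': "B' \<in> bounded_ops K K \<and>
      (\<forall>x\<in>carrier K. \<forall>y\<in>carrier K. hinner K (B' x) y = complex_measure_integral M (\<lambda>G. hinner K (Q G x) y) f)"
    show "B' = B"
    proof (rule bounded_ops_ext[OF pvm_hilbert pvm_hilbert _ B])
      show "B' x = B x" if "x \<in> carrier K" for x
        by (rule K.hinner_ext) (use that B' B Bf in \<open>auto intro: bounded_ops_carrier[OF pvm_hilbert pvm_hilbert]\<close>)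
    qed (use B' in blast)
  qed (use B Bf in blast)
  then show "pvm_integral M K Q f \<in> bounded_ops K K" "hlift K K (pvm_integral M K Q f) = ?A"
    using B Bl by auto
qed

lemma Linf_norm_nonneg: "f \<in> Linf M K Q \<Longrightarrow> 0 \<le> Linf_norm M K Q f"
  unfolding Linf_norm_def using Linf_ess_bounded by (intro cInf_greatest) auto

text \<open>For x nonzero, the norm of the image divided by 4 * norm x is at most every essential
  bound of f, hence at most their infimum, which need not be attained for this argument.\<close>

lemma norm_hlift_pvm_integral_le:
  assumes f: "f \<in> Linf M K Q"
  shows "norm (hlift K K (pvm_integral M K Q f) x) \<le> 4 * Linf_norm M K Q f * norm x"
proof (cases "x = 0")
  case True
  then show ?thesis
    using bounded_clinear_zero[OF bounded_clinear_hlift[OF pvm_hilbert pvm_hilbert pvm_integral_in[OF f]]] by simp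
next
  case False
  have fm: "f \<in> borel_measurable M" using f by (simp add: Linf_def)
  have "norm (hlift K K (pvm_integral M K Q f) x) / (4 * norm x) \<le> Linf_norm M K Q f"
    unfolding Linf_norm_def
  proof (rule cInf_greatest)
    show "{c. 0 \<le> c \<and> Q {w \<in> space M. c < cmod (f w)} = op_zero K K} \<noteq> {}"
      using Linf_ess_bounded[OF f] by blast
    fix c assume "c \<in> {c. 0 \<le> c \<and> Q {w \<in> space M. c < cmod (f w)} = op_zero K K}"
    then have "ess_bounded_by M (\<lambda>G. hlift K K (Q G)) f c" using ess_bounded_byI[OF fm] by blast
    from norm_povm_integral_le[OF povm_hlift this, of x]
    show "norm (hlift K K (pvm_integral M K Q f) x) / (4 * norm x) \<le> c"
      using False by (simp add: hlift_pvm_integral[OF f] field_simps)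
  qed
  then show ?thesis using False by (simp add: field_simps)
qed

end

section \<open>Alternating products and their weak integrals\<close>

text \<open>Each operator a_i is paired with the b_i to its right, so the product depends only on a
  list of indices, and a cyclic shift of the product is a cut of the list.\<close>

definition opchain :: "(nat \<Rightarrow> 'a \<Rightarrow> 'a) \<Rightarrow> (nat \<Rightarrow> 'a \<Rightarrow> 'a) \<Rightarrow> nat list \<Rightarrow> 'a \<Rightarrow> 'a" where
  "opchain a \<beta> is z = foldr (\<lambda>i z. a i (\<beta> i z)) is z"

lemma opchain_simps [simp]:
  "opchain a \<beta> [] z = z" "opchain a \<beta> (i # is) z = a i (\<beta> i (opchain a \<beta> is z))"
  "opchain a \<beta> (is @ js) z = opchain a \<beta> is (opchain a \<beta> js z)"
  "opchain a \<beta> (map f is) z = opchain (\<lambda>i. a (f i)) (\<lambda>i. \<beta> (f i)) is z"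
  by (simp_all add: opchain_def foldr_map o_def)

lemma opchain_cong:
  assumes "\<And>i. i \<in> set is \<Longrightarrow> \<beta> i = \<beta>' i" shows "opchain a \<beta> is z = opchain a \<beta>' is z"
  unfolding opchain_def by (rule foldr_cong) (use assms in auto)

lemma op_family_cong:
  assumes "op_family \<rho> a" and eq: "\<And>s. s \<in> space \<rho> \<Longrightarrow> a s = a' s"
  shows "op_family \<rho> a'"
  unfolding op_family_def
proof (intro conjI ballI allI impI, goal_cases)
  case (1 s)
  then show ?case using op_family_clinear[OF assms(1), of s] eq by simp
next
  case (2 x)
  then show ?case using op_family_spanned[OF assms(1), of x] eq by (simp add: countably_spanned_def)
next
  case (3 T x y)
  then have T: "\<And>s. s \<in> space \<rho> \<Longrightarrow> bounded_clinear (T s)"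
    and m: "\<And>x y. (\<lambda>s. cinner (T s x) y) \<in> borel_measurable \<rho>" by blast+
  have "(\<lambda>s. cinner (T s (a s x)) y) \<in> borel_measurable \<rho>"
    by (rule op_family_measurable_compose[OF assms(1) T m])
  then show ?case by (rule measurable_cong[THEN iffD1, rotated]) (simp add: eq)
qed

lemma op_family_opchain:
  assumes "\<And>i. i \<in> set is \<Longrightarrow> op_family \<rho> (a i)" "\<And>i. i \<in> set is \<Longrightarrow> bounded_clinear (\<beta> i)"
  shows "op_family \<rho> (\<lambda>s. opchain (\<lambda>i. a i s) \<beta> is)"
  using assms
proof (induction "is")
  case Nil
  show ?case using op_family_const[OF bounded_clinear_ident] by (simp add: opchain_def[abs_def])
next
  case (Cons i "is")
  have "op_family \<rho> (\<lambda>s x. a i s (\<beta> i (opchain (\<lambda>i. a i s) \<beta> is x)))"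
    by (rule op_family_compose[OF _ op_family_compose[OF op_family_const]]) (use Cons in auto)
  then show ?case by (rule op_family_cong) (simp add: fun_eq_iff)
qed

lemma norm_opchain_le:
  fixes a \<beta> :: "nat \<Rightarrow> 'a::real_normed_vector \<Rightarrow> 'a"
  assumes "distinct is" "\<And>i. i \<in> set is \<Longrightarrow> 0 \<le> c i" "\<And>i. i \<in> set is \<Longrightarrow> 0 \<le> d i"
    "\<And>i x. i \<in> set is \<Longrightarrow> norm (a i x) \<le> c i * norm x" "\<And>i x. i \<in> set is \<Longrightarrow> norm (\<beta> i x) \<le> d i * norm x"
  shows "norm (opchain a \<beta> is z) \<le> (\<Prod>i\<in>set is. c i * d i) * norm z"
  using assms
proof (induction "is")
  case (Cons i "is")
  have "norm (a i (\<beta> i (opchain a \<beta> is z))) \<le> c i * (d i * norm (opchain a \<beta> is z))"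
    using Cons.prems by (intro order_trans[OF Cons.prems(4)] mult_left_mono) auto
  also have "\<dots> \<le> c i * (d i * ((\<Prod>i\<in>set is. c i * d i) * norm z))"
    using Cons by (intro mult_left_mono) auto
  finally show ?case using Cons.prems(1) by (simp add: mult_ac)
qed simp

text \<open>The last operator has no b to its right and therefore stands outside the chain over 1,
  ..., m; composing with one further operator completes the pattern.\<close>

lemma alternating_product_lift:
  assumes H: "\<And>j. j \<in> {1..m+1} \<Longrightarrow> hilbert_space (H j)"
    and A: "\<And>j. j \<in> {1..m+1} \<Longrightarrow> A j \<in> bounded_ops (H j) (H j)"
    and b: "\<And>j. j \<in> {1..m} \<Longrightarrow> b j \<in> bounded_ops (H (j+1)) (H j)"
  shows "alternating_product H A b m \<in> bounded_ops (H (m+1)) (H 1) \<and>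
    (\<forall>z. hlift (H (m+1)) (H 1) (alternating_product H A b m) z =
      opchain (\<lambda>j. hlift (H j) (H j) (A j)) (\<lambda>j. hlift (H (j+1)) (H j) (b j)) [1..<m+1]
        (hlift (H (m+1)) (H (m+1)) (A (m+1)) z))"
  using assms
proof (induction m)
  case 0
  then show ?case by simp
next
  case (Suc m)
  have IH: "alternating_product H A b m \<in> bounded_ops (H (m+1)) (H 1)"
    "\<And>z. hlift (H (m+1)) (H 1) (alternating_product H A b m) z =
      opchain (\<lambda>j. hlift (H j) (H j) (A j)) (\<lambda>j. hlift (H (j+1)) (H j) (b j)) [1..<m+1]
        (hlift (H (m+1)) (H (m+1)) (A (m+1)) z)"
    using Suc.IH Suc.prems by auto
  have h: "hilbert_space (H 1)" "hilbert_space (H (m+1))" "hilbert_space (H (m+2))" using Suc.prems(1) by auto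
  have bA: "b (m+1) \<in> bounded_ops (H (m+2)) (H (m+1))" "A (m+2) \<in> bounded_ops (H (m+2)) (H (m+2))"
    using Suc.prems(3)[of "m+1"] Suc.prems(2)[of "m+2"] by (simp_all add: numeral_2_eq_2)
  note c = compose_in_bounded_ops[OF h(3,3,2) bA(2,1)] hlift_compose[OF h(3,3,2) bA(2,1)]
  note c' = compose_in_bounded_ops[OF h(3,2,1) c(1) IH(1)] hlift_compose[OF h(3,2,1) c(1) IH(1)]
  have s: "Suc m + 1 = m + 2" by simp
  have up: "[1..<m+2] = [1..<m+1] @ [m+1]" using upt_Suc_append[of 1 "m+1"] by simp
  show ?case
    unfolding alternating_product.simps s
  proof (intro conjI allI)
    show "hlift (H (m+2)) (H 1) (compose (carrier (H (m+2))) (alternating_product H A b m)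
          (compose (carrier (H (m+2))) (b (m+1)) (A (m+2)))) z =
      opchain (\<lambda>j. hlift (H j) (H j) (A j)) (\<lambda>j. hlift (H (j+1)) (H j) (b j)) [1..<m+2]
        (hlift (H (m+2)) (H (m+2)) (A (m+2)) z)" for z
      unfolding up opchain_simps c'(2) c(2) IH(2) by (simp add: numeral_2_eq_2)
  qed (rule c'(1))
qed

text \<open>The lifted integrand maps into \<open>hspace K\<close> and does not see the complement
  of \<open>hspace H\<close>. Both properties pass to its weak integral, which can therefore be
  dropped to the carriers and solves the definite description.\<close>

lemma
  assumes H: "hilbert_space H" and K: "hilbert_space K"
    and F: "\<And>s. s \<in> space \<rho> \<Longrightarrow> F s \<in> bounded_ops H K"
    and W: "has_weak_integral \<rho> (\<lambda>s. hlift H K (F s)) B"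
  shows has_pettis_integral_pettis_integral: "has_pettis_integral H K \<rho> F (pettis_integral H K \<rho> F)"
    and hlift_pettis_integral: "hlift H K (pettis_integral H K \<rho> F) = B"
proof -
  interpret H: hilbert_space H by (rule H)
  interpret K: hilbert_space K by (rule K)
  have bB: "bounded_clinear B" and Bi: "\<And>x y. has_bochner_integral \<rho> (\<lambda>s. cinner (hlift H K (F s) x) y) (cinner (B x) y)"
    using W by (auto simp: has_weak_integral_def)
  have to_weak: "has_weak_integral \<rho> (\<lambda>s. hlift H K (F s)) (hlift H K A)" if A: "has_pettis_integral H K \<rho> F A" for A
    unfolding has_weak_integral_def
  proof (intro conjI allI)
    have Ab: "A \<in> bounded_ops H K" using A by (simp add: has_pettis_integral_def)
    then show "bounded_clinear (hlift H K A)" by (rule bounded_clinear_hlift[OF H K])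
    have "has_bochner_integral \<rho> (\<lambda>s. hinner K (F s (hinv H x)) (hinv K y)) (hinner K (A (hinv H x)) (hinv K y))" for x y
      using A by (simp add: has_pettis_integral_def)
    then show "has_bochner_integral \<rho> (\<lambda>s. cinner (hlift H K (F s) x) y) (cinner (hlift H K A x) y)" for x y
      by (subst has_bochner_integral_cong[where g = "\<lambda>s. hinner K (F s (hinv H x)) (hinv K y)"
            and y = "hinner K (A (hinv H x)) (hinv K y)" and N = \<rho>])
         (auto simp: cinner_hlift[OF H K] F Ab)
  qed
  have B_in: "B x \<in> hspace K" for x
    by (rule has_weak_integral_in[OF W K.hspace hlift_in[OF H K F]])
  have B_proj: "B (cproj (hspace H) z) = B z" for z
  proof (rule cinner_ext)
    show "cinner (B (cproj (hspace H) z)) y = cinner (B z) y" for y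
      using Bi[of "cproj (hspace H) z" y] Bi[of z y]
      by (simp add: hlift_cproj[OF H K] has_bochner_integral_iff)
  qed
  define A where "A = hdrop H K B"
  have A: "A \<in> bounded_ops H K" unfolding A_def by (rule hdrop_in[OF H K bB B_in])
  have Al: "hlift H K A = B"
    unfolding A_def by (rule ext) (simp add: hlift_hdrop[OF H K bB B_in] B_proj)
  have AP: "has_pettis_integral H K \<rho> F A"
    unfolding has_pettis_integral_def
  proof (intro conjI ballI A)
    fix x y assume xy: "x \<in> carrier H" "y \<in> carrier K"
    have "cinner (B (hemb H x)) (hemb K y) = hinner K (A x) y"
      using cinner_hlift[OF H K A, of "hemb H x" "hemb K y"] xy by (simp add: Al)
    then show "has_bochner_integral \<rho> (\<lambda>s. hinner K (F s x) y) (hinner K (A x) y)"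
      using Bi[of "hemb H x" "hemb K y"] xy
      by (subst has_bochner_integral_cong[where g = "\<lambda>s. cinner (hlift H K (F s) (hemb H x)) (hemb K y)"
            and y = "cinner (B (hemb H x)) (hemb K y)" and N = \<rho>]) (auto simp: cinner_hlift[OF H K F])
  qed
  have "pettis_integral H K \<rho> F = A"
    unfolding pettis_integral_def
  proof (rule the_equality[where P = "has_pettis_integral H K \<rho> F", OF AP])
    fix A' assume A': "has_pettis_integral H K \<rho> F A'"
    show "A' = A"
    proof (rule hlift_inject[OF H K _ A])
      show "A' \<in> bounded_ops H K" using A' by (simp add: has_pettis_integral_def)
      show "hlift H K A' = hlift H K A"
        by (rule has_weak_integral_unique[OF to_weak[OF A'] to_weak[OF AP]])
    qed
  qed
  then show "has_pettis_integral H K \<rho> F (pettis_integral H K \<rho> F)" "hlift H K (pettis_integral H K \<rho> F) = B"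
    using AP Al by auto
qed

text \<open>A majorant of finite integral is finite almost everywhere and may be replaced by a real
  integrable function; h itself is not assumed to be measurable.\<close>

lemma upper_integral_dominating:
  fixes h :: "'s \<Rightarrow> real"
  assumes "upper_integral \<rho> (\<lambda>s. ennreal (h s)) < \<infinity>"
  shows "\<exists>g. integrable \<rho> g \<and> (AE s in \<rho>. h s \<le> g s)"
proof -
  obtain G where G: "G \<in> borel_measurable \<rho>" "AE s in \<rho>. ennreal (h s) \<le> G s" "(\<integral>\<^sup>+ s. G s \<partial>\<rho>) < \<infinity>"
    using assms unfolding upper_integral_def Inf_less_iff by auto
  have fin: "AE s in \<rho>. G s \<noteq> \<infinity>" using G by (intro nn_integral_PInf_AE) auto
  have "integrable \<rho> (\<lambda>s. enn2real (G s))"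
  proof (rule integrableI_nonneg)
    have "(\<integral>\<^sup>+ s. ennreal (enn2real (G s)) \<partial>\<rho>) = (\<integral>\<^sup>+ s. G s \<partial>\<rho>)"
      using fin by (intro nn_integral_cong_AE) (auto simp: less_top)
    then show "(\<integral>\<^sup>+ s. ennreal (enn2real (G s)) \<partial>\<rho>) < \<infinity>" using G(3) by simp
  qed (use G(1) in auto)
  moreover have "AE s in \<rho>. h s \<le> enn2real (G s)"
    using G(2) fin
  proof eventually_elim
    case (elim s)
    have "ennreal (h s) \<le> ennreal (enn2real (G s))" using elim by (simp add: less_top)
    then show ?case by (metis enn2real_nonneg ennreal_le_iff)
  qed
  ultimately show ?thesis by blast
qed

text \<open>Every assumption is stable under a permutation of the indices, so the locale is
  interpreted a second time for the families composed with \<gamma>, with the same g.\<close>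

locale moi_family =
  fixes k :: nat and \<Omega> :: "nat \<Rightarrow> 'w measure" and H :: "nat \<Rightarrow> 'h hilb"
    and P :: "nat \<Rightarrow> 'w set \<Rightarrow> 'h \<Rightarrow> 'h" and \<rho> :: "'s measure" and \<phi>s :: "nat \<Rightarrow> 'w \<times> 's \<Rightarrow> complex"
    and g :: "'s \<Rightarrow> real"
  assumes pvm: "j \<in> {1..k+1} \<Longrightarrow> pvm_space (\<Omega> j) (H j) (P j)"
    and \<phi>s_measurable: "j \<in> {1..k+1} \<Longrightarrow> \<phi>s j \<in> borel_measurable (\<Omega> j \<Otimes>\<^sub>M \<rho>)"
    and \<phi>s_Linf: "j \<in> {1..k+1} \<Longrightarrow> s \<in> space \<rho> \<Longrightarrow> (\<lambda>w. \<phi>s j (w, s)) \<in> Linf (\<Omega> j) (H j) (P j)"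
    and g_integrable: "integrable \<rho> g"
    and g_dominating: "AE s in \<rho>. (\<Prod>j\<in>{1..k+1}. Linf_norm (\<Omega> j) (H j) (P j) (\<lambda>w. \<phi>s j (w, s))) \<le> g s"
begin

definition symbol_op :: "nat \<Rightarrow> 's \<Rightarrow> 'h ell2 \<Rightarrow> 'h ell2" where
  "symbol_op j s = hlift (H j) (H j) (pvm_integral (\<Omega> j) (H j) (P j) (\<lambda>w. \<phi>s j (w, s)))"

lemma hilbert: "j \<in> {1..k+1} \<Longrightarrow> hilbert_space (H j)"
  using pvm_hilbert[OF pvm] .

lemma op_family_symbol_op:
  assumes j: "j \<in> {1..k+1}" shows "op_family \<rho> (symbol_op j)"
proof (rule op_family_cong)
  let ?p = "\<lambda>G. hlift (H j) (H j) (P j G)"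
  show "op_family \<rho> (\<lambda>s. povm_integral (\<Omega> j) ?p (\<lambda>w. \<phi>s j (w, s)))"
  proof (rule op_family_povm_integral[OF povm_hlift[OF pvm[OF j]] \<phi>s_measurable[OF j]])
    fix s assume s: "s \<in> space \<rho>"
    show "\<exists>c. ess_bounded_by (\<Omega> j) ?p (\<lambda>w. \<phi>s j (w, s)) c"
      using Linf_ess_bounded[OF pvm[OF j] \<phi>s_Linf[OF j s]] ess_bounded_byI[OF pvm[OF j]] \<phi>s_Linf[OF j s]
      by (auto simp: Linf_def)
  qed
  show "povm_integral (\<Omega> j) ?p (\<lambda>w. \<phi>s j (w, s)) = symbol_op j s" if "s \<in> space \<rho>" for s
    unfolding symbol_op_def by (rule hlift_pvm_integral[OF pvm[OF j] \<phi>s_Linf[OF j that], symmetric])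
qed

lemma symbol_op_in: "j \<in> {1..k+1} \<Longrightarrow> s \<in> space \<rho> \<Longrightarrow> symbol_op j s x \<in> hspace (H j)"
  unfolding symbol_op_def by (rule hlift_in[OF hilbert hilbert pvm_integral_in[OF pvm \<phi>s_Linf]])

text \<open>The two lists and i0 exhaust the indices exactly once, so the product of the two bounds
  is a constant times the product of all the \<open>Linf_norm\<close> values, which g dominates.
  After the symbol i0 there is a gap, into which the trace class operator can be inserted.\<close>

lemma chain_dominated:
  assumes \<beta>: "\<And>i. i \<in> set (is @ js) \<Longrightarrow> bounded_clinear (\<beta> i)"
    and d: "distinct (is @ i0 # js)" and n: "set (is @ i0 # js) = {1..k+1}"
  shows "\<exists>C\<ge>0. AE s in \<rho>. \<exists>l m. 0 \<le> l \<and> 0 \<le> m \<and>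
      (\<forall>x. norm (opchain (\<lambda>i. symbol_op i s) \<beta> is (symbol_op i0 s x)) \<le> l * norm x) \<and>
      (\<forall>x. norm (opchain (\<lambda>i. symbol_op i s) \<beta> js x) \<le> m * norm x) \<and> l * m \<le> C * g s"
proof -
  have "\<forall>i. \<exists>D. i \<in> set (is @ js) \<longrightarrow> 0 \<le> D \<and> (\<forall>x. norm (\<beta> i x) \<le> D * norm x)"
    using bounded_clinear_bound[OF \<beta>] by (metis less_imp_le)
  then obtain D where D: "\<And>i. i \<in> set (is @ js) \<Longrightarrow> 0 \<le> D i"
    "\<And>i x. i \<in> set (is @ js) \<Longrightarrow> norm (\<beta> i x) \<le> D i * norm x" by metis
  define c where "c j s = Linf_norm (\<Omega> j) (H j) (P j) (\<lambda>w. \<phi>s j (w, s))" for j s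
  have i0: "i0 \<in> {1..k+1}" and sub: "set is \<subseteq> {1..k+1}" "set js \<subseteq> {1..k+1}" using n by auto
  have c: "0 \<le> 4 * c j s" "norm (symbol_op j s x) \<le> 4 * c j s * norm x"
    if "j \<in> {1..k+1}" "s \<in> space \<rho>" for j s x
    using Linf_norm_nonneg[OF pvm[OF that(1)] \<phi>s_Linf[OF that]]
      norm_hlift_pvm_integral_le[OF pvm[OF that(1)] \<phi>s_Linf[OF that]]
    by (auto simp: c_def symbol_op_def)
  \<comment> \<open>A factor 4 for each symbol from \<open>norm_hlift_pvm_integral_le\<close>, the
    leading one for i0, and a norm bound for each \<open>\<beta> i\<close>.\<close>
  define C where "C = 4 * (\<Prod>i\<in>set is. 4 * D i) * (\<Prod>i\<in>set js. 4 * D i)"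
  have C0: "0 \<le> C" unfolding C_def using D(1) by (intro mult_nonneg_nonneg prod_nonneg) auto
  have AEs: "AE s in \<rho>. s \<in> space \<rho>" by simp
  have "AE s in \<rho>. \<exists>l m. 0 \<le> l \<and> 0 \<le> m \<and>
      (\<forall>x. norm (opchain (\<lambda>i. symbol_op i s) \<beta> is (symbol_op i0 s x)) \<le> l * norm x) \<and>
      (\<forall>x. norm (opchain (\<lambda>i. symbol_op i s) \<beta> js x) \<le> m * norm x) \<and> l * m \<le> C * g s"
    using g_dominating AEs
  proof eventually_elim
    case (elim s)
    define l m where "l = (\<Prod>i\<in>set is. 4 * c i s * D i)" and "m = (\<Prod>i\<in>set js. 4 * c i s * D i)"
    have l0: "0 \<le> l" and m0: "0 \<le> m"
      unfolding l_def m_def using c(1) elim(2) D(1) sub by (auto intro!: prod_nonneg mult_nonneg_nonneg)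
    have b: "norm (opchain (\<lambda>i. symbol_op i s) \<beta> is x) \<le> l * norm x" for x
      unfolding l_def using c elim(2) D sub d by (intro norm_opchain_le) auto
    have "norm (opchain (\<lambda>i. symbol_op i s) \<beta> is (symbol_op i0 s x)) \<le> (l * (4 * c i0 s)) * norm x" for x
      using order_trans[OF b mult_left_mono[OF c(2)[OF i0 elim(2)] l0]] by (simp add: mult.assoc)
    moreover have "norm (opchain (\<lambda>i. symbol_op i s) \<beta> js x) \<le> m * norm x" for x
      unfolding m_def using c elim(2) D sub d by (intro norm_opchain_le) auto
    moreover have "(l * (4 * c i0 s)) * m \<le> C * g s"
    proof -
      have p: "(\<Prod>j\<in>{1..k+1}. c j s) = c i0 s * ((\<Prod>i\<in>set is. c i s) * (\<Prod>i\<in>set js. c i s))"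
      proof -
        have "i0 \<notin> set is \<union> set js" "set is \<inter> set js = {}" using d by auto
        then show ?thesis unfolding n[symmetric] by (simp add: prod.union_disjoint)
      qed
      have q: "(l * (4 * c i0 s)) * m = C * (c i0 s * ((\<Prod>i\<in>set is. c i s) * (\<Prod>i\<in>set js. c i s)))"
        by (simp add: C_def l_def m_def prod.distrib)
      have "C * (\<Prod>j\<in>{1..k+1}. c j s) \<le> C * g s"
        unfolding c_def by (rule mult_left_mono[OF elim(1) C0])
      then show ?thesis by (simp only: p q)
    qed
    moreover have "0 \<le> l * (4 * c i0 s)" using l0 c(1)[OF i0 elim(2)] by simp
    ultimately show ?case using m0 by blast
  qed
  then show ?thesis using C0 by blast
qed

lemma op_family_chain:
  assumes "set is \<subseteq> {1..k+1}" "\<And>i. i \<in> set is \<Longrightarrow> bounded_clinear (\<beta> i)"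
  shows "op_family \<rho> (\<lambda>s. opchain (\<lambda>i. symbol_op i s) \<beta> is)"
  by (rule op_family_opchain) (use assms op_family_symbol_op in auto)

lemma op_family_chain_symbol:
  assumes "set is \<subseteq> {1..k+1}" "\<And>i. i \<in> set is \<Longrightarrow> bounded_clinear (\<beta> i)" "i0 \<in> {1..k+1}"
  shows "op_family \<rho> (\<lambda>s x. opchain (\<lambda>i. symbol_op i s) \<beta> is (symbol_op i0 s x))"
  by (rule op_family_compose[OF op_family_chain op_family_symbol_op]) (use assms in auto)

lemma
  assumes b: "\<And>j. j \<in> {1..k} \<Longrightarrow> b j \<in> bounded_ops (H (j+1)) (H j)"
  shows has_pettis_integral_moi:
      "has_pettis_integral (H (k+1)) (H 1) \<rho> (moi_integrand k \<Omega> H P \<phi>s b) (moi k \<Omega> H P \<rho> \<phi>s b)"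
    and has_weak_integral_moi: "has_weak_integral \<rho>
      (\<lambda>s z. opchain (\<lambda>i. symbol_op i s) (\<lambda>j. hlift (H (j+1)) (H j) (b j)) [1..<k+1] (symbol_op (k+1) s z))
      (hlift (H (k+1)) (H 1) (moi k \<Omega> H P \<rho> \<phi>s b))"
proof -
  let ?\<beta> = "\<lambda>j. hlift (H (j+1)) (H j) (b j)"
  let ?F = "\<lambda>s z. opchain (\<lambda>i. symbol_op i s) ?\<beta> [1..<k+1] (symbol_op (k+1) s z)"
  have n: "hilbert_space (H (k+1))" "hilbert_space (H 1)" using hilbert by auto
  have \<beta>: "bounded_clinear (?\<beta> i)" if "i \<in> {1..k}" for i
    using that hilbert by (intro bounded_clinear_hlift b) auto
  have F: "moi_integrand k \<Omega> H P \<phi>s b s \<in> bounded_ops (H (k+1)) (H 1) \<and>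
      (\<forall>z. hlift (H (k+1)) (H 1) (moi_integrand k \<Omega> H P \<phi>s b s) z = ?F s z)" if s: "s \<in> space \<rho>" for s
    unfolding moi_integrand_def symbol_op_def
    by (rule alternating_product_lift) (use hilbert b pvm_integral_in[OF pvm \<phi>s_Linf] s in auto)
  have fam: "op_family \<rho> ?F"
    by (rule op_family_chain_symbol) (use \<beta> in auto)
  \<comment> \<open>With an empty second list the second factor is the identity.\<close>
  have "\<exists>C\<ge>0. AE s in \<rho>. \<exists>l m. 0 \<le> l \<and> 0 \<le> m \<and> (\<forall>x. norm (?F s x) \<le> l * norm x) \<and>
      (\<forall>x. norm (opchain (\<lambda>i. symbol_op i s) ?\<beta> [] x) \<le> m * norm x) \<and> l * m \<le> C * g s"
    by (rule chain_dominated) (use \<beta> in auto)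
  then obtain C where C: "AE s in \<rho>. \<exists>l m. 0 \<le> l \<and> 0 \<le> m \<and> (\<forall>x. norm (?F s x) \<le> l * norm x) \<and>
      (\<forall>x. norm (opchain (\<lambda>i. symbol_op i s) ?\<beta> [] x) \<le> m * norm x) \<and> l * m \<le> C * g s" by blast
  have le: "AE s in \<rho>. \<exists>l m. 0 \<le> l \<and> 0 \<le> m \<and> (\<forall>x. norm (?F s x) \<le> l * norm x) \<and>
      (\<forall>x :: 'h ell2. norm x \<le> m * norm x) \<and> l * m \<le> C * g s"
    using C by simp
  have "integrable \<rho> (\<lambda>s. C * g s)" using g_integrable by auto
  from weak_integral_compose_exists[OF fam op_family_const[OF bounded_clinear_ident] bounded_clinear_ident this le]
  have "\<exists>B. has_weak_integral \<rho> ?F B" .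
  then obtain B where B: "has_weak_integral \<rho> ?F B" ..
  have W: "has_weak_integral \<rho> (\<lambda>s. hlift (H (k+1)) (H 1) (moi_integrand k \<Omega> H P \<phi>s b s)) B"
    by (rule has_weak_integral_cong[THEN iffD2, OF _ B]) (use F in auto)
  show "has_pettis_integral (H (k+1)) (H 1) \<rho> (moi_integrand k \<Omega> H P \<phi>s b) (moi k \<Omega> H P \<rho> \<phi>s b)"
    unfolding moi_def by (rule has_pettis_integral_pettis_integral[OF n _ W]) (use F in auto)
  have "hlift (H (k+1)) (H 1) (moi k \<Omega> H P \<rho> \<phi>s b) = B"
    unfolding moi_def by (rule hlift_pettis_integral[OF n _ W]) (use F in auto)
  then show "has_weak_integral \<rho> ?F (hlift (H (k+1)) (H 1) (moi k \<Omega> H P \<rho> \<phi>s b))" using B by simp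
qed

lemma moi_in: "(\<And>j. j \<in> {1..k} \<Longrightarrow> b j \<in> bounded_ops (H (j+1)) (H j)) \<Longrightarrow>
    moi k \<Omega> H P \<rho> \<phi>s b \<in> bounded_ops (H (k+1)) (H 1)"
  using has_pettis_integral_moi by (simp add: has_pettis_integral_def)

section \<open>Rotating the chain under the trace\<close>

lemma chain_symbol_in:
  assumes c: "c \<in> {1..k+1}" and s: "s \<in> space \<rho>"
  shows "opchain (\<lambda>i. symbol_op i s) \<beta> [c..<k+1] (symbol_op (k+1) s x) \<in> hspace (H c)"
proof (cases "c = k + 1")
  case True
  then show ?thesis using symbol_op_in[OF c s] by simp
next
  case False
  then have "[c..<k+1] = c # [Suc c..<k+1]" using c by (intro upt_conv_Cons) auto
  then show ?thesis using symbol_op_in[OF c s] by simp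
qed

text \<open>In the rotated list k+1 stays cyclically in front of 1. Wherever the cut c is, the
  nuclear operator \<open>\<beta> (k+1)\<close> thus falls between the part from c on and the part
  below c, the latter being the identity for c = 1.\<close>

lemma chain_trace_rotate:
  assumes \<beta>: "\<And>i. i \<in> {1..k} \<Longrightarrow> bounded_clinear (\<beta> i)" and T: "nuclear_rep u v (\<beta> (k+1))"
    and c: "c \<in> {1..k+1}"
    and A: "has_weak_integral \<rho> (\<lambda>s x. opchain (\<lambda>i. symbol_op i s) \<beta> [1..<k+1] (symbol_op (k+1) s x)) A"
    and A': "has_weak_integral \<rho> (\<lambda>s. opchain (\<lambda>i. symbol_op i s) \<beta> ([c..<k+2] @ [1..<c])) A'"
  shows "\<exists>M. trace_bound A' M"
    and "onb (hspace (H c)) E \<Longrightarrow> ((\<lambda>e. cinner (A' e) e) has_sum (\<Sum>n. cinner (A (v n)) (u n))) E"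
proof -
  let ?L = "\<lambda>s x. opchain (\<lambda>i. symbol_op i s) \<beta> [c..<k+1] (symbol_op (k+1) s x)"
  let ?M = "\<lambda>s. opchain (\<lambda>i. symbol_op i s) \<beta> [1..<c]"
  have L: "op_family \<rho> ?L" by (rule op_family_chain_symbol) (use \<beta> c in auto)
  have M: "op_family \<rho> ?M" by (rule op_family_chain) (use \<beta> c in auto)
  have "\<exists>C\<ge>0. AE s in \<rho>. \<exists>l m. 0 \<le> l \<and> 0 \<le> m \<and> (\<forall>x. norm (?L s x) \<le> l * norm x) \<and>
      (\<forall>x. norm (?M s x) \<le> m * norm x) \<and> l * m \<le> C * g s"
  proof (rule chain_dominated)
    show "set ([c..<k+1] @ (k+1) # [1..<c]) = {1..k+1}" using c by auto
    show "distinct ([c..<k+1] @ (k+1) # [1..<c])" using c by auto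
    show "bounded_clinear (\<beta> i)" if "i \<in> set ([c..<k+1] @ [1..<c])" for i
      using that c by (intro \<beta>) (auto simp del: upt_Suc)
  qed
  then obtain C where le: "AE s in \<rho>. \<exists>l m. 0 \<le> l \<and> 0 \<le> m \<and> (\<forall>x. norm (?L s x) \<le> l * norm x) \<and>
      (\<forall>x. norm (?M s x) \<le> m * norm x) \<and> l * m \<le> C * g s" by blast
  have g: "integrable \<rho> (\<lambda>s. C * g s)" using g_integrable by auto
  have e: "[c..<k+2] = [c..<k+1] @ [k+1]" using c by (simp add: upt_Suc_append)
  have rot: "has_weak_integral \<rho> (\<lambda>s x. ?L s (\<beta> (k+1) (?M s x))) A'"
    by (rule has_weak_integral_cong[THEN iffD1, OF _ A']) (simp only: e opchain_simps)
  have split: "[1..<k+1] = [1..<c] @ [c..<k+1]" using c upt_add_eq_append[of 1 c "k+1-c"] by (simp del: upt_Suc)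
  have flip: "has_weak_integral \<rho> (\<lambda>s x. ?M s (?L s x)) A"
    by (rule has_weak_integral_cong[THEN iffD1, OF _ A]) (simp only: split opchain_simps)
  show "\<exists>M. trace_bound A' M"
    using weak_integral_compose_trace_bound(2)[OF op_family_clinear[OF L] op_family_clinear[OF M] T g le rot] by blast
  interpret Hc: hilbert_space "H c" by (rule hilbert[OF c])
  show "((\<lambda>e. cinner (A' e) e) has_sum (\<Sum>n. cinner (A (v n)) (u n))) E" if "onb (hspace (H c)) E"
    by (rule weak_integral_trace_rotate[OF L M T Hc.hspace that chain_symbol_in[OF c] g le flip rot])
qed

end

section \<open>Cyclic permutations and multilinearity\<close>

declare upt_Suc [simp del]

definition cyclic_next :: "nat \<Rightarrow> nat \<Rightarrow> nat" where
  "cyclic_next n j = (if j = n then 1 else j + 1)"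

lemma cong_atLeastAtMost_eq:
  assumes "x \<in> {1..n}" "y \<in> {1..n}" "[int x = int y] (mod int n)" shows "x = y"
proof (rule ccontr)
  assume "x \<noteq> y"
  then have "\<bar>int n\<bar> \<le> \<bar>int x - int y\<bar>"
    using assms(3) by (intro dvd_imp_le_int) (auto simp: cong_iff_dvd_diff)
  then show False using assms(1,2) by auto
qed

text \<open>Representatives in 1, ..., n of a residue class are unique, so the congruence sends
  consecutive indices to cyclically consecutive values. Iterating this makes the list of values a
  rotation starting at \<open>\<gamma> 1\<close>.\<close>

lemma
  assumes "cyclic_permutation n \<gamma>" and n: "1 \<le> n"
  shows cyclic_permutation_in: "i \<in> {1..n} \<Longrightarrow> \<gamma> i \<in> {1..n}"
    and cyclic_permutation_Suc: "i \<in> {1..<n} \<Longrightarrow> \<gamma> (i + 1) = cyclic_next n (\<gamma> i)"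
    and cyclic_permutation_last: "\<gamma> 1 = cyclic_next n (\<gamma> n)"
    and cyclic_permutation_upt: "map \<gamma> [1..<n+1] = [\<gamma> 1..<n+1] @ [1..<\<gamma> 1]"
proof -
  obtain j :: int where perm: "\<gamma> permutes {1..n}" and j: "\<And>i. i \<in> {1..n} \<Longrightarrow> [int (\<gamma> i) = int i + j] (mod int n)"
    using assms(1) unfolding cyclic_permutation_def by blast
  show in_n: "\<gamma> i \<in> {1..n}" if "i \<in> {1..n}" for i using permutes_in_image[OF perm, of i] that by simp
  have next_in: "cyclic_next n i \<in> {1..n}" if "i \<in> {1..n}" for i using that by (auto simp: cyclic_next_def)
  have next_cong: "[int (cyclic_next n i) = int i + 1] (mod int n)" if "i \<in> {1..n}" for i
    using that by (auto simp: cyclic_next_def cong_iff_dvd_diff)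
  have *: "\<gamma> i' = cyclic_next n (\<gamma> i)"
    if i: "i \<in> {1..n}" "i' \<in> {1..n}" "[int i' = int i + 1] (mod int n)" for i i'
  proof (rule cong_atLeastAtMost_eq[OF in_n[OF i(2)] next_in[OF in_n[OF i(1)]]])
    have "[int (\<gamma> i') = int i' + j] (mod int n)" by (rule j[OF i(2)])
    also have "[int i' + j = int i + 1 + j] (mod int n)" by (rule cong_add[OF i(3) cong_refl])
    also have "int i + 1 + j = (int i + j) + 1" by simp
    also have "[(int i + j) + 1 = int (\<gamma> i) + 1] (mod int n)" by (rule cong_add[OF cong_sym[OF j[OF i(1)]] cong_refl])
    also have "[int (\<gamma> i) + 1 = int (cyclic_next n (\<gamma> i))] (mod int n)"
      by (rule cong_sym[OF next_cong[OF in_n[OF i(1)]]])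
    finally show "[int (\<gamma> i') = int (cyclic_next n (\<gamma> i))] (mod int n)" .
  qed
  show step: "\<gamma> (i + 1) = cyclic_next n (\<gamma> i)" if "i \<in> {1..<n}" for i
    by (rule *) (use that in \<open>auto simp: add.commute\<close>)
  show "\<gamma> 1 = cyclic_next n (\<gamma> n)"
    by (rule *) (use n in \<open>auto simp: cong_iff_dvd_diff\<close>)
  have g1: "\<gamma> 1 \<in> {1..n}" by (rule in_n) (use n in simp)
  \<comment> \<open>The iterated step in closed form; since t < n there is at most one
    wrap-around.\<close>
  have formula: "\<gamma> (t + 1) = (if \<gamma> 1 + t \<le> n then \<gamma> 1 + t else \<gamma> 1 + t - n)" if "t < n" for t
    using that
  proof (induction t)
    case 0
    then show ?case using g1 by simp
  next
    case (Suc t)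
    have "\<gamma> (Suc t + 1) = cyclic_next n (\<gamma> (t + 1))" using \<open>Suc t < n\<close> step[of "t + 1"] by simp
    then show ?case using Suc.IH Suc.prems g1 by (auto simp: cyclic_next_def)
  qed
  show "map \<gamma> [1..<n+1] = [\<gamma> 1..<n+1] @ [1..<\<gamma> 1]"
  proof (rule nth_equalityI)
    show "length (map \<gamma> [1..<n+1]) = length ([\<gamma> 1..<n+1] @ [1..<\<gamma> 1])" using g1 by auto
    fix t assume "t < length (map \<gamma> [1..<n+1])"
    then have t: "t < n" by simp
    then have "map \<gamma> [1..<n+1] ! t = \<gamma> (t + 1)" by (simp del: upt_Suc)
    moreover have "([\<gamma> 1..<n+1] @ [1..<\<gamma> 1]) ! t = (if \<gamma> 1 + t \<le> n then \<gamma> 1 + t else \<gamma> 1 + t - n)"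
      using t g1 by (auto simp: nth_append simp del: upt_Suc)
    ultimately show "map \<gamma> [1..<n+1] ! t = ([\<gamma> 1..<n+1] @ [1..<\<gamma> 1]) ! t" using formula[OF t] by simp
  qed
qed

lemma cyclic_permutation_id: "cyclic_permutation n id"
  unfolding cyclic_permutation_def by (auto intro: exI[of _ 0] permutes_id)

section \<open>Sums and multiples of operators under transfer\<close>

context
  fixes H K :: "'a hilb"
  assumes H: "hilbert_space H" and K: "hilbert_space K"
begin

interpretation H: hilbert_space H by (rule H)
interpretation K: hilbert_space K by (rule K)

lemma
  assumes A: "A \<in> bounded_ops H K" and B: "B \<in> bounded_ops H K"
  shows op_add_in: "op_add H K A B \<in> bounded_ops H K"
    and hlift_op_add: "hlift H K (op_add H K A B) z = hlift H K A z + hlift H K B z"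
proof -
  note AK = bounded_ops_carrier[OF H K A] and BK = bounded_ops_carrier[OF H K B]
  have "op_add H K A B = hdrop H K (\<lambda>z. hlift H K A z + hlift H K B z)"
    unfolding op_add_def hdrop_def
    by (rule restrict_ext)
       (simp add: hlift_hemb[OF H K] AK BK K.hemb_add[symmetric] K.carrier_add)
  also have "\<dots> \<in> bounded_ops H K"
    by (rule hdrop_in[OF H K bounded_clinear_plus[OF bounded_clinear_hlift[OF H K A] bounded_clinear_hlift[OF H K B]]])
       (intro csubspaceD(2)[OF K.csubspace_hspace] hlift_in[OF H K] A B)
  finally show "op_add H K A B \<in> bounded_ops H K" .
  show "hlift H K (op_add H K A B) z = hlift H K A z + hlift H K B z"
    by (simp add: hlift_def op_add_def K.hemb_add AK BK)
qed

lemma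
  assumes A: "A \<in> bounded_ops H K"
  shows op_scale_in: "op_scale H K a A \<in> bounded_ops H K"
    and hlift_op_scale: "hlift H K (op_scale H K a A) z = a *\<^sub>C hlift H K A z"
proof -
  note AK = bounded_ops_carrier[OF H K A]
  have "op_scale H K a A = hdrop H K (\<lambda>z. a *\<^sub>C hlift H K A z)"
    unfolding op_scale_def hdrop_def
    by (rule restrict_ext) (simp add: hlift_hemb[OF H K] AK K.hemb_smult[symmetric] K.carrier_smult)
  also have "\<dots> \<in> bounded_ops H K"
    by (rule hdrop_in[OF H K bounded_clinear_scale[OF bounded_clinear_hlift[OF H K A]]])
       (intro csubspaceD(3)[OF K.csubspace_hspace] hlift_in[OF H K] A)
  finally show "op_scale H K a A \<in> bounded_ops H K" .
  show "hlift H K (op_scale H K a A) z = a *\<^sub>C hlift H K A z"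
    by (simp add: hlift_def op_scale_def K.hemb_smult AK)
qed

end

context moi_family
begin

text \<open>The value of the trace is expressed through the unpermuted integral only. The trace
  identity is therefore the comparison of the instances for \<gamma> and for the identity.\<close>

lemma moi_trace_rotate:
  assumes b: "\<And>j. j \<in> {1..k} \<Longrightarrow> b j \<in> bounded_ops (H (j+1)) (H j)"
    and bn: "b (k+1) \<in> bounded_ops (H 1) (H (k+1))"
    and uv: "nuclear_rep u v (hlift (H 1) (H (k+1)) (b (k+1)))"
    and \<gamma>: "cyclic_permutation (k+1) \<gamma>"
  defines "A' \<equiv> moi k (\<Omega> \<circ> \<gamma>) (H \<circ> \<gamma>) (P \<circ> \<gamma>) \<rho> (\<phi>s \<circ> \<gamma>) (b \<circ> \<gamma>)"
  defines "B' \<equiv> compose (carrier (H (\<gamma> 1))) A' (b (\<gamma> (k+1)))"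
  shows "has_pettis_integral (H (\<gamma> (k+1))) (H (\<gamma> 1)) \<rho>
      (moi_integrand k (\<Omega> \<circ> \<gamma>) (H \<circ> \<gamma>) (P \<circ> \<gamma>) (\<phi>s \<circ> \<gamma>) (b \<circ> \<gamma>)) A'"
    and "B' \<in> trace_class (H (\<gamma> 1)) (H (\<gamma> 1))"
    and "op_trace (H (\<gamma> 1)) B' = (\<Sum>n. cinner (hlift (H (k+1)) (H 1) (moi k \<Omega> H P \<rho> \<phi>s b) (v n)) (u n))"
proof -
  note cyc = cyclic_permutation_in[OF \<gamma>] cyclic_permutation_Suc[OF \<gamma>] cyclic_permutation_last[OF \<gamma>]
    cyclic_permutation_upt[OF \<gamma>]
  have perm: "\<gamma> permutes {1..k+1}" using \<gamma> by (simp add: cyclic_permutation_def)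
  let ?n = "k + 1"
  \<comment> \<open>Permuting the indices does not change the product of the norms, so the same g
    dominates.\<close>
  interpret G: moi_family k "\<Omega> \<circ> \<gamma>" "H \<circ> \<gamma>" "P \<circ> \<gamma>" \<rho> "\<phi>s \<circ> \<gamma>" g
  proof
    have "(\<Prod>j\<in>{1..k+1}. f (\<gamma> j)) = (\<Prod>j\<in>{1..k+1}. f j)" for f :: "nat \<Rightarrow> real"
      using prod.permute[OF perm, of f] by (simp add: o_def)
    note this[of "\<lambda>j. Linf_norm (\<Omega> j) (H j) (P j) (\<lambda>w. \<phi>s j (w, s))" for s]
    then show "AE s in \<rho>. (\<Prod>j\<in>{1..k+1}. Linf_norm ((\<Omega> \<circ> \<gamma>) j) ((H \<circ> \<gamma>) j) ((P \<circ> \<gamma>) j) (\<lambda>w. (\<phi>s \<circ> \<gamma>) j (w, s))) \<le> g s"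
      using g_dominating by simp
  qed (use cyc(1) pvm \<phi>s_measurable \<phi>s_Linf g_integrable in auto)
  \<comment> \<open>\<open>cyclic_next\<close> wraps k+1 to 1, so this family includes the lift of
    \<open>b (k+1)\<close> and is compatible with relabelling by \<gamma>.\<close>
  define \<beta> where "\<beta> j = hlift (H (cyclic_next ?n j)) (H j) (b j)" for j
  have bb: "b j \<in> bounded_ops (H (cyclic_next ?n j)) (H j)" if "j \<in> {1..?n}" for j
  proof (cases "j = ?n")
    case True
    then show ?thesis using bn by (simp add: cyclic_next_def)
  next
    case False
    then show ?thesis using b[of j] that by (simp add: cyclic_next_def)
  qed
  have b\<gamma>: "(b \<circ> \<gamma>) j \<in> bounded_ops ((H \<circ> \<gamma>) (j+1)) ((H \<circ> \<gamma>) j)" if "j \<in> {1..k}" for j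
    using bb[OF cyc(1)[of j]] cyc(2)[of j] that by simp
  have A'_pettis: "has_pettis_integral ((H \<circ> \<gamma>) (k+1)) ((H \<circ> \<gamma>) 1) \<rho>
      (moi_integrand k (\<Omega> \<circ> \<gamma>) (H \<circ> \<gamma>) (P \<circ> \<gamma>) (\<phi>s \<circ> \<gamma>) (b \<circ> \<gamma>)) A'"
    unfolding A'_def by (rule G.has_pettis_integral_moi[OF b\<gamma>])
  then show "has_pettis_integral (H (\<gamma> (k+1))) (H (\<gamma> 1)) \<rho>
      (moi_integrand k (\<Omega> \<circ> \<gamma>) (H \<circ> \<gamma>) (P \<circ> \<gamma>) (\<phi>s \<circ> \<gamma>) (b \<circ> \<gamma>)) A'" by simp
  have A'_in: "A' \<in> bounded_ops (H (\<gamma> ?n)) (H (\<gamma> 1))"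
    using A'_pettis by (simp add: has_pettis_integral_def)
  have Gs: "G.symbol_op j s = symbol_op (\<gamma> j) s" for j s
    by (simp add: G.symbol_op_def symbol_op_def)
  have b_last: "b (\<gamma> ?n) \<in> bounded_ops (H (\<gamma> 1)) (H (\<gamma> ?n))"
    using bb[OF cyc(1)[of ?n]] cyc(3) by simp
  have hil: "hilbert_space (H (\<gamma> 1))" "hilbert_space (H (\<gamma> ?n))" using hilbert cyc(1) by auto
  have B'_in: "B' \<in> bounded_ops (H (\<gamma> 1)) (H (\<gamma> 1))"
    unfolding B'_def by (rule compose_in_bounded_ops[OF hil(1,2,1) b_last A'_in])
  have "has_weak_integral \<rho>
      (\<lambda>s z. opchain (\<lambda>i. symbol_op (\<gamma> i) s) (\<lambda>i. \<beta> (\<gamma> i)) [1..<k+1] (symbol_op (\<gamma> ?n) s z))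
      (hlift (H (\<gamma> ?n)) (H (\<gamma> 1)) A')"
  proof (rule has_weak_integral_cong[THEN iffD1])
    show "has_weak_integral \<rho> (\<lambda>s z. opchain (\<lambda>i. G.symbol_op i s)
        (\<lambda>j. hlift ((H \<circ> \<gamma>) (j+1)) ((H \<circ> \<gamma>) j) ((b \<circ> \<gamma>) j)) [1..<k+1] (G.symbol_op (k+1) s z))
      (hlift (H (\<gamma> ?n)) (H (\<gamma> 1)) A')"
      using G.has_weak_integral_moi[of "b \<circ> \<gamma>", OF b\<gamma>] unfolding A'_def by (simp only: comp_apply)
    show "opchain (\<lambda>i. G.symbol_op i s) (\<lambda>j. hlift ((H \<circ> \<gamma>) (j+1)) ((H \<circ> \<gamma>) j) ((b \<circ> \<gamma>) j)) [1..<k+1]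
        (G.symbol_op (k+1) s z) = opchain (\<lambda>i. symbol_op (\<gamma> i) s) (\<lambda>i. \<beta> (\<gamma> i)) [1..<k+1] (symbol_op (\<gamma> ?n) s z)" for s z
      unfolding Gs by (rule opchain_cong) (use cyc(2) in \<open>auto simp: \<beta>_def\<close>)
  qed
  \<comment> \<open>Composing with \<open>b (\<gamma> (k+1))\<close> completes the chain to all k+1
    indices, in the order of their values under \<gamma>.\<close>
  then have "has_weak_integral \<rho> (\<lambda>s z. opchain (\<lambda>i. symbol_op (\<gamma> i) s) (\<lambda>i. \<beta> (\<gamma> i)) [1..<k+1]
        (symbol_op (\<gamma> ?n) s (\<beta> (\<gamma> ?n) z))) (\<lambda>z. hlift (H (\<gamma> ?n)) (H (\<gamma> 1)) A' (\<beta> (\<gamma> ?n) z))"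
    by (rule has_weak_integral_compose) (use bounded_clinear_hlift[OF hil b_last] cyc(3) in \<open>simp add: \<beta>_def\<close>)
  moreover have "(\<lambda>z. hlift (H (\<gamma> ?n)) (H (\<gamma> 1)) A' (\<beta> (\<gamma> ?n) z)) = hlift (H (\<gamma> 1)) (H (\<gamma> 1)) B'"
  proof -
    have "cyclic_next ?n (\<gamma> ?n) = \<gamma> 1" using cyc(3) by simp
    then have "\<beta> (\<gamma> ?n) = hlift (H (\<gamma> 1)) (H (\<gamma> ?n)) (b (\<gamma> ?n))" by (simp only: \<beta>_def)
    then show ?thesis by (simp only: fun_eq_iff B'_def hlift_compose[OF hil(1,2,1) b_last A'_in]) simp
  qed
  moreover have "opchain (\<lambda>i. symbol_op (\<gamma> i) s) (\<lambda>i. \<beta> (\<gamma> i)) [1..<k+1] (symbol_op (\<gamma> ?n) s (\<beta> (\<gamma> ?n) z))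
      = opchain (\<lambda>i. symbol_op i s) \<beta> (map \<gamma> [1..<?n+1]) z" for s z
  proof -
    have up: "[1..<?n+1] = [1..<k+1] @ [?n]" by (simp add: upt_Suc_append)
    show ?thesis by (simp only: up map_append list.map opchain_simps)
  qed
  ultimately have W: "has_weak_integral \<rho> (\<lambda>s. opchain (\<lambda>i. symbol_op i s) \<beta> ([\<gamma> 1..<k+2] @ [1..<\<gamma> 1]))
      (hlift (H (\<gamma> 1)) (H (\<gamma> 1)) B')"
    using cyc(4) by (simp del: opchain_simps upt_Suc)
  have \<beta>b: "bounded_clinear (\<beta> i)" if "i \<in> {1..k}" for i
    unfolding \<beta>_def using that hilbert by (intro bounded_clinear_hlift bb) (auto simp: cyclic_next_def)
  have \<beta>n: "nuclear_rep u v (\<beta> (k+1))" using uv by (simp add: \<beta>_def cyclic_next_def)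
  have A: "has_weak_integral \<rho> (\<lambda>s x. opchain (\<lambda>i. symbol_op i s) \<beta> [1..<k+1] (symbol_op (k+1) s x))
      (hlift (H (k+1)) (H 1) (moi k \<Omega> H P \<rho> \<phi>s b))"
  proof (rule has_weak_integral_cong[THEN iffD1, OF _ has_weak_integral_moi[OF b]])
    show "opchain (\<lambda>i. symbol_op i s) (\<lambda>j. hlift (H (j+1)) (H j) (b j)) [1..<k+1] (symbol_op (k+1) s x)
      = opchain (\<lambda>i. symbol_op i s) \<beta> [1..<k+1] (symbol_op (k+1) s x)" for s x
      by (rule opchain_cong) (auto simp: \<beta>_def cyclic_next_def)
  qed
  have g1: "\<gamma> 1 \<in> {1..k+1}" using cyc(1)[of 1] by simp
  obtain M where "trace_bound (hlift (H (\<gamma> 1)) (H (\<gamma> 1)) B') M"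
    using chain_trace_rotate(1)[OF \<beta>b \<beta>n g1 A W] by blast
  then show "B' \<in> trace_class (H (\<gamma> 1)) (H (\<gamma> 1))"
    by (rule trace_classI[OF hil(1) hil(1) B'_in])
  show "op_trace (H (\<gamma> 1)) B' = (\<Sum>n. cinner (hlift (H (k+1)) (H 1) (moi k \<Omega> H P \<rho> \<phi>s b) (v n)) (u n))"
    by (rule op_trace_eqI[OF hil(1) hil(1) B'_in chain_trace_rotate(2)[OF \<beta>b \<beta>n g1 A W]])
qed

text \<open>Isolates slot i between two families that do not depend on c; linearity and the trace
  duality in c are read off from this form.\<close>

lemma has_weak_integral_moi_upd:
  assumes b: "\<And>j. j \<in> {1..k} \<Longrightarrow> b j \<in> bounded_ops (H (j+1)) (H j)"
    and i: "i \<in> {1..k}" and c: "c \<in> bounded_ops (H (i+1)) (H i)"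
  shows "has_weak_integral \<rho> (\<lambda>s z. opchain (\<lambda>i. symbol_op i s) (\<lambda>j. hlift (H (j+1)) (H j) (b j)) [1..<i]
     (symbol_op i s (hlift (H (i+1)) (H i) c
       (opchain (\<lambda>i. symbol_op i s) (\<lambda>j. hlift (H (j+1)) (H j) (b j)) [i+1..<k+1] (symbol_op (k+1) s z)))))
     (hlift (H (k+1)) (H 1) (moi k \<Omega> H P \<rho> \<phi>s (b(i := c))))"
proof (rule has_weak_integral_cong[THEN iffD1, OF _ has_weak_integral_moi])
  let ?\<beta> = "\<lambda>j. hlift (H (j+1)) (H j) (b j)"
  let ?\<beta>' = "\<lambda>j. hlift (H (j+1)) (H j) ((b(i := c)) j)"
  have l: "[1..<k+1] = [1..<i] @ i # [i+1..<k+1]"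
    using i upt_add_eq_append[of 1 i "k+1-i"] upt_conv_Cons[of i "k+1"] by (simp del: upt_Suc)
  have "opchain a ?\<beta>' [1..<i] z = opchain a ?\<beta> [1..<i] z"
    "opchain a ?\<beta>' [i+1..<k+1] z = opchain a ?\<beta> [i+1..<k+1] z" for a z
    by (rule opchain_cong; auto)+
  then show "opchain (\<lambda>i. symbol_op i s) ?\<beta>' [1..<k+1] (symbol_op (k+1) s z) =
     opchain (\<lambda>i. symbol_op i s) ?\<beta> [1..<i] (symbol_op i s (hlift (H (i+1)) (H i) c
       (opchain (\<lambda>i. symbol_op i s) ?\<beta> [i+1..<k+1] (symbol_op (k+1) s z))))" for s z
    unfolding l by (simp del: upt_Suc)
  show "(b(i := c)) j \<in> bounded_ops (H (j+1)) (H j)" if "j \<in> {1..k}" for j using b[OF that] c by auto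
qed

text \<open>After transfer both sides are weak integrals of the same integrand, and weak integrals
  are unique.\<close>

lemma
  assumes b: "\<And>j. j \<in> {1..k} \<Longrightarrow> b j \<in> bounded_ops (H (j+1)) (H j)"
    and i: "i \<in> {1..k}" and c: "c \<in> bounded_ops (H (i+1)) (H i)"
  shows moi_upd_add: "d \<in> bounded_ops (H (i+1)) (H i) \<Longrightarrow>
      moi k \<Omega> H P \<rho> \<phi>s (b(i := op_add (H (i+1)) (H i) c d)) =
      op_add (H (k+1)) (H 1) (moi k \<Omega> H P \<rho> \<phi>s (b(i := c))) (moi k \<Omega> H P \<rho> \<phi>s (b(i := d)))"
    and moi_upd_scale: "moi k \<Omega> H P \<rho> \<phi>s (b(i := op_scale (H (i+1)) (H i) a c)) =
      op_scale (H (k+1)) (H 1) a (moi k \<Omega> H P \<rho> \<phi>s (b(i := c)))"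
proof -
  let ?\<beta> = "\<lambda>j. hlift (H (j+1)) (H j) (b j)"
  have hil: "hilbert_space (H 1)" "hilbert_space (H i)" "hilbert_space (H (i+1))" "hilbert_space (H (k+1))"
    using hilbert i by auto
  have moi_in': "moi k \<Omega> H P \<rho> \<phi>s (b(i := d)) \<in> bounded_ops (H (k+1)) (H 1)"
    if "d \<in> bounded_ops (H (i+1)) (H i)" for d
    by (rule moi_in) (use b that in auto)
  define X where "X s z = opchain (\<lambda>i. symbol_op i s) ?\<beta> [1..<i] (symbol_op i s z)" for s z
  define Y where "Y s z = opchain (\<lambda>i. symbol_op i s) ?\<beta> [i+1..<k+1] (symbol_op (k+1) s z)" for s z
  have W: "has_weak_integral \<rho> (\<lambda>s z. X s (hlift (H (i+1)) (H i) d (Y s z)))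
     (hlift (H (k+1)) (H 1) (moi k \<Omega> H P \<rho> \<phi>s (b(i := d))))" if "d \<in> bounded_ops (H (i+1)) (H i)" for d
    using has_weak_integral_moi_upd[OF b i that] by (simp add: X_def Y_def)
  have X: "bounded_clinear (X s)" if "s \<in> space \<rho>" for s
  proof -
    have "op_family \<rho> X"
      unfolding X_def[abs_def]
    proof (rule op_family_chain_symbol)
      show "bounded_clinear (?\<beta> j)" if "j \<in> set [1..<i]" for j
        using that i hilbert by (intro bounded_clinear_hlift b) auto
    qed (use i in auto)
    from op_family_clinear[OF this that] show ?thesis .
  qed
  show "moi k \<Omega> H P \<rho> \<phi>s (b(i := op_add (H (i+1)) (H i) c d)) =
      op_add (H (k+1)) (H 1) (moi k \<Omega> H P \<rho> \<phi>s (b(i := c))) (moi k \<Omega> H P \<rho> \<phi>s (b(i := d)))"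
    if d: "d \<in> bounded_ops (H (i+1)) (H i)"
  proof (rule hlift_inject[OF hil(4,1)])
    note cd = op_add_in[OF hil(3,2) c d]
    show "moi k \<Omega> H P \<rho> \<phi>s (b(i := op_add (H (i+1)) (H i) c d)) \<in> bounded_ops (H (k+1)) (H 1)"
      by (rule moi_in'[OF cd])
    show "op_add (H (k+1)) (H 1) (moi k \<Omega> H P \<rho> \<phi>s (b(i := c))) (moi k \<Omega> H P \<rho> \<phi>s (b(i := d)))
        \<in> bounded_ops (H (k+1)) (H 1)"
      by (rule op_add_in[OF hil(4,1) moi_in'[OF c] moi_in'[OF d]])
    have "has_weak_integral \<rho> (\<lambda>s z. X s (hlift (H (i+1)) (H i) (op_add (H (i+1)) (H i) c d) (Y s z)))
      (\<lambda>z. hlift (H (k+1)) (H 1) (moi k \<Omega> H P \<rho> \<phi>s (b(i := c))) z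
         + hlift (H (k+1)) (H 1) (moi k \<Omega> H P \<rho> \<phi>s (b(i := d))) z)"
      by (rule has_weak_integral_cong[THEN iffD2, OF _ has_weak_integral_add[OF W[OF c] W[OF d]]])
         (simp only: hlift_op_add[OF hil(3,2) c d] bounded_clinear_add[OF X])
    from has_weak_integral_unique[OF W[OF cd] this]
    show "hlift (H (k+1)) (H 1) (moi k \<Omega> H P \<rho> \<phi>s (b(i := op_add (H (i+1)) (H i) c d))) =
      hlift (H (k+1)) (H 1) (op_add (H (k+1)) (H 1) (moi k \<Omega> H P \<rho> \<phi>s (b(i := c))) (moi k \<Omega> H P \<rho> \<phi>s (b(i := d))))"
      by (simp only: fun_eq_iff hlift_op_add[OF hil(4,1) moi_in'[OF c] moi_in'[OF d]]) simp
  qed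
  show "moi k \<Omega> H P \<rho> \<phi>s (b(i := op_scale (H (i+1)) (H i) a c)) =
      op_scale (H (k+1)) (H 1) a (moi k \<Omega> H P \<rho> \<phi>s (b(i := c)))"
  proof (rule hlift_inject[OF hil(4,1)])
    note ac = op_scale_in[OF hil(3,2) c, of a]
    show "moi k \<Omega> H P \<rho> \<phi>s (b(i := op_scale (H (i+1)) (H i) a c)) \<in> bounded_ops (H (k+1)) (H 1)"
      by (rule moi_in'[OF ac])
    show "op_scale (H (k+1)) (H 1) a (moi k \<Omega> H P \<rho> \<phi>s (b(i := c))) \<in> bounded_ops (H (k+1)) (H 1)"
      by (rule op_scale_in[OF hil(4,1) moi_in'[OF c]])
    have "has_weak_integral \<rho> (\<lambda>s z. X s (hlift (H (i+1)) (H i) (op_scale (H (i+1)) (H i) a c) (Y s z)))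
      (\<lambda>z. a *\<^sub>C hlift (H (k+1)) (H 1) (moi k \<Omega> H P \<rho> \<phi>s (b(i := c))) z)"
      by (rule has_weak_integral_cong[THEN iffD2, OF _ has_weak_integral_scale[OF W[OF c]]])
         (simp only: hlift_op_scale[OF hil(3,2) c] bounded_clinear_scaleC[OF X])
    from has_weak_integral_unique[OF W[OF ac] this]
    show "hlift (H (k+1)) (H 1) (moi k \<Omega> H P \<rho> \<phi>s (b(i := op_scale (H (i+1)) (H i) a c))) =
      hlift (H (k+1)) (H 1) (op_scale (H (k+1)) (H 1) a (moi k \<Omega> H P \<rho> \<phi>s (b(i := c))))"
      by (simp only: fun_eq_iff hlift_op_scale[OF hil(4,1) moi_in'[OF c]]) simp
  qed
qed

end

section \<open>Ultraweak continuity\<close>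

lemma alternating_product_cong:
  "(\<And>j. j \<in> {1..m} \<Longrightarrow> b j = b' j) \<Longrightarrow> alternating_product H A b m = alternating_product H A b' m"
  by (induction m) auto

lemma moi_cong:
  assumes "\<And>j. j \<in> {1..k} \<Longrightarrow> b j = b' j"
  shows "moi k \<Omega> H P \<rho> \<phi>s b = moi k \<Omega> H P \<rho> \<phi>s b'"
  unfolding moi_def moi_integrand_def using alternating_product_cong[of k b b', OF assms] by simp

context moi_family
begin

text \<open>With T the lift of B and the integrand written as M c L, the cyclic identity carries the
  integral of M c L T to that of c L T M, from which c can be pulled out. D is the integral of L T
  M, and it is trace class because T has a nuclear representation.\<close>

lemma op_trace_moi_upd:
  assumes b: "\<And>j. j \<in> {1..k} \<Longrightarrow> b j \<in> bounded_ops (H (j+1)) (H j)"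
    and i: "i \<in> {1..k}" and B: "B \<in> trace_class (H 1) (H (k+1))"
  shows "\<exists>D\<in>trace_class (H i) (H (i+1)). \<forall>c\<in>bounded_ops (H (i+1)) (H i).
    op_trace (H 1) (compose (carrier (H 1)) (moi k \<Omega> H P \<rho> \<phi>s (b(i := c))) B) =
    op_trace (H i) (compose (carrier (H i)) c D)"
proof -
  let ?\<beta> = "\<lambda>j. hlift (H (j+1)) (H j) (b j)"
  \<comment> \<open>M ends in the symbol i with no operator after it; the identity in slot i gives
    it the shape required by \<open>chain_dominated\<close>.\<close>
  let ?\<beta>' = "(\<lambda>j. hlift (H (j+1)) (H j) (b j))(i := \<lambda>x. x)"
  have hil: "hilbert_space (H 1)" "hilbert_space (H i)" "hilbert_space (H (i+1))" "hilbert_space (H (k+1))"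
    using hilbert i by auto
  interpret Hi: hilbert_space "H i" by (rule hil(2))
  interpret Hi1: hilbert_space "H (i+1)" by (rule hil(3))
  have Bb: "B \<in> bounded_ops (H 1) (H (k+1))" using B by (simp add: trace_class_def)
  let ?T = "hlift (H 1) (H (k+1)) B"
  obtain u v where uv: "nuclear_rep u v ?T" using trace_class_imp_nuclear_rep[OF hil(1,4) B] by blast
  define L where "L s x = opchain (\<lambda>i. symbol_op i s) ?\<beta> [i+1..<k+1] (symbol_op (k+1) s x)" for s x
  define M where "M s x = opchain (\<lambda>i. symbol_op i s) ?\<beta> [1..<i] (symbol_op i s x)" for s x
  have \<beta>: "bounded_clinear (?\<beta> j)" if "j \<in> {1..k}" for j
    using that hilbert by (intro bounded_clinear_hlift b) auto
  have L: "op_family \<rho> L"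
    unfolding L_def[abs_def] by (rule op_family_chain_symbol) (use \<beta> i in auto)
  have M: "op_family \<rho> M"
    unfolding M_def[abs_def] by (rule op_family_chain_symbol) (use \<beta> i in auto)
  have up: "[1..<i+1] = [1..<i] @ [i]" using i by (simp add: upt_Suc_append)
  have L': "opchain (\<lambda>i. symbol_op i s) ?\<beta>' [i+1..<k+1] (symbol_op (k+1) s x) = L s x" for s x
    unfolding L_def by (rule opchain_cong) auto
  have M': "opchain (\<lambda>i. symbol_op i s) ?\<beta>' [1..<i+1] x = M s x" for s x
  proof -
    have "opchain (\<lambda>i. symbol_op i s) ?\<beta>' [1..<i+1] x = opchain (\<lambda>i. symbol_op i s) ?\<beta>' [1..<i] (symbol_op i s x)"
      unfolding up by simp
    also have "\<dots> = M s x" unfolding M_def by (rule opchain_cong) auto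
    finally show ?thesis .
  qed
  have "\<exists>C\<ge>0. AE s in \<rho>. \<exists>l m. 0 \<le> l \<and> 0 \<le> m \<and>
      (\<forall>x. norm (opchain (\<lambda>i. symbol_op i s) ?\<beta>' [i+1..<k+1] (symbol_op (k+1) s x)) \<le> l * norm x) \<and>
      (\<forall>x. norm (opchain (\<lambda>i. symbol_op i s) ?\<beta>' [1..<i+1] x) \<le> m * norm x) \<and> l * m \<le> C * g s"
  proof (rule chain_dominated)
    show "set ([i+1..<k+1] @ (k+1) # [1..<i+1]) = {1..k+1}" "distinct ([i+1..<k+1] @ (k+1) # [1..<i+1])"
      using i by auto
    show "bounded_clinear (?\<beta>' j)" if "j \<in> set ([i+1..<k+1] @ [1..<i+1])" for j
      using \<beta>[of j] that i by auto
  qed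
  then obtain C where le: "AE s in \<rho>. \<exists>l m. 0 \<le> l \<and> 0 \<le> m \<and> (\<forall>x. norm (L s x) \<le> l * norm x) \<and>
      (\<forall>x. norm (M s x) \<le> m * norm x) \<and> l * m \<le> C * g s"
    unfolding L' M' by blast
  have Cg: "integrable \<rho> (\<lambda>s. C * g s)" using g_integrable by auto
  obtain D' where D': "has_weak_integral \<rho> (\<lambda>s x. L s (?T (M s x))) D'"
    using weak_integral_compose_exists[OF L M bounded_clinear_hlift[OF hil(1,4) Bb] Cg le] by blast
  have bD': "bounded_clinear D'" using D' by (simp add: has_weak_integral_def)
  have "L s x \<in> hspace (H (i+1))" if "s \<in> space \<rho>" for s x
    unfolding L_def by (rule chain_symbol_in[OF _ that]) (use i in auto)
  then have D'_in: "D' x \<in> hspace (H (i+1))" for x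
    by (intro has_weak_integral_in[OF D' Hi1.hspace]) auto
  have "M s (cproj (hspace (H i)) x) = M s x" for s x
    by (simp add: M_def symbol_op_def hlift_cproj[OF hil(2,2)])
  then have D'_proj: "D' (cproj (hspace (H i)) x) = D' x" for x
    using has_weak_integral_unique[OF has_weak_integral_compose[OF D' bounded_clinear_cproj[OF Hi.hspace]]] D'
    by (simp add: fun_eq_iff)
  define D where "D = hdrop (H i) (H (i+1)) D'"
  have D_lift: "hlift (H i) (H (i+1)) D x = D' x" for x
    unfolding D_def hlift_hdrop[OF hil(2,3) bD' D'_in] by (rule D'_proj)
  have D_in: "D \<in> bounded_ops (H i) (H (i+1))"
    unfolding D_def by (rule hdrop_in[OF hil(2,3) bD' D'_in])
  have "hlift (H i) (H (i+1)) D = D'" by (rule ext) (rule D_lift)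
  then have D_tc: "D \<in> trace_class (H i) (H (i+1))"
    using weak_integral_compose_trace_bound(2)[OF op_family_clinear[OF L] op_family_clinear[OF M] uv Cg le D']
    by (intro trace_classI[OF hil(2,3) D_in]) auto
  show ?thesis
  proof (rule bexI[OF _ D_tc], rule ballI)
    fix c assume c: "c \<in> bounded_ops (H (i+1)) (H i)"
    let ?c = "hlift (H (i+1)) (H i) c" and ?A = "hlift (H (k+1)) (H 1) (moi k \<Omega> H P \<rho> \<phi>s (b(i := c)))"
    \<comment> \<open>\<open>moi_trace_rotate\<close> expects the trace class operator in slot k+1;
      the integral itself reads only the slots 1, ..., k.\<close>
    let ?b = "b(i := c, k+1 := B)"
    have bc: "bounded_clinear ?c" by (rule bounded_clinear_hlift[OF hil(3,2) c])
    have moi_b: "moi k \<Omega> H P \<rho> \<phi>s ?b = moi k \<Omega> H P \<rho> \<phi>s (b(i := c))" by (rule moi_cong) auto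
    have "op_trace (H (id 1)) (compose (carrier (H (id 1))) (moi k (\<Omega> \<circ> id) (H \<circ> id) (P \<circ> id) \<rho> (\<phi>s \<circ> id) (?b \<circ> id)) (?b (id (k+1))))
       = (\<Sum>n. cinner (hlift (H (k+1)) (H 1) (moi k \<Omega> H P \<rho> \<phi>s ?b) (v n)) (u n))"
      by (rule moi_trace_rotate(3)[OF _ _ _ cyclic_permutation_id]) (use b c Bb uv i in auto)
    then have 1: "op_trace (H 1) (compose (carrier (H 1)) (moi k \<Omega> H P \<rho> \<phi>s (b(i := c))) B)
       = (\<Sum>n. cinner (?A (v n)) (u n))"
      by (simp only: id_apply comp_id fun_upd_same moi_b)
    obtain K where K: "0 < K" "\<And>x. norm (?c x) \<le> K * norm x" using bounded_clinear_bound[OF bc] by blast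
    have cL: "op_family \<rho> (\<lambda>s x. ?c (L s x))" by (rule op_family_compose[OF op_family_const[OF bc] L])
    have le': "AE s in \<rho>. \<exists>l m. 0 \<le> l \<and> 0 \<le> m \<and> (\<forall>x. norm (?c (L s x)) \<le> l * norm x) \<and>
      (\<forall>x. norm (M s x) \<le> m * norm x) \<and> l * m \<le> K * (C * g s)"
      using le
    proof eventually_elim
      case (elim s)
      then obtain l m where lm: "0 \<le> l" "0 \<le> m" "\<And>x. norm (L s x) \<le> l * norm x"
        "\<And>x. norm (M s x) \<le> m * norm x" "l * m \<le> C * g s" by blast
      have "norm (?c (L s x)) \<le> (K * l) * norm x" for x
        using order_trans[OF K(2) mult_left_mono[OF lm(3)]] K(1) by (simp add: mult.assoc)
      moreover have "(K * l) * m \<le> K * (C * g s)" using mult_left_mono[OF lm(5), of K] K(1) by (simp add: mult.assoc)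
      moreover have "0 \<le> K * l" using K(1) lm(1) by simp
      ultimately show ?case using lm(2,4) by blast
    qed
    have A: "has_weak_integral \<rho> (\<lambda>s x. M s (?c (L s x))) ?A"
      using has_weak_integral_moi_upd[OF b i c] by (simp only: M_def L_def)
    have cD: "has_weak_integral \<rho> (\<lambda>s x. ?c (L s (?T (M s x)))) (\<lambda>x. ?c (D' x))"
      by (rule has_weak_integral_left_compose[OF D' bc])
    \<comment> \<open>The rotation of the trace is used with c absorbed into the left factor; the
      weak integral of M c L is the lifted integral for the updated tuple.\<close>
    have "op_trace (H i) (compose (carrier (H i)) c D) = (\<Sum>n. cinner (?A (v n)) (u n))"
    proof (rule op_trace_eqI[OF hil(2,2) compose_in_bounded_ops[OF hil(2,3,2) D_in c]])
      fix E assume E: "onb (hspace (H i)) E"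
      have "integrable \<rho> (\<lambda>s. K * (C * g s))" using Cg by auto
      from weak_integral_trace_rotate[OF cL M uv Hi.hspace E hlift_in[OF hil(3,2) c] this le' A cD]
      show "((\<lambda>e. cinner (hlift (H i) (H i) (compose (carrier (H i)) c D) e) e) has_sum
          (\<Sum>n. cinner (?A (v n)) (u n))) E"
        by (simp only: hlift_compose[OF hil(2,3,2) D_in c] D_lift)
    qed
    then show "op_trace (H 1) (compose (carrier (H 1)) (moi k \<Omega> H P \<rho> \<phi>s (b(i := c))) B) =
        op_trace (H i) (compose (carrier (H i)) c D)" using 1 by simp
  qed
qed

text \<open>The target topology is initial for the functionals given by trace class operators B.
  Pulled back to c, each of them is the functional given by D, and this is continuous for the source
  topology by definition.\<close>

lemma continuous_map_moi_upd:
  assumes b: "\<And>j. j \<in> {1..k} \<Longrightarrow> b j \<in> bounded_ops (H (j+1)) (H j)" and i: "i \<in> {1..k}"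
  shows "continuous_map (ultraweak_topology (H (i+1)) (H i)) (ultraweak_topology (H (k+1)) (H 1))
     (\<lambda>c. moi k \<Omega> H P \<rho> \<phi>s (b(i := c)))"
proof -
  let ?X = "ultraweak_topology (H (i+1)) (H i)"
  let ?f = "\<lambda>A. \<lambda>B\<in>trace_class (H i) (H (i+1)). op_trace (H i) (compose (carrier (H i)) A B)"
  have top: "topspace ?X \<subseteq> bounded_ops (H (i+1)) (H i)"
    by (auto simp: ultraweak_topology_def topspace_pullback_topology)
  show ?thesis
    unfolding ultraweak_topology_def[of "H (k+1)"]
  proof (rule continuous_map_pullback')
    show "topspace ?X \<subseteq> (\<lambda>c. moi k \<Omega> H P \<rho> \<phi>s (b(i := c))) -` bounded_ops (H (k+1)) (H 1)"
    proof
      fix c assume "c \<in> topspace ?X"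
      then have "c \<in> bounded_ops (H (i+1)) (H i)" using top by blast
      then have "moi k \<Omega> H P \<rho> \<phi>s (b(i := c)) \<in> bounded_ops (H (k+1)) (H 1)"
        using b by (intro moi_in) auto
      then show "c \<in> (\<lambda>c. moi k \<Omega> H P \<rho> \<phi>s (b(i := c))) -` bounded_ops (H (k+1)) (H 1)" by simp
    qed
    show "continuous_map ?X (product_topology (\<lambda>B. euclidean) (trace_class (H 1) (H (k+1))))
      ((\<lambda>A. \<lambda>B\<in>trace_class (H 1) (H (k+1)). op_trace (H 1) (compose (carrier (H 1)) A B)) \<circ>
        (\<lambda>c. moi k \<Omega> H P \<rho> \<phi>s (b(i := c))))"
      unfolding continuous_map_componentwise
    proof (intro conjI ballI)
      fix B assume B: "B \<in> trace_class (H 1) (H (k+1))"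
      obtain D where D: "D \<in> trace_class (H i) (H (i+1))" and tr: "\<And>c. c \<in> bounded_ops (H (i+1)) (H i) \<Longrightarrow>
          op_trace (H 1) (compose (carrier (H 1)) (moi k \<Omega> H P \<rho> \<phi>s (b(i := c))) B) =
          op_trace (H i) (compose (carrier (H i)) c D)"
        using op_trace_moi_upd[OF b i B] by blast
      have "continuous_map (product_topology (\<lambda>B. euclidean) (trace_class (H i) (H (i+1)))) euclidean
          (\<lambda>h :: ('h \<Rightarrow> 'h) \<Rightarrow> complex. h D)"
        by (rule continuous_map_product_projection[OF D])
      from continuous_map_pullback[OF this, of "bounded_ops (H (i+1)) (H i)" ?f]
      have "continuous_map ?X euclidean ((\<lambda>h. h D) \<circ> ?f)" by (simp only: ultraweak_topology_def)
      then show "continuous_map ?X euclidean (\<lambda>c. ((\<lambda>A. \<lambda>B\<in>trace_class (H 1) (H (k+1)).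
          op_trace (H 1) (compose (carrier (H 1)) A B)) \<circ> (\<lambda>c. moi k \<Omega> H P \<rho> \<phi>s (b(i := c)))) c B)"
        by (rule continuous_map_eq) (use top tr B D in \<open>auto simp: subset_iff\<close>)
    qed auto
  qed
qed

end

theorem corollary4p2p11:
  fixes k :: nat
    and \<Omega> :: "nat \<Rightarrow> 'w measure"
    and H :: "nat \<Rightarrow> 'h hilb"
    and P :: "nat \<Rightarrow> 'w set \<Rightarrow> 'h \<Rightarrow> 'h"
    and T :: "'t hilb"
    and \<tau> :: "(nat \<Rightarrow> 'h) \<Rightarrow> 't"
    and Q :: "(nat \<Rightarrow> 'w) set \<Rightarrow> 't \<Rightarrow> 't"
    and \<phi> :: "(nat \<Rightarrow> 'w) \<Rightarrow> complex"
    and \<rho> :: "'s measure"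
    and \<phi>s :: "nat \<Rightarrow> 'w \<times> 's \<Rightarrow> complex"
  assumes "1 \<le> k"
    and "\<And>j. j \<in> {1..k+1} \<Longrightarrow> pvm_space (\<Omega> j) (H j) (P j)"
    and "hilbert_tensor_product {1..k+1} H T \<tau>"
    and "product_pvm {1..k+1} \<Omega> H P T \<tau> Q"
    and "integral_projective_decomposition {1..k+1} \<Omega> H P T Q \<phi> \<rho> \<phi>s"
  shows
    "(\<forall>b \<gamma>. (\<forall>j\<in>{1..k}. b j \<in> bounded_ops (H (j+1)) (H j)) \<and>
        b (k+1) \<in> trace_class (H 1) (H (k+1)) \<and> cyclic_permutation (k+1) \<gamma> \<longrightarrow>
        (let A = moi k \<Omega> H P \<rho> \<phi>s b;
             A' = moi k (\<Omega> \<circ> \<gamma>) (H \<circ> \<gamma>) (P \<circ> \<gamma>) \<rho> (\<phi>s \<circ> \<gamma>) (b \<circ> \<gamma>);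
             B = compose (carrier (H 1)) A (b (k+1));
             B' = compose (carrier (H (\<gamma> 1))) A' (b (\<gamma> (k+1)))
         in has_pettis_integral (H (k+1)) (H 1) \<rho> (moi_integrand k \<Omega> H P \<phi>s b) A \<and>
            has_pettis_integral (H (\<gamma> (k+1))) (H (\<gamma> 1)) \<rho>
              (moi_integrand k (\<Omega> \<circ> \<gamma>) (H \<circ> \<gamma>) (P \<circ> \<gamma>) (\<phi>s \<circ> \<gamma>) (b \<circ> \<gamma>)) A' \<and>
            B \<in> trace_class (H 1) (H 1) \<and> B' \<in> trace_class (H (\<gamma> 1)) (H (\<gamma> 1)) \<and>
            op_trace (H 1) B = op_trace (H (\<gamma> 1)) B')) \<and>
     (\<forall>b. (\<forall>j\<in>{1..k}. b j \<in> bounded_ops (H (j+1)) (H j)) \<longrightarrow>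
        has_pettis_integral (H (k+1)) (H 1) \<rho> (moi_integrand k \<Omega> H P \<phi>s b)
          (moi k \<Omega> H P \<rho> \<phi>s b) \<and>
        (\<forall>i\<in>{1..k}.
           (\<forall>c\<in>bounded_ops (H (i+1)) (H i). \<forall>d\<in>bounded_ops (H (i+1)) (H i).
              moi k \<Omega> H P \<rho> \<phi>s (b(i := op_add (H (i+1)) (H i) c d)) =
              op_add (H (k+1)) (H 1) (moi k \<Omega> H P \<rho> \<phi>s (b(i := c)))
                (moi k \<Omega> H P \<rho> \<phi>s (b(i := d)))) \<and>
           (\<forall>a. \<forall>c\<in>bounded_ops (H (i+1)) (H i).
              moi k \<Omega> H P \<rho> \<phi>s (b(i := op_scale (H (i+1)) (H i) a c)) =
              op_scale (H (k+1)) (H 1) a (moi k \<Omega> H P \<rho> \<phi>s (b(i := c)))) \<and>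
           continuous_map (ultraweak_topology (H (i+1)) (H i))
             (ultraweak_topology (H (k+1)) (H 1))
             (\<lambda>c. moi k \<Omega> H P \<rho> \<phi>s (b(i := c)))))"
proof -
  let ?N = "\<lambda>j s. Linf_norm (\<Omega> j) (H j) (P j) (\<lambda>w. \<phi>s j (w, s))"
  note dec = assms(5)[unfolded integral_projective_decomposition_def]
  have Linf: "\<And>j s. j \<in> {1..k+1} \<Longrightarrow> s \<in> space \<rho> \<Longrightarrow> (\<lambda>w. \<phi>s j (w, s)) \<in> Linf (\<Omega> j) (H j) (P j)"
    and ui: "upper_integral \<rho> (\<lambda>s. \<Prod>j\<in>{1..k+1}. ennreal (?N j s)) < \<infinity>"
    using dec by blast+
  have N: "0 \<le> max 0 (?N j s)" for j s by simp
  \<comment> \<open>\<open>ennreal\<close> truncates at 0, and \<open>Linf_norm\<close> is known to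
    be nonnegative only for s in the space of \<rho>; the maximum makes the equation valid for every
    s.\<close>
  have "(\<Prod>j\<in>{1..k+1}. ennreal (?N j s)) = ennreal (\<Prod>j\<in>{1..k+1}. max 0 (?N j s))" for s
    by (simp add: prod_ennreal[symmetric] ennreal_max_0 del: prod.cl_ivl_Suc)
  with ui have "upper_integral \<rho> (\<lambda>s. ennreal (\<Prod>j\<in>{1..k+1}. max 0 (?N j s))) < \<infinity>" by simp
  from upper_integral_dominating[OF this] obtain g where g: "integrable \<rho> g"
    "AE s in \<rho>. (\<Prod>j\<in>{1..k+1}. max 0 (?N j s)) \<le> g s" by blast
  interpret moi_family k \<Omega> H P \<rho> \<phi>s g
  proof
    have "AE s in \<rho>. s \<in> space \<rho>" by simp
    with g(2) show "AE s in \<rho>. (\<Prod>j\<in>{1..k+1}. ?N j s) \<le> g s"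
    proof eventually_elim
      case (elim s)
      have "max 0 (?N j s) = ?N j s" if "j \<in> {1..k+1}" for j
        using Linf_norm_nonneg[OF assms(2)[OF that] Linf[OF that elim(2)]] by simp
      then have "(\<Prod>j\<in>{1..k+1}. max 0 (?N j s)) = (\<Prod>j\<in>{1..k+1}. ?N j s)" by (intro prod.cong) auto
      then show ?case using elim(1) by simp
    qed
  qed (use assms(2) dec g(1) in blast)+
  show ?thesis
  proof (intro conjI allI impI ballI)
    fix b \<gamma>
    assume a: "(\<forall>j\<in>{1..k}. b j \<in> bounded_ops (H (j+1)) (H j)) \<and>
        b (k+1) \<in> trace_class (H 1) (H (k+1)) \<and> cyclic_permutation (k+1) \<gamma>"
    then have b: "\<And>j. j \<in> {1..k} \<Longrightarrow> b j \<in> bounded_ops (H (j+1)) (H j)"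
      and bn: "b (k+1) \<in> trace_class (H 1) (H (k+1))" and \<gamma>: "cyclic_permutation (k+1) \<gamma>" by auto
    have bb: "b (k+1) \<in> bounded_ops (H 1) (H (k+1))" using bn by (simp add: trace_class_def)
    obtain u v where uv: "nuclear_rep u v (hlift (H 1) (H (k+1)) (b (k+1)))"
      using trace_class_imp_nuclear_rep[OF hilbert hilbert bn] by auto
    \<comment> \<open>Both instances have the same right-hand side, computed from one nuclear
      representation of \<open>b (k+1)\<close>.\<close>
    note r = moi_trace_rotate[OF b bb uv \<gamma>] and r_id = moi_trace_rotate[OF b bb uv cyclic_permutation_id]
    show "let A = moi k \<Omega> H P \<rho> \<phi>s b;
             A' = moi k (\<Omega> \<circ> \<gamma>) (H \<circ> \<gamma>) (P \<circ> \<gamma>) \<rho> (\<phi>s \<circ> \<gamma>) (b \<circ> \<gamma>);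
             B = compose (carrier (H 1)) A (b (k+1));
             B' = compose (carrier (H (\<gamma> 1))) A' (b (\<gamma> (k+1)))
         in has_pettis_integral (H (k+1)) (H 1) \<rho> (moi_integrand k \<Omega> H P \<phi>s b) A \<and>
            has_pettis_integral (H (\<gamma> (k+1))) (H (\<gamma> 1)) \<rho>
              (moi_integrand k (\<Omega> \<circ> \<gamma>) (H \<circ> \<gamma>) (P \<circ> \<gamma>) (\<phi>s \<circ> \<gamma>) (b \<circ> \<gamma>)) A' \<and>
            B \<in> trace_class (H 1) (H 1) \<and> B' \<in> trace_class (H (\<gamma> 1)) (H (\<gamma> 1)) \<and>
            op_trace (H 1) B = op_trace (H (\<gamma> 1)) B'"
      unfolding Let_def
    proof (intro conjI)
      show "has_pettis_integral (H (k+1)) (H 1) \<rho> (moi_integrand k \<Omega> H P \<phi>s b) (moi k \<Omega> H P \<rho> \<phi>s b)"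
        by (rule has_pettis_integral_moi[OF b])
      show "compose (carrier (H 1)) (moi k \<Omega> H P \<rho> \<phi>s b) (b (k+1)) \<in> trace_class (H 1) (H 1)"
        using r_id(2) by simp
      show "op_trace (H 1) (compose (carrier (H 1)) (moi k \<Omega> H P \<rho> \<phi>s b) (b (k+1))) =
        op_trace (H (\<gamma> 1)) (compose (carrier (H (\<gamma> 1)))
          (moi k (\<Omega> \<circ> \<gamma>) (H \<circ> \<gamma>) (P \<circ> \<gamma>) \<rho> (\<phi>s \<circ> \<gamma>) (b \<circ> \<gamma>)) (b (\<gamma> (k+1))))"
        using r_id(3) r(3) by simp
    qed (use r(1,2) in simp_all)
  next
    fix b assume b: "\<forall>j\<in>{1..k}. b j \<in> bounded_ops (H (j+1)) (H j)"
    show "has_pettis_integral (H (k+1)) (H 1) \<rho> (moi_integrand k \<Omega> H P \<phi>s b) (moi k \<Omega> H P \<rho> \<phi>s b)"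
      using b by (intro has_pettis_integral_moi) blast
    fix i assume i: "i \<in> {1..k}"
    show "continuous_map (ultraweak_topology (H (i+1)) (H i)) (ultraweak_topology (H (k+1)) (H 1))
        (\<lambda>c. moi k \<Omega> H P \<rho> \<phi>s (b(i := c)))"
      using b by (intro continuous_map_moi_upd i) blast
    fix c assume c: "c \<in> bounded_ops (H (i+1)) (H i)"
    show "moi k \<Omega> H P \<rho> \<phi>s (b(i := op_scale (H (i+1)) (H i) a c)) =
        op_scale (H (k+1)) (H 1) a (moi k \<Omega> H P \<rho> \<phi>s (b(i := c)))" for a
      using b by (intro moi_upd_scale i c) blast
    show "moi k \<Omega> H P \<rho> \<phi>s (b(i := op_add (H (i+1)) (H i) c d)) =
        op_add (H (k+1)) (H 1) (moi k \<Omega> H P \<rho> \<phi>s (b(i := c))) (moi k \<Omega> H P \<rho> \<phi>s (b(i := d)))"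
      if "d \<in> bounded_ops (H (i+1)) (H i)" for d
      using b by (intro moi_upd_add i c that) blast
  qed
qed

end
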